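(* There are universal constants $\mathrm{C}, \mathrm{c} > 0$ and two randomized, polynomial-time algorithms, each of which takes as input an arbitrary standardized matrix $A$ and outputs a set $\tau$ of column indices of $A$, with the following guarantees. (a) The first algorithm produces a set $\tau$ for which $$|\tau| \geq \operatorname{st.rank}(A) \quad\text{and}\quad \|A_\tau\| \leq \mathrm{C}.$$ (b) The second algorithm produces a set $\tau$ for which $$|\tau| \geq \mathrm{c}\cdot \operatorname{st.rank}(A) \quad\text{and}\quad \kappa(A_\tau) \leq \sqrt{3}.$$
   Context: Matrices have real or complex entries. A matrix is standardized when each of its columns has unit $\ell_2$ norm. $\|\cdot\|$ is the spectral norm and $\|\cdot\|_{\mathrm F}$ is the Frobenius norm. The stable rank of a matrix is $\operatorname{st.rank}(A) = \|A\|_{\mathrm F}^2/\|A\|^2$. For a set $\tau$ of column indices, $A_\tau$ is the column submatrix of $A$ indexed by $\tau$. The condition number is $\kappa(A) = \max\{ \|Ax\|_2/\|Ay\|_2 : \|x\|_2 = \|y\|_2 = 1\}$ (infinite if $A$ has a nontrivial kernel). A universal constant is one that does not depend on the matrix or its dimensions. "Polynomial-time" means that the computational cost is polynomial in the dimensions of $A$; a randomized algorithm "produces" a set with stated properties if, on every input, its output has these properties with probability bounded below by a positive universal constant. *)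

theory Defs
  imports
    "HOL-Probability.Probability_Mass_Function"
    "HOL-Computational_Algebra.Polynomial"
    "Jordan_Normal_Form.Matrix_Kernel"
    "Jordan_Normal_Form.DL_Submatrix"
begin

section \<open>Norms, stable rank and condition number\<close>

text \<open>
  The scalar type is any real normed field; it is used at \<open>real\<close> and at \<open>complex\<close>.
  The vectors over which the norms and the condition number range have entries in the same field
  as the matrix.
\<close>

definition l2_norm :: "'a::real_normed_field Matrix.vec \<Rightarrow> real" where
  "l2_norm x = L2_set (\<lambda>i. norm (vec_index x i)) {..<dim_vec x}"

definition standardized :: "'a::real_normed_field mat \<Rightarrow> bool" where
  "standardized A \<longleftrightarrow> (\<forall>j<dim_col A. l2_norm (col A j) = 1)"

definition spectral_norm :: "'a::real_normed_field mat \<Rightarrow> real" where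
  "spectral_norm A = (SUP x\<in>{x \<in> carrier_vec (dim_col A). l2_norm x \<le> 1}. l2_norm (A *\<^sub>v x))"

definition frobenius_norm :: "'a::real_normed_field mat \<Rightarrow> real" where
  "frobenius_norm A = L2_set (\<lambda>ij. norm (A $$ ij)) ({..<dim_row A} \<times> {..<dim_col A})"

definition stable_rank :: "'a::real_normed_field mat \<Rightarrow> real" where
  "stable_rank A = (frobenius_norm A)\<^sup>2 / (spectral_norm A)\<^sup>2"

definition column_submatrix :: "'a mat \<Rightarrow> nat set \<Rightarrow> 'a mat" where
  "column_submatrix A \<tau> = submatrix A UNIV \<tau>"

definition condition_number :: "'a::real_normed_field mat \<Rightarrow> ereal" where
  "condition_number A =
     (if mat_kernel A = {0\<^sub>v (dim_col A)}
      then Sup {ereal (l2_norm (A *\<^sub>v x) / l2_norm (A *\<^sub>v y)) | x y.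
             x \<in> carrier_vec (dim_col A) \<and> y \<in> carrier_vec (dim_col A) \<and>
             l2_norm x = 1 \<and> l2_norm y = 1}
      else \<infinity>)"

section \<open>Randomized algorithms in the real arithmetic model\<close>

text \<open>
  Algorithms are programs of a small imperative language for a real random access machine: exact
  field operations and comparisons on real numbers, and the toss of a fair coin, take unit time.
  A program is a fixed finite object that serves inputs of all dimensions. Its memory consists of
  natural number variables, which are used for control and addressing, and of
  two-dimensional real arrays. Three features keep the unit-cost assumption harmless: natural
  numbers can only be added and (truncated) subtracted, so they have \<open>O(t)\<close> bits after \<open>t\<close> steps;
  there is no rounding of reals to integers; and constants are rational, so no information
  can be hidden in them. Every expression in a program has a fixed size, so charging one
  step for its evaluation changes costs by a factor that depends only on the program.
\<close>

datatype nexp =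
    NConst nat
  | NVar nat
  | NAdd nexp nexp
  | NSub nexp nexp

datatype rexp =
    RConst rat
  | ROfNat nexp
  | RGet nat nexp nexp
  | RAdd rexp rexp
  | RSub rexp rexp
  | RMul rexp rexp
  | RDiv rexp rexp

datatype bexp =
    NLess nexp nexp
  | RLess rexp rexp
  | BNot bexp
  | BAnd bexp bexp

datatype com =
    Skip
  | NSet nat nexp
  | RSet nat nexp nexp rexp
  | Toss nat
  | Seq com com
  | Cond bexp com com
  | While bexp com

record state =
  nvar :: "nat \<Rightarrow> nat"
  rarr :: "nat \<Rightarrow> nat \<Rightarrow> nat \<Rightarrow> real"

primrec nval :: "nexp \<Rightarrow> state \<Rightarrow> nat" where
  "nval (NConst k) s = k"
| "nval (NVar v) s = nvar s v"
| "nval (NAdd a b) s = nval a s + nval b s"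
| "nval (NSub a b) s = nval a s - nval b s"

primrec rval :: "rexp \<Rightarrow> state \<Rightarrow> real" where
  "rval (RConst q) s = of_rat q"
| "rval (ROfNat a) s = real (nval a s)"
| "rval (RGet r a b) s = rarr s r (nval a s) (nval b s)"
| "rval (RAdd e f) s = rval e s + rval f s"
| "rval (RSub e f) s = rval e s - rval f s"
| "rval (RMul e f) s = rval e s * rval f s"
| "rval (RDiv e f) s = rval e s / rval f s"

primrec bval :: "bexp \<Rightarrow> state \<Rightarrow> bool" where
  "bval (NLess a b) s \<longleftrightarrow> nval a s < nval b s"
| "bval (RLess e f) s \<longleftrightarrow> rval e s < rval f s"
| "bval (BNot b) s \<longleftrightarrow> \<not> bval b s"
| "bval (BAnd b c) s \<longleftrightarrow> bval b s \<and> bval c s"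

definition set_nvar :: "nat \<Rightarrow> nat \<Rightarrow> state \<Rightarrow> state" where
  "set_nvar v k s = s\<lparr>nvar := (nvar s)(v := k)\<rparr>"

definition set_rarr :: "nat \<Rightarrow> nat \<Rightarrow> nat \<Rightarrow> real \<Rightarrow> state \<Rightarrow> state" where
  "set_rarr r i j x s =
     s\<lparr>rarr := (rarr s)(r := (rarr s r)(i := (rarr s r i)(j := x)))\<rparr>"

text \<open>One step of a computation; \<^const>\<open>Skip\<close> is the halted program, which steps to itself.\<close>

primrec step :: "com \<Rightarrow> state \<Rightarrow> (com \<times> state) pmf" where
  "step Skip s = return_pmf (Skip, s)"
| "step (NSet v a) s = return_pmf (Skip, set_nvar v (nval a s) s)"
| "step (RSet r a b e) s = return_pmf (Skip, set_rarr r (nval a s) (nval b s) (rval e s) s)"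
| "step (Toss v) s =
     map_pmf (\<lambda>h. (Skip, set_nvar v (if h then 1 else 0) s)) (bernoulli_pmf (1 / 2))"
| "step (Seq p q) s =
     (if p = Skip then return_pmf (q, s)
      else map_pmf (\<lambda>(p', s'). (Seq p' q, s')) (step p s))"
| "step (Cond b p q) s = return_pmf (if bval b s then p else q, s)"
| "step (While b p) s = return_pmf (Cond b (Seq p (While b p)) Skip, s)"

primrec steps :: "nat \<Rightarrow> com \<times> state \<Rightarrow> (com \<times> state) pmf" where
  "steps 0 c = return_pmf c"
| "steps (Suc t) c = bind_pmf (step (fst c) (snd c)) (steps t)"

text \<open>
  Input: the dimensions in variables 0 and 1, the real and imaginary parts of the entries in arrays
  0 and 1; everything else is zero. Output: the set of those column indices \<open>j\<close> for which
  entry \<open>(0, j)\<close> of array 2 is nonzero.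
\<close>

definition input_state :: "complex mat \<Rightarrow> state" where
  "input_state A =
     \<lparr>nvar = (\<lambda>_. 0)(0 := dim_row A, 1 := dim_col A),
      rarr = (\<lambda>_ _ _. 0)
        (0 := (\<lambda>i j. if i < dim_row A \<and> j < dim_col A then Re (A $$ (i, j)) else 0),
         1 := (\<lambda>i j. if i < dim_row A \<and> j < dim_col A then Im (A $$ (i, j)) else 0))\<rparr>"

definition output_set :: "nat \<Rightarrow> state \<Rightarrow> nat set" where
  "output_set n s = {j. j < n \<and> rarr s 2 0 j \<noteq> 0}"

text \<open>
  The input matrices are the standardized matrices with at least one column; the stable rank
  of a matrix without columns would be \<open>0 / 0\<close>. The running time bound is for every outcome of
  the coin tosses. A real input matrix is presented to the program as a complex matrix, so the bound
  for complex matrices includes the real ones.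
\<close>

definition polynomial_time :: "com \<Rightarrow> bool" where
  "polynomial_time P \<longleftrightarrow>
     (\<exists>p :: nat poly. \<forall>A :: complex mat. standardized A \<and> 0 < dim_col A \<longrightarrow>
        (\<forall>c \<in> set_pmf (steps (poly p (dim_row A + dim_col A)) (P, input_state A)). fst c = Skip))"

text \<open>
  \<^term>\<open>produces emb P Q\<close>: with probability bounded below by a positive constant, program \<open>P\<close> halts on
  input \<open>A\<close> with an output \<open>\<tau>\<close> such that \<open>Q A \<tau>\<close>. The map \<open>emb\<close> is the inclusion of the scalar field
  into the complex numbers. Halted configurations do not change, so the probability of
  having halted with a good output is nondecreasing in the number \<open>t\<close> of steps.
\<close>

definition produces ::
  "('a::real_normed_field \<Rightarrow> complex) \<Rightarrow> com \<Rightarrow> ('a mat \<Rightarrow> nat set \<Rightarrow> bool) \<Rightarrow> bool" where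
  "produces emb P Q \<longleftrightarrow>
     (\<exists>\<delta>>0. \<forall>A. standardized A \<and> 0 < dim_col A \<longrightarrow>
        (\<exists>t. measure_pmf.prob (steps t (P, input_state (map_mat emb A)))
               {c. fst c = Skip \<and> Q A (output_set (dim_col A) (snd c))} \<ge> \<delta>))"

end

theory Submission
  imports Defs "HOL-Library.Function_Algebras"
begin

text \<open>Both parts are proved with one deterministic greedy algorithm, a form of the barrier method of
Batson, Spielman and Srivastava. Let $a_0, \dots, a_{n-1}$ be the unit columns of $A$, let
$B = \|A\|^2$, so that the stable rank is $n / B$, and let $M_\tau = \sum_{p \in \tau} a_p a_p^*$.
For a real number $t$ that is not an eigenvalue of $M_\tau$ put $R = (t - M_\tau)^{-1}$ and
$\Phi_t(\tau) = \sum_{j<n} \langle a_j, R a_j \rangle$. An upper barrier is a number $t$ above the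
spectrum of $M_\tau$, a lower barrier is a number $t$ strictly between $0$ and the spectrum of the
Gram matrix of the columns in $\tau$. They are treated simultaneously by means of a sign $s = 1$ or
$s = -1$; in both cases the requirement is $s \|A_\tau c\|^2 < s t \|c\|^2$ for all $c \ne 0$
(\<^verbatim>\<open>strictly_dominated\<close>).

Adding a column $a_j$ changes $R$ by a rank-one term with denominator $1 - q_j$, where
$q_j = \langle a_j, R a_j \rangle$, and the requirement survives exactly when $s (1 - q_j) > 0$.
This is a Schur complement computation (\<^verbatim>\<open>schur_complement_identity\<close>). Hence the
signs of the pivots $1 - q_p$ met while the columns of $\tau$ are eliminated one after the other
certify the requirement, without any eigenvalue computation.

Moving the barrier from $t$ to $t' = t + s \delta$ decreases $s \Phi$ by some $D$ with
$D \ge \delta (t'/t) \sum_j \|x_j\|^2$, where $x_j$ is the image of $a_j$ under the new resolvent.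
Adding $a_j$ afterwards increases $s \Phi$ by $w_j / (s (1 - q_j))$ with
$w_j = \sum_i |\langle a_i, x_j \rangle|^2 \le B \|x_j\|^2$. Summation over $j$ and Markov's
inequality show that for all but a small fraction of the indices $j$ the increase is at most $D$, as
long as $\delta$ is at least a constant times $B / n$ (\<^verbatim>\<open>few_bad_columns\<close>). So there is a
column that respects an upper and a lower barrier at the same time, and $k$ columns can be selected
while the barriers travel a constant distance, with $k$ of the order of the stable rank
(\<^verbatim>\<open>next_column_bounded_norm\<close>, \<^verbatim>\<open>next_column_well_conditioned\<close>). For
part (a) an upper barrier travels from $8$ to $16$, which gives norm at most $4$. For part (b) an
upper barrier travels from $7/5$ to $36/25$ and a lower barrier from $1/2$ to $12/25$; the final
quotient is $3$, so the condition number is at most $\sqrt 3$.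

The algorithm needs neither $\|A\|$ nor an eigenvalue. For each target size $k = 1, \dots, n$ it
looks greedily for columns that keep the certificate valid, with the barriers moving in $k$ equal
steps, and the largest successful $k$ determines the output. Every output is certified, and the
theory above says that every $k$ of the right order succeeds. All quantities in the certificate are
entries of the matrix $A^* R A$, which starts as $A^* A / t$ and is updated by the Sherman--Morrison
formula; this needs only field operations.

The program is written in a language of bounded loops whose meaning is a function on states and
whose running time is bounded by a polynomial that can be read off the program text
(\<^verbatim>\<open>compile_correct\<close>). It never tosses a coin, so its success probability is $1$.\<close>

section \<open>Loop programs with a static running time\<close>

text \<open>Deterministic computations. A step of the halted program to itself is excluded, so
that a computation of the first half of a sequential composition can be lifted step by step.\<close>

inductive reach :: "com \<times> state \<Rightarrow> nat \<Rightarrow> com \<times> state \<Rightarrow> bool" where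
  reach_refl: "reach c 0 c"
| reach_step: "P \<noteq> Skip \<Longrightarrow> step P s = return_pmf c \<Longrightarrow> reach c t c' \<Longrightarrow> reach (P, s) (Suc t) c'"

lemma reach_trans: "reach c t c' \<Longrightarrow> reach c' t' c'' \<Longrightarrow> reach c (t + t') c''"
  by (induction rule: reach.induct) (auto intro: reach.intros)

lemma reach_one: "P \<noteq> Skip \<Longrightarrow> step P s = return_pmf c \<Longrightarrow> reach (P, s) 1 c"
  using reach_step[OF _ _ reach_refl] by simp

lemma reach_Seq_left: "reach c t c' \<Longrightarrow> reach (Seq (fst c) Q, snd c) t (Seq (fst c') Q, snd c')"
proof (induction rule: reach.induct)
  case (reach_step P s c t c')
  then have "step (Seq P Q) s = return_pmf (Seq (fst c) Q, snd c)"
    by (simp add: case_prod_beta)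
  then show ?case using reach_step.IH by (auto intro: reach.reach_step)
qed (rule reach_refl)

lemma reach_Seq:
  assumes "reach (P, s) t (Skip, s')" "reach (Q, s') t' c"
  shows "reach (Seq P Q, s) (t + 1 + t') c"
proof -
  have "reach (Seq P Q, s) t (Seq Skip Q, s')" using reach_Seq_left[OF assms(1)] by simp
  moreover have "reach (Seq Skip Q, s') 1 (Q, s')" by (rule reach_one) auto
  ultimately show ?thesis using assms(2) by (blast intro: reach_trans)
qed

lemma steps_Skip: "steps t (Skip, s) = return_pmf (Skip, s)"
  by (induction t) (auto simp: bind_return_pmf)

lemma reach_steps: "reach c t c' \<Longrightarrow> steps (t + t') c = steps t' c'"
  by (induction rule: reach.induct) (auto simp: bind_return_pmf)

lemma reach_halted:
  assumes "reach (P, s) t (Skip, s')" "t \<le> T"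
  shows "steps T (P, s) = return_pmf (Skip, s')"
  using reach_steps[OF assms(1), of "T - t"] assms(2) by (simp add: steps_Skip)

text \<open>Every loop runs over $0, \dots, d - 1$, where $d$ is the value of a variable that well-formed
programs only let be one of the two input dimensions; this is what makes the running time a
polynomial that depends on the program text alone. In \<open>For v w p\<close> the counter is \<open>v\<close>
and the bound is \<open>w\<close>.\<close>

datatype prog =
    Nop
  | SetN nat nexp
  | SetR nat nexp nexp rexp
  | Then prog prog (infixr ";;" 60)
  | If bexp prog prog
  | For nat nat prog

primrec compile :: "prog \<Rightarrow> com" where
  "compile Nop = Skip"
| "compile (SetN v a) = NSet v a"
| "compile (SetR r a b e) = RSet r a b e"
| "compile (p ;; q) = Seq (compile p) (compile q)"
| "compile (If b p q) = Cond b (compile p) (compile q)"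
| "compile (For v w p) = Seq (NSet v (NConst 0))
     (While (NLess (NVar v) (NVar w)) (Seq (compile p) (NSet v (NAdd (NVar v) (NConst 1)))))"

primrec sem :: "prog \<Rightarrow> state \<Rightarrow> state" where
  "sem Nop = (\<lambda>s. s)"
| "sem (SetN v a) = (\<lambda>s. set_nvar v (nval a s) s)"
| "sem (SetR r a b e) = (\<lambda>s. set_rarr r (nval a s) (nval b s) (rval e s) s)"
| "sem (p ;; q) = (\<lambda>s. sem q (sem p s))"
| "sem (If b p q) = (\<lambda>s. if bval b s then sem p s else sem q s)"
| "sem (For v w p) = (\<lambda>s.
     ((\<lambda>s. set_nvar v (Suc (nvar s v)) (sem p s)) ^^ nvar s w) (set_nvar v 0 s))"

primrec assigned_vars :: "prog \<Rightarrow> nat set" where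
  "assigned_vars Nop = {}"
| "assigned_vars (SetN v a) = {v}"
| "assigned_vars (SetR r a b e) = {}"
| "assigned_vars (p ;; q) = assigned_vars p \<union> assigned_vars q"
| "assigned_vars (If b p q) = assigned_vars p \<union> assigned_vars q"
| "assigned_vars (For v w p) = insert v (assigned_vars p)"

primrec assigned_arrays :: "prog \<Rightarrow> nat set" where
  "assigned_arrays Nop = {}"
| "assigned_arrays (SetN v a) = {}"
| "assigned_arrays (SetR r a b e) = {r}"
| "assigned_arrays (p ;; q) = assigned_arrays p \<union> assigned_arrays q"
| "assigned_arrays (If b p q) = assigned_arrays p \<union> assigned_arrays q"
| "assigned_arrays (For v w p) = assigned_arrays p"

primrec well_formed :: "prog \<Rightarrow> bool" where
  "well_formed Nop \<longleftrightarrow> True"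
| "well_formed (SetN v a) \<longleftrightarrow> v \<notin> {0, 1}"
| "well_formed (SetR r a b e) \<longleftrightarrow> True"
| "well_formed (p ;; q) \<longleftrightarrow> well_formed p \<and> well_formed q"
| "well_formed (If b p q) \<longleftrightarrow> well_formed p \<and> well_formed q"
| "well_formed (For v w p) \<longleftrightarrow> v \<notin> {0, 1} \<and> w \<in> {0, 1} \<and> v \<notin> assigned_vars p \<and> well_formed p"

text \<open>The polynomial variable stands for a common bound on the two input dimensions. The constant $6$
covers the administrative steps of a loop iteration and, once more, those of entering and leaving the
loop.\<close>

primrec cost :: "prog \<Rightarrow> nat poly" where
  "cost Nop = 0"
| "cost (SetN v a) = 1"
| "cost (SetR r a b e) = 1"
| "cost (p ;; q) = cost p + cost q + 1"
| "cost (If b p q) = cost p + cost q + 1"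
| "cost (For v w p) = [:0, 1:] * (cost p + [:6:]) + [:6:]"

lemma nvar_set_nvar [simp]: "nvar (set_nvar v k s) = (nvar s)(v := k)"
  and rarr_set_nvar [simp]: "rarr (set_nvar v k s) = rarr s"
  and nvar_set_rarr [simp]: "nvar (set_rarr r i j x s) = nvar s"
  and rarr_set_rarr [simp]:
    "rarr (set_rarr r i j x s) = (rarr s)(r := (rarr s r)(i := (rarr s r i)(j := x)))"
  by (simp_all add: set_nvar_def set_rarr_def)

lemma sem_frame:
  "v \<notin> assigned_vars p \<Longrightarrow> nvar (sem p s) v = nvar s v"
  "r \<notin> assigned_arrays p \<Longrightarrow> rarr (sem p s) r = rarr s r"
proof (induction p arbitrary: s)
  case (For w b p)
  {
    case 1
    have "nvar (((\<lambda>s. set_nvar w (Suc (nvar s w)) (sem p s)) ^^ k) s) v = nvar s v" for k s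
      using For 1 by (induction k) auto
    then show ?case using 1 by simp
  next
    case 2
    have "rarr (((\<lambda>s. set_nvar w (Suc (nvar s w)) (sem p s)) ^^ k) s) r = rarr s r" for k s
      using For 2 by (induction k) auto
    then show ?case by simp
  }
qed auto

lemma well_formed_dims: "well_formed p \<Longrightarrow> v \<in> assigned_vars p \<Longrightarrow> v \<noteq> 0 \<and> v \<noteq> 1"
  by (induction p) auto

text \<open>The predicate \<open>Inv\<close> only has to carry the information under which the bound \<open>T\<close> on the
running time of the loop body is known.\<close>

lemma loop_reach:
  assumes v: "v \<noteq> w" "v \<notin> assigned_vars p" "w \<notin> assigned_vars p"
    and body: "\<And>s. Inv s \<Longrightarrow> \<exists>t \<le> T. reach (compile p, s) t (Skip, sem p s)"
    and Inv: "\<And>s. Inv s \<Longrightarrow> Inv (set_nvar v (Suc (nvar s v)) (sem p s))"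
  shows "Inv s \<Longrightarrow> nvar s v + d = nvar s w \<Longrightarrow>
    \<exists>t \<le> d * (T + 6) + 3. reach (While (NLess (NVar v) (NVar w))
        (Seq (compile p) (NSet v (NAdd (NVar v) (NConst 1)))), s) t
      (Skip, ((\<lambda>s. set_nvar v (Suc (nvar s v)) (sem p s)) ^^ d) s)"
proof (induction d arbitrary: s)
  let ?B = "Seq (compile p) (NSet v (NAdd (NVar v) (NConst 1)))"
  let ?W = "While (NLess (NVar v) (NVar w)) ?B"
  {
    case 0
    have "reach (?W, s) 1 (Cond (NLess (NVar v) (NVar w)) (Seq ?B ?W) Skip, s)"
      by (rule reach_one) auto
    moreover have "reach (Cond (NLess (NVar v) (NVar w)) (Seq ?B ?W) Skip, s) 1 (Skip, s)"
      using 0 by (intro reach_one) auto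
    ultimately have "reach (?W, s) (1 + 1) (Skip, s)" by (rule reach_trans)
    then show ?case by (intro exI[of _ "1 + 1"]) auto
  next
    case (Suc d)
    define s1 where "s1 = sem p s"
    define s2 where "s2 = set_nvar v (Suc (nvar s1 v)) s1"
    have frame: "nvar s1 v = nvar s v" "nvar s1 w = nvar s w"
      using v by (auto simp: s1_def sem_frame)
    then have s2: "s2 = set_nvar v (Suc (nvar s v)) (sem p s)" by (simp add: s2_def s1_def)
    obtain t where t: "t \<le> T" "reach (compile p, s) t (Skip, s1)"
      using body[OF Suc.prems(1)] by (auto simp: s1_def)
    have "nvar s2 v + d = nvar s2 w" using Suc.prems frame v by (simp add: s2_def)
    moreover have "Inv s2" unfolding s2 by (rule Inv[OF Suc.prems(1)])
    ultimately obtain t' where t': "t' \<le> d * (T + 6) + 3"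
      "reach (?W, s2) t' (Skip, ((\<lambda>s. set_nvar v (Suc (nvar s v)) (sem p s)) ^^ d) s2)"
      using Suc.IH by blast
    have "reach (?W, s) 1 (Cond (NLess (NVar v) (NVar w)) (Seq ?B ?W) Skip, s)"
      by (rule reach_one) auto
    moreover have "reach (Cond (NLess (NVar v) (NVar w)) (Seq ?B ?W) Skip, s) 1 (Seq ?B ?W, s)"
      using Suc.prems by (intro reach_one) auto
    moreover have "reach (?B, s) (t + 1 + 1) (Skip, s2)"
      by (rule reach_Seq[OF t(2)], rule reach_one) (auto simp: s2_def)
    note reach_Seq[OF this t'(2)]
    ultimately have "reach (?W, s) (1 + (1 + (t + 1 + 1 + 1 + t')))
        (Skip, ((\<lambda>s. set_nvar v (Suc (nvar s v)) (sem p s)) ^^ d) s2)"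
      by (blast intro: reach_trans)
    moreover have "1 + (1 + (t + 1 + 1 + 1 + t')) \<le> Suc d * (T + 6) + 3" using t t' by simp
    ultimately show ?case unfolding s2 funpow_Suc_right comp_def by blast
  }
qed

text \<open>A loop whose body costs $c$ steps costs at most $N (c + 6) + 6$ steps, because a well-formed body
changes neither the counter nor the dimensions.\<close>

lemma compile_correct:
  "well_formed p \<Longrightarrow> nvar s 0 \<le> N \<Longrightarrow> nvar s 1 \<le> N \<Longrightarrow>
    \<exists>t \<le> poly (cost p) N. reach (compile p, s) t (Skip, sem p s)"
proof (induction p arbitrary: s)
  case Nop
  show ?case by (auto intro: exI[of _ 0] reach_refl)
next
  case (SetN v a)
  show ?case by (auto intro!: exI[of _ 1] reach_one[unfolded One_nat_def])
next
  case (SetR r a b e)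
  show ?case by (auto intro!: exI[of _ 1] reach_one[unfolded One_nat_def])
next
  case (Then p q)
  obtain t where t: "t \<le> poly (cost p) N" "reach (compile p, s) t (Skip, sem p s)"
    using Then by auto
  have "nvar (sem p s) 0 = nvar s 0" "nvar (sem p s) 1 = nvar s 1"
    using well_formed_dims[of p] Then.prems by (auto intro!: sem_frame)
  then obtain t' where t': "t' \<le> poly (cost q) N" "reach (compile q, sem p s) t' (Skip, sem q (sem p s))"
    using Then.IH(2)[of "sem p s"] Then.prems by auto
  show ?case
    using reach_Seq[OF t(2) t'(2)] t(1) t'(1) by (intro exI[of _ "t + 1 + t'"]) simp
next
  case (If b p q)
  define r where "r = (if bval b s then p else q)"
  obtain t where t: "t \<le> poly (cost p) N + poly (cost q) N" "reach (compile r, s) t (Skip, sem r s)"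
  proof (cases "bval b s")
    case True
    then show ?thesis using If.IH(1)[of s] If.prems that by (auto simp: r_def intro: trans_le_add1)
  next
    case False
    then show ?thesis using If.IH(2)[of s] If.prems that by (auto simp: r_def intro: trans_le_add2)
  qed
  have "reach (compile (If b p q), s) 1 (compile r, s)"
    by (rule reach_one) (auto simp: r_def)
  from reach_trans[OF this t(2)] t(1) show ?case
    by (intro exI[of _ "1 + t"]) (auto simp: r_def)
next
  case (For v w p)
  define Inv where "Inv = (\<lambda>s :: state. nvar s 0 \<le> N \<and> nvar s 1 \<le> N)"
  have wf: "v \<noteq> 0" "v \<noteq> 1" "w \<in> {0, 1}" "v \<notin> assigned_vars p" "well_formed p"
    using For.prems by auto
  have dims: "nvar (sem p s) 0 = nvar s 0" "nvar (sem p s) 1 = nvar s 1" for s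
    using well_formed_dims[of p] wf by (auto intro!: sem_frame)
  have w: "w \<notin> assigned_vars p" using well_formed_dims[of p w] wf by auto
  define s0 where "s0 = set_nvar v 0 s"
  have Inv0: "Inv s0" using For.prems wf by (simp add: Inv_def s0_def)
  have n0: "nvar s0 v + nvar s w = nvar s0 w" using wf by (auto simp: s0_def)
  obtain t where t: "t \<le> nvar s w * (poly (cost p) N + 6) + 3"
    "reach (While (NLess (NVar v) (NVar w))
        (Seq (compile p) (NSet v (NAdd (NVar v) (NConst 1)))), s0) t
      (Skip, ((\<lambda>s. set_nvar v (Suc (nvar s v)) (sem p s)) ^^ nvar s w) s0)"
    using loop_reach[where Inv = Inv and T = "poly (cost p) N", OF _ wf(4) w _ _ Inv0 n0] wf
      For.IH dims by (auto simp: Inv_def)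
  have "reach (NSet v (NConst 0), s) 1 (Skip, s0)" by (rule reach_one) (auto simp: s0_def)
  from reach_Seq[OF this t(2)]
  have R: "reach (compile (For v w p), s) (1 + 1 + t) (Skip, sem (For v w p) s)"
    by (simp add: s0_def)
  have "nvar s w * (poly (cost p) N + 6) \<le> N * (poly (cost p) N + 6)"
    using For.prems wf by (intro mult_le_mono1) auto
  moreover have "poly (cost (For v w p)) N = N * (poly (cost p) N + 6) + 6" by simp
  ultimately have "1 + 1 + t \<le> poly (cost (For v w p)) N" using t(1) by linarith
  with R show ?case by blast
qed

lemma polynomial_time_compile:
  assumes "well_formed p"
  shows "polynomial_time (compile p)"
  unfolding polynomial_time_def
proof (intro exI[of _ "cost p"] allI impI ballI)
  fix A :: "complex mat" and c
  assume c: "c \<in> set_pmf (steps (poly (cost p) (dim_row A + dim_col A)) (compile p, input_state A))"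
  obtain t where "t \<le> poly (cost p) (dim_row A + dim_col A)"
    "reach (compile p, input_state A) t (Skip, sem p (input_state A))"
    using compile_correct[OF assms, of "input_state A" "dim_row A + dim_col A"]
    by (auto simp: input_state_def)
  from reach_halted[OF this(2,1)] c show "fst c = Skip" by simp
qed

text \<open>The compiled program tosses no coin, so the distribution after the last step is a point mass.\<close>

lemma produces_compile:
  fixes Q :: "'a::real_normed_field mat \<Rightarrow> nat set \<Rightarrow> bool"
  assumes "well_formed p"
    and "\<And>A. standardized A \<Longrightarrow> 0 < dim_col A \<Longrightarrow>
      Q A (output_set (dim_col A) (sem p (input_state (map_mat emb A))))"
  shows "produces emb (compile p) Q"
  unfolding produces_def
proof (intro exI[of _ "1::real"] conjI allI impI)
  fix A :: "'a mat" assume A: "standardized A \<and> 0 < dim_col A"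
  let ?s = "input_state (map_mat emb A)"
  obtain t where "reach (compile p, ?s) t (Skip, sem p ?s)"
    using compile_correct[OF assms(1), of ?s "nvar ?s 0 + nvar ?s 1"]
    by auto
  from reach_halted[OF this order_refl] assms(2)[of A] A
  show "\<exists>t. 1 \<le> measure_pmf.prob (steps t (compile p, ?s))
      {c. fst c = Skip \<and> Q A (output_set (dim_col A) (snd c))}"
    by (intro exI[of _ t]) (simp add: measure_return_pmf)
qed simp

text \<open>The loop rule. The invariant is stated for the state in which the counter has already been advanced,
which is the state in which the next iteration starts.\<close>

lemma sem_For_induct:
  assumes v: "v \<notin> assigned_vars p"
    and init: "I 0 (set_nvar v 0 s)"
    and step: "\<And>i s'. i < nvar s w \<Longrightarrow> nvar s' v = i \<Longrightarrow> I i s' \<Longrightarrow> I (Suc i) (set_nvar v (Suc i) (sem p s'))"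
  shows "I (nvar s w) (sem (For v w p) s)"
proof -
  define F where "F = (\<lambda>s. set_nvar v (Suc (nvar s v)) (sem p s))"
  have "k \<le> nvar s w \<Longrightarrow> nvar ((F ^^ k) (set_nvar v 0 s)) v = k \<and> I k ((F ^^ k) (set_nvar v 0 s))" for k
  proof (induction k)
    case (Suc k)
    let ?s = "(F ^^ k) (set_nvar v 0 s)"
    have "nvar ?s v = k" "I k ?s" using Suc by auto
    then have "F ?s = set_nvar v (Suc k) (sem p ?s)" by (simp add: F_def)
    then show ?case using step[of k ?s] Suc \<open>nvar ?s v = k\<close> by simp
  qed (simp add: init)
  then show ?thesis by (simp add: F_def)
qed

text \<open>Two nested loops that fill a square array, one entry per iteration: \<open>E\<close> describes the part of the
state that the body reads, and \<open>D i j\<close> says that entry \<open>(i, j)\<close> has its final value.\<close>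

lemma sem_For_For:
  assumes v: "v1 \<noteq> v2" "v1 \<notin> assigned_vars p" "v2 \<notin> assigned_vars p"
    and E: "E s" "\<And>s. E s \<Longrightarrow> nvar s 1 = n"
      "\<And>s k. E s \<Longrightarrow> E (set_nvar v1 k s)" "\<And>s k. E s \<Longrightarrow> E (set_nvar v2 k s)"
    and D: "\<And>i j s k. D i j (set_nvar v1 k s) = D i j s" "\<And>i j s k. D i j (set_nvar v2 k s) = D i j s"
    and body: "\<And>i j s. i < n \<Longrightarrow> j < n \<Longrightarrow> E s \<Longrightarrow> nvar s v1 = i \<Longrightarrow> nvar s v2 = j \<Longrightarrow>
       E (sem p s) \<and> D i j (sem p s) \<and>
       (\<forall>i'<n. \<forall>j'<n. (i', j') \<noteq> (i, j) \<longrightarrow> D i' j' s \<longrightarrow> D i' j' (sem p s))"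
  shows "E (sem (For v1 1 (For v2 1 p)) s) \<and>
    (\<forall>i<n. \<forall>j<n. D i j (sem (For v1 1 (For v2 1 p)) s))"
proof -
  define I where "I = (\<lambda>i s. E s \<and> (\<forall>i'<i. \<forall>j'<n. i' < n \<longrightarrow> D i' j' s))"
  have "I (nvar s 1) (sem (For v1 1 (For v2 1 p)) s)"
  proof (rule sem_For_induct)
    show "v1 \<notin> assigned_vars (For v2 1 p)" using v by simp
    show "I 0 (set_nvar v1 0 s)" using E by (simp add: I_def)
    fix i s' assume i: "i < nvar s 1" "nvar s' v1 = i" and I: "I i s'"
    then have E': "E s'" and n: "nvar s 1 = n" "nvar s' 1 = n" using E by (auto simp: I_def)
    define J where "J = (\<lambda>j s. I i s \<and> nvar s v1 = i \<and> (\<forall>j'<j. j' < n \<longrightarrow> D i j' s))"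
    have "J (nvar s' 1) (sem (For v2 1 p) s')"
    proof (rule sem_For_induct[OF v(3)])
      show "J 0 (set_nvar v2 0 s')" using I i E D v by (simp add: J_def I_def)
      fix j s'' assume j: "j < nvar s' 1" "nvar s'' v2 = j" and J: "J j s''"
      have "E s''" "nvar s'' v1 = i" using J by (auto simp: J_def I_def)
      from body[OF _ _ this j(2)] i n j
      have *: "E (sem p s'') \<and> D i j (sem p s'') \<and>
        (\<forall>i'<n. \<forall>j'<n. (i', j') \<noteq> (i, j) \<longrightarrow> D i' j' s'' \<longrightarrow> D i' j' (sem p s''))" by simp
      moreover have "i < n" using i n by simp
      ultimately show "J (Suc j) (set_nvar v2 (Suc j) (sem p s''))"
        using J v E D by (auto simp: J_def I_def sem_frame less_Suc_eq)
    qed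
    then show "I (Suc i) (set_nvar v1 (Suc i) (sem (For v2 1 p) s'))"
      unfolding n using E D by (auto simp: J_def I_def less_Suc_eq)
  qed
  then show ?thesis using E by (auto simp: I_def)
qed

section \<open>Resolvent kernels and barriers\<close>

text \<open>For a Gram matrix \<open>g i j\<close> $= \langle a_i, a_j \rangle$ this is the matrix
$\langle a_i, (t - M)^{-1} a_j \rangle$, where $M = \sum a_q a_q^*$ runs over those $q \in \tau$ with
$q < p$; the recursion is the Sherman--Morrison formula. The pivot is real for a Hermitian \<open>g\<close>, so
taking its real part loses nothing and spares the program the imaginary part.\<close>

fun kern :: "(nat \<Rightarrow> nat \<Rightarrow> complex) \<Rightarrow> real \<Rightarrow> nat set \<Rightarrow> nat \<Rightarrow> nat \<Rightarrow> nat \<Rightarrow> complex" where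
  "kern g t \<tau> 0 i j = g i j / of_real t"
| "kern g t \<tau> (Suc p) i j = kern g t \<tau> p i j +
     (if p \<in> \<tau> then kern g t \<tau> p i p * kern g t \<tau> p p j / of_real (1 - Re (kern g t \<tau> p p p))
      else 0)"

text \<open>The certificate that is checked by the program. The pivot signs guarantee that \<open>t\<close> lies
on the right side of the spectrum, and the trace condition bounds the average of the future pivots. For
a lower barrier both conditions are reversed, which is the effect of \<open>s = -1\<close>.\<close>

definition barrier_ok ::
  "(nat \<Rightarrow> nat \<Rightarrow> complex) \<Rightarrow> nat \<Rightarrow> real \<Rightarrow> real \<Rightarrow> real \<Rightarrow> nat set \<Rightarrow> bool" where
  "barrier_ok g n s \<theta> t \<tau> \<longleftrightarrow>
     (\<forall>p<n. p \<in> \<tau> \<longrightarrow> 0 < s * (1 - Re (kern g t \<tau> p p p))) \<and>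
     s * (\<Sum>i<n. Re (kern g t \<tau> n i i)) \<le> s * real n / \<theta>"

text \<open>A family of barriers that moves with the number of selected columns. The data are rational because they
occur as constants in programs.\<close>

record barrier =
  side :: rat
  threshold :: rat
  start :: rat
  drift :: rat

text \<open>The barrier for \<open>c\<close> columns on the way to \<open>k\<close>; the total drift is reached at \<open>c = k\<close>.\<close>

definition level :: "barrier \<Rightarrow> nat \<Rightarrow> nat \<Rightarrow> real" where
  "level b k c = of_rat (start b) + of_rat (drift b) * real c / real k"

definition barrier_ok_at :: "(nat \<Rightarrow> nat \<Rightarrow> complex) \<Rightarrow> nat \<Rightarrow> barrier \<Rightarrow> nat \<Rightarrow> nat \<Rightarrow> nat set \<Rightarrow> bool" where
  "barrier_ok_at g n b k c \<tau> = barrier_ok g n (of_rat (side b)) (of_rat (threshold b)) (level b k c) \<tau>"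

text \<open>The threshold stays $2$ below the start, so that the trace condition holds for every set of columns when
$\|A\|^2 \le 2$. In that case the stable rank can be as large as $n$, and the averaging argument, which
sets a fraction of the columns aside, would not suffice.\<close>

definition bounded_norm_barrier :: barrier where
  "bounded_norm_barrier = \<lparr>side = 1, threshold = 6, start = 8, drift = 8\<rparr>"

text \<open>The final levels $36/25$ and $12/25$ of the upper and the lower barrier have quotient $3$. The drifts
are small, so that only a small fraction of the columns is lost in each of the two averaging arguments
and the two can be combined.\<close>

definition upper_barrier :: barrier where
  "upper_barrier = \<lparr>side = 1, threshold = 7 / 5, start = 7 / 5, drift = 1 / 25\<rparr>"

definition lower_barrier :: barrier where
  "lower_barrier = \<lparr>side = -1, threshold = 1 / 2, start = 1 / 2, drift = - 1 / 50\<rparr>"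

section \<open>The barrier argument\<close>

text \<open>A positive semidefinite sesquilinear form on an abstract space. The dimension is hidden in \<open>ip\<close>, so that
the matrices of all sizes are instances over one type.\<close>

locale unit_vectors = vector_space sc
  for sc :: "complex \<Rightarrow> 'v::ab_group_add \<Rightarrow> 'v" +
  fixes ip :: "'v \<Rightarrow> 'v \<Rightarrow> complex" and a :: "nat \<Rightarrow> 'v" and n :: nat
  assumes ip_add_right: "ip x (y + z) = ip x y + ip x z"
    and ip_scale_right: "ip x (sc c y) = c * ip x y"
    and ip_commute: "ip y x = cnj (ip x y)"
    and ip_nonneg: "0 \<le> Re (ip x x)"
    and unit: "j < n \<Longrightarrow> ip (a j) (a j) = 1"
begin

lemma ip_add_left: "ip (x + y) z = ip x z + ip y z"
  by (metis complex_cnj_add ip_add_right ip_commute)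

lemma ip_scale_left: "ip (sc c x) y = cnj c * ip x y"
  by (metis complex_cnj_mult ip_scale_right ip_commute)

lemma ip_zero_right [simp]: "ip x 0 = 0"
  using ip_add_right[of x 0 0] by simp

lemma ip_zero_left [simp]: "ip 0 x = 0"
  using ip_add_left[of 0 0 x] by simp

lemma ip_minus_right: "ip x (- y) = - ip x y"
  using ip_add_right[of x y "- y"] by (simp add: eq_neg_iff_add_eq_0 add.commute)

lemma ip_diff_right: "ip x (y - z) = ip x y - ip x z"
  using ip_add_right[of x y "- z"] by (simp add: ip_minus_right)

lemma ip_diff_left: "ip (x - y) z = ip x z - ip y z"
  by (metis complex_cnj_diff ip_diff_right ip_commute)

lemma ip_sum_right: "ip x (\<Sum>i\<in>I. f i) = (\<Sum>i\<in>I. ip x (f i))"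
  by (induction I rule: infinite_finite_induct) (auto simp: ip_add_right)

lemma ip_sum_left: "ip (\<Sum>i\<in>I. f i) x = (\<Sum>i\<in>I. ip (f i) x)"
  by (induction I rule: infinite_finite_induct) (auto simp: ip_add_left)

lemmas ip_simps = ip_add_left ip_add_right ip_scale_left ip_scale_right ip_diff_left ip_diff_right

definition nsq :: "'v \<Rightarrow> real" where "nsq x = Re (ip x x)"

lemma nsq_nonneg: "0 \<le> nsq x" by (simp add: nsq_def ip_nonneg)

lemma ip_self: "ip x x = of_real (nsq x)"
proof -
  have "Im (ip x x) = 0" using ip_commute[of x x] by (metis cnj.simps(2) neg_equal_zero)
  then show ?thesis by (simp add: nsq_def complex_eq_iff)
qed

lemma nsq_add: "nsq (x + y) = nsq x + nsq y + 2 * Re (ip x y)"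
proof -
  have "Re (ip y x) = Re (ip x y)" by (subst ip_commute) simp
  then show ?thesis by (simp add: nsq_def ip_simps)
qed

lemma nsq_scale: "nsq (sc c x) = (norm c)\<^sup>2 * nsq x"
proof -
  have "ip (sc c x) (sc c x) = (c * cnj c) * ip x x" by (simp add: ip_simps)
  then have "ip (sc c x) (sc c x) = of_real ((norm c)\<^sup>2 * nsq x)"
    by (simp only: complex_norm_square[symmetric] ip_self of_real_mult)
  then show ?thesis by (simp only: nsq_def Re_complex_of_real)
qed

lemma cauchy_schwarz_real: "(Re (ip x y))\<^sup>2 \<le> nsq x * nsq y"
proof -
  have q: "0 \<le> nsq x + r\<^sup>2 * nsq y + 2 * (r * Re (ip x y))" for r :: real
    using nsq_nonneg[of "x + sc (of_real r) y"]
    by (simp add: nsq_add nsq_scale ip_simps)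
  show ?thesis
  proof (cases "nsq y = 0")
    case True
    have "Re (ip x y) = 0"
    proof (rule ccontr)
      assume "Re (ip x y) \<noteq> 0"
      with q[of "- (nsq x + 1) / (2 * Re (ip x y))"] True show False
        by (simp add: field_simps)
    qed
    with True show ?thesis by simp
  next
    case False
    then have "0 < nsq y" using nsq_nonneg[of y] by simp
    with q[of "- Re (ip x y) / nsq y"] show ?thesis
      by (simp add: field_simps power2_eq_square)
  qed
qed

text \<open>For \<open>\<tau>\<close> a set of columns, this is the vector $A_\tau c$; \<open>frame_op \<tau>\<close> is $A_\tau A_\tau^*$.\<close>

definition synth :: "nat set \<Rightarrow> (nat \<Rightarrow> complex) \<Rightarrow> 'v" where
  "synth \<tau> c = (\<Sum>p\<in>\<tau>. sc (c p) (a p))"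

definition frame_op :: "nat set \<Rightarrow> 'v \<Rightarrow> 'v" where
  "frame_op \<tau> x = synth \<tau> (\<lambda>p. ip (a p) x)"

lemma frame_op_insert:
  "finite \<tau> \<Longrightarrow> j \<notin> \<tau> \<Longrightarrow> frame_op (insert j \<tau>) x = frame_op \<tau> x + sc (ip (a j) x) (a j)"
  by (simp add: frame_op_def synth_def add.commute)

lemma frame_op_add: "frame_op \<tau> (x + y) = frame_op \<tau> x + frame_op \<tau> y"
  by (simp add: frame_op_def synth_def ip_add_right scale_left_distrib sum.distrib)

lemma frame_op_scale: "frame_op \<tau> (sc c x) = sc c (frame_op \<tau> x)"
  by (simp add: frame_op_def synth_def ip_scale_right scale_sum_right)

text \<open>\<open>R\<close> is the inverse of $t - M_\tau$. Both one-sided inverse properties are included: together they make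
the resolvent unique, so it does not matter in which order the columns are eliminated.\<close>

definition resolvent :: "real \<Rightarrow> nat set \<Rightarrow> ('v \<Rightarrow> 'v) \<Rightarrow> bool" where
  "resolvent t \<tau> R \<longleftrightarrow>
     (\<forall>x y. R (x + y) = R x + R y) \<and> (\<forall>c x. R (sc c x) = sc c (R x)) \<and>
     (\<forall>x y. ip (R x) y = ip x (R y)) \<and>
     (\<forall>x. sc (of_real t) (R x) - frame_op \<tau> (R x) = x) \<and>
     (\<forall>x. R (sc (of_real t) x - frame_op \<tau> x) = x)"

lemma resolventD:
  assumes "resolvent t \<tau> R"
  shows "R (x + y) = R x + R y" "R (sc c x) = sc c (R x)" "ip (R x) y = ip x (R y)"
    "sc (of_real t) (R x) - frame_op \<tau> (R x) = x"
    "R (sc (of_real t) x - frame_op \<tau> x) = x"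
  using assms by (auto simp: resolvent_def)

lemma resolvent_diff: "resolvent t \<tau> R \<Longrightarrow> R (x - y) = R x - R y"
  by (metis add_diff_cancel diff_add_cancel resolventD(1))

lemma resolvent_unique: "resolvent t \<tau> R \<Longrightarrow> resolvent t \<tau> R' \<Longrightarrow> R = R'"
  by (rule ext) (metis resolventD(4,5))

definition pivot :: "('v \<Rightarrow> 'v) \<Rightarrow> nat \<Rightarrow> real" where
  "pivot R j = Re (ip (a j) (R (a j)))"

lemma ip_pivot:
  assumes "resolvent t \<tau> R"
  shows "ip (a j) (R (a j)) = of_real (pivot R j)"
proof -
  have "cnj (ip (a j) (R (a j))) = ip (a j) (R (a j))"
    using assms ip_commute resolventD(3) by metis
  then have "Im (ip (a j) (R (a j))) = 0" by (simp add: complex_eq_iff)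
  then show ?thesis by (simp add: pivot_def complex_eq_iff)
qed

text \<open>The Sherman--Morrison formula for the resolvent after column \<open>j\<close> is added.\<close>

definition rank_one_update :: "('v \<Rightarrow> 'v) \<Rightarrow> nat \<Rightarrow> 'v \<Rightarrow> 'v" where
  "rank_one_update R j x = R x + sc (ip (a j) (R x) / of_real (1 - pivot R j)) (R (a j))"

text \<open>Multiplying out, all terms besides the identity are multiples of one vector, with a coefficient
that vanishes because $\langle a_j, R a_j \rangle$ is the pivot.\<close>

lemma resolvent_rank_one_update:
  assumes R: "resolvent t \<tau> R" and fin: "finite \<tau>" and j: "j \<notin> \<tau>" and q: "pivot R j \<noteq> 1"
  shows "resolvent t (insert j \<tau>) (rank_one_update R j)"
proof -
  note D = resolventD[OF R] resolvent_diff[OF R]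
  define d where "d = complex_of_real (1 - pivot R j)"
  have d: "d \<noteq> 0" "cnj d = d" "ip (a j) (R (a j)) = 1 - d"
    using q by (auto simp: d_def ip_pivot[OF R])
  have U: "rank_one_update R j x = R x + sc (ip (a j) (R x) / d) (R (a j))" for x
    by (simp add: rank_one_update_def d_def)
  have 1: "rank_one_update R j (x + y) = rank_one_update R j x + rank_one_update R j y" for x y
    by (simp add: U D ip_simps add_divide_distrib scale_left_distrib)
  have 2: "rank_one_update R j (sc c x) = sc c (rank_one_update R j x)" for c x
    by (simp add: U D ip_simps scale_right_distrib)
  have 3: "ip (rank_one_update R j x) y = ip x (rank_one_update R j y)" for x y
  proof -
    have "cnj (ip (a j) (R x)) = ip x (R (a j))" by (metis D(3) ip_commute)
    moreover have "ip (R (a j)) y = ip (a j) (R y)" by (rule D(3))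
    ultimately show ?thesis by (simp add: U ip_simps D(3) d)
  qed
  have 4: "sc (of_real t) (rank_one_update R j x) - frame_op (insert j \<tau>) (rank_one_update R j x) = x"
    for x
  proof -
    define g where "g = ip (a j) (R x) / d"
    have "ip (a j) (R x) + g * ip (a j) (R (a j)) = g"
      using d(1) by (simp add: g_def d(3) field_simps)
    then have I: "ip (a j) (rank_one_update R j x) = g"
      by (simp add: U ip_simps g_def)
    have "sc (of_real t) (rank_one_update R j x) - frame_op (insert j \<tau>) (rank_one_update R j x)
      = (sc (of_real t) (R x) - frame_op \<tau> (R x))
        + sc g (sc (of_real t) (R (a j)) - frame_op \<tau> (R (a j))) - sc g (a j)"
      unfolding frame_op_insert[OF fin j] I
      by (simp add: U g_def[symmetric] frame_op_add frame_op_scale scale_right_distrib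
          scale_right_diff_distrib mult.commute)
    then show ?thesis by (simp add: D)
  qed
  have 5: "rank_one_update R j (sc (of_real t) x - frame_op (insert j \<tau>) x) = x" for x
  proof -
    define b where "b = ip (a j) x"
    have RR: "R (sc (of_real t) x - frame_op (insert j \<tau>) x) = x - sc b (R (a j))"
    proof -
      have "sc (of_real t) x - frame_op (insert j \<tau>) x = (sc (of_real t) x - frame_op \<tau> x) - sc b (a j)"
        by (simp add: frame_op_insert[OF fin j] b_def)
      then have "R (sc (of_real t) x - frame_op (insert j \<tau>) x)
          = R (sc (of_real t) x - frame_op \<tau> x) - R (sc b (a j))"
        by (simp only: D(6))
      then show ?thesis by (simp only: D(2,5))
    qed
    have "ip (a j) (x - sc b (R (a j))) = b * d"
      by (simp add: ip_simps d(3) b_def algebra_simps)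
    then show ?thesis unfolding U RR using d(1) by simp
  qed
  show ?thesis unfolding resolvent_def using 1 2 3 4 5 by blast
qed

lemma quadratic_rank_one_update:
  assumes R: "resolvent t \<tau> R"
  shows "Re (ip x (rank_one_update R j x)) =
    Re (ip x (R x)) + (norm (ip (a j) (R x)))\<^sup>2 / (1 - pivot R j)"
proof -
  have "ip x (R (a j)) = cnj (ip (a j) (R x))" by (metis R resolventD(3) ip_commute)
  then have "ip x (rank_one_update R j x) =
      ip x (R x) + of_real ((norm (ip (a j) (R x)))\<^sup>2 / (1 - pivot R j))"
    by (simp add: rank_one_update_def ip_simps complex_norm_square del: of_real_power)
  then show ?thesis by simp
qed

text \<open>For \<open>s = 1\<close> the largest eigenvalue of the Gram matrix of the columns in \<open>\<tau>\<close> is below \<open>t\<close>; for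
\<open>s = -1\<close> the smallest one is above \<open>t\<close>. The strict form is the one that is equivalent to the
strict pivot conditions.\<close>

definition strictly_dominated :: "real \<Rightarrow> real \<Rightarrow> nat set \<Rightarrow> bool" where
  "strictly_dominated s t \<tau> \<longleftrightarrow>
     (\<forall>c. (\<exists>p\<in>\<tau>. c p \<noteq> 0) \<longrightarrow> s * nsq (synth \<tau> c) < s * t * (\<Sum>p\<in>\<tau>. (norm (c p))\<^sup>2))"

lemma strictly_dominated_subset:
  assumes "strictly_dominated s t \<tau>" "\<sigma> \<subseteq> \<tau>" "finite \<tau>"
  shows "strictly_dominated s t \<sigma>"
  unfolding strictly_dominated_def
proof (intro allI impI)
  fix c :: "nat \<Rightarrow> complex" assume c: "\<exists>p\<in>\<sigma>. c p \<noteq> 0"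
  define e where "e = (\<lambda>p. if p \<in> \<sigma> then c p else 0)"
  have "synth \<tau> e = synth \<sigma> c" "(\<Sum>p\<in>\<tau>. (norm (e p))\<^sup>2) = (\<Sum>p\<in>\<sigma>. (norm (c p))\<^sup>2)"
    unfolding synth_def e_def using assms(2,3)
    by (auto intro!: sum.mono_neutral_cong_right)
  moreover have "\<exists>p\<in>\<tau>. e p \<noteq> 0" using c assms(2) by (auto simp: e_def)
  ultimately show "s * nsq (synth \<sigma> c) < s * t * (\<Sum>p\<in>\<sigma>. (norm (c p))\<^sup>2)"
    using assms(1) unfolding strictly_dominated_def by metis
qed

lemma strictly_dominated_mono:
  assumes "strictly_dominated s t \<tau>" "s * t \<le> s * t'"
  shows "strictly_dominated s t' \<tau>"
  unfolding strictly_dominated_def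
proof (intro allI impI)
  fix c :: "nat \<Rightarrow> complex" assume c: "\<exists>p\<in>\<tau>. c p \<noteq> 0"
  have "s * nsq (synth \<tau> c) < s * t * (\<Sum>p\<in>\<tau>. (norm (c p))\<^sup>2)"
    using assms(1) c by (auto simp: strictly_dominated_def)
  also have "\<dots> \<le> s * t' * (\<Sum>p\<in>\<tau>. (norm (c p))\<^sup>2)"
    using assms(2) by (intro mult_right_mono sum_nonneg) auto
  finally show "s * nsq (synth \<tau> c) < s * t' * (\<Sum>p\<in>\<tau>. (norm (c p))\<^sup>2)" .
qed

text \<open>The quadratic form $\|A_\sigma c\|^2 - t \|c\|^2$ in one more variable, after completing the square. With
$y = R a_p$ one has $a_p = t y - A_\sigma A_\sigma^* y$, so substituting
$d = c - c_p A_\sigma^* y$ turns the new vector into $A_\sigma d + c_p t y$; the mixed terms on the two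
sides cancel, and what remains is the coefficient $t (q - 1)$ of the Schur complement.\<close>

lemma schur_complement_identity:
  assumes R: "resolvent t \<sigma> R" and fin: "finite \<sigma>" and p: "p \<notin> \<sigma>"
  shows "nsq (synth (insert p \<sigma>) c) - t * (\<Sum>j\<in>insert p \<sigma>. (norm (c j))\<^sup>2) =
    nsq (synth \<sigma> (\<lambda>j. c j - c p * ip (a j) (R (a p))))
      - t * (\<Sum>j\<in>\<sigma>. (norm (c j - c p * ip (a j) (R (a p))))\<^sup>2)
      + (norm (c p))\<^sup>2 * (t * (pivot R p - 1))"
proof -
  define y where "y = R (a p)"
  define e where "e = (\<lambda>j. ip (a j) y)"
  define d where "d = (\<lambda>j. c j - c p * e j)"
  define E where "E = (\<Sum>j\<in>\<sigma>. (norm (e j))\<^sup>2)"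
  define X where "X = (\<Sum>j\<in>\<sigma>. Re (cnj (d j) * (c p * e j)))"
  have ap: "a p = sc (of_real t) y - synth \<sigma> e"
    using resolventD(4)[OF R, of "a p"] by (simp add: y_def frame_op_def e_def)
  have ye: "ip y (synth \<sigma> e) = of_real E"
  proof -
    have "ip y (a j) * e j = of_real ((norm (e j))\<^sup>2)" for j
    proof -
      have "ip y (a j) = cnj (e j)" unfolding e_def by (rule ip_commute)
      then show ?thesis by (simp add: complex_norm_square mult.commute del: of_real_power)
    qed
    then show ?thesis
      by (simp add: synth_def ip_sum_right ip_scale_right E_def mult.commute[of "e _"])
  qed
  have piv: "pivot R p = t * nsq y - E"
  proof -
    have "pivot R p = Re (ip y (a p))"
      unfolding pivot_def y_def by (simp add: resolventD(3)[OF R])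
    then show ?thesis by (subst (asm) ap) (simp add: ip_simps ye ip_self)
  qed
  have S: "synth (insert p \<sigma>) c = synth \<sigma> d + sc (c p * of_real t) y"
  proof -
    have "synth \<sigma> d = synth \<sigma> c - sc (c p) (synth \<sigma> e)"
      by (simp add: synth_def d_def scale_left_diff_distrib sum_subtractf scale_sum_right)
    moreover have "synth (insert p \<sigma>) c = sc (c p) (sc (of_real t) y - synth \<sigma> e) + synth \<sigma> c"
      unfolding ap[symmetric] using fin p by (simp add: synth_def)
    ultimately show ?thesis by (simp add: scale_right_diff_distrib)
  qed
  have X2: "Re (ip (synth \<sigma> d) (sc (c p * of_real t) y)) = t * X"
    by (simp add: synth_def ip_sum_left ip_simps X_def e_def sum_distrib_left algebra_simps)
  have L: "nsq (synth (insert p \<sigma>) c) = nsq (synth \<sigma> d) + (norm (c p))\<^sup>2 * t\<^sup>2 * nsq y + 2 * t * X"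
    unfolding S nsq_add X2 by (simp add: nsq_scale norm_mult power_mult_distrib)
  have C: "(\<Sum>j\<in>\<sigma>. (norm (c j))\<^sup>2) = (\<Sum>j\<in>\<sigma>. (norm (d j))\<^sup>2) + (norm (c p))\<^sup>2 * E + 2 * X"
  proof -
    have "(norm (c j))\<^sup>2 = (norm (d j))\<^sup>2 + (norm (c p))\<^sup>2 * (norm (e j))\<^sup>2
        + 2 * Re (cnj (d j) * (c p * e j))" for j
    proof -
      have cj: "c j = d j + c p * e j" by (simp add: d_def)
      have "(norm (u + v))\<^sup>2 = (norm u)\<^sup>2 + (norm v)\<^sup>2 + 2 * Re (cnj u * v)" for u v :: complex
        by (simp only: cmod_power2) (simp add: power2_eq_square algebra_simps)
      from this[of "d j" "c p * e j"] show ?thesis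
        by (simp only: cj[symmetric] norm_mult power_mult_distrib)
    qed
    from sum.cong[OF refl this] show ?thesis
      by (simp only: sum.distrib E_def X_def sum_distrib_left)
  qed
  have "nsq (synth (insert p \<sigma>) c) - t * (\<Sum>j\<in>insert p \<sigma>. (norm (c j))\<^sup>2) =
     nsq (synth \<sigma> d) - t * (\<Sum>j\<in>\<sigma>. (norm (d j))\<^sup>2) + (norm (c p))\<^sup>2 * (t * (pivot R p - 1))"
    unfolding sum.insert[OF fin p] L C piv by (simp add: algebra_simps power2_eq_square)
  then show ?thesis by (simp add: d_def e_def y_def)
qed

lemma strictly_dominated_insert:
  assumes R: "resolvent t \<sigma> R" and fin: "finite \<sigma>" and p: "p \<notin> \<sigma>" and t: "0 < t"
    and dom: "strictly_dominated s t \<sigma>" and q: "0 < s * (1 - pivot R p)"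
  shows "strictly_dominated s t (insert p \<sigma>)"
  unfolding strictly_dominated_def
proof (intro allI impI)
  fix c :: "nat \<Rightarrow> complex" assume c: "\<exists>j\<in>insert p \<sigma>. c j \<noteq> 0"
  define d where "d = (\<lambda>j. c j - c p * ip (a j) (R (a p)))"
  define f where "f = s * (nsq (synth \<sigma> d) - t * (\<Sum>j\<in>\<sigma>. (norm (d j))\<^sup>2))"
  define h where "h = (norm (c p))\<^sup>2 * (t * (s * (1 - pivot R p)))"
  have id: "s * (nsq (synth (insert p \<sigma>) c) - t * (\<Sum>j\<in>insert p \<sigma>. (norm (c j))\<^sup>2)) = f - h"
    unfolding schur_complement_identity[OF R fin p] f_def h_def d_def by (simp add: algebra_simps)
  have f: "f < 0" if "\<exists>j\<in>\<sigma>. d j \<noteq> 0"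
    using dom that unfolding strictly_dominated_def f_def by (auto simp: algebra_simps)
  have f0: "f \<le> 0"
  proof (cases "\<exists>j\<in>\<sigma>. d j \<noteq> 0")
    case False
    then have "f = 0" by (simp add: f_def synth_def nsq_def)
    then show ?thesis by simp
  qed (use f in force)
  have "f - h < 0"
  proof (cases "c p = 0")
    case True
    then have "d = c" by (simp add: d_def)
    with True c f show ?thesis by (auto simp: h_def)
  next
    case False
    then have "0 < h" using t q by (simp add: h_def)
    with f0 show ?thesis by simp
  qed
  with id show "s * nsq (synth (insert p \<sigma>) c) < s * t * (\<Sum>j\<in>insert p \<sigma>. (norm (c j))\<^sup>2)"
    by (simp add: algebra_simps)
qed

text \<open>The coefficient vector that annihilates the completed square isolates the Schur complement.\<close>

lemma pivot_sign_if_strictly_dominated: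
  assumes R: "resolvent t \<sigma> R" and fin: "finite \<sigma>" and p: "p \<notin> \<sigma>" and t: "0 < t"
    and dom: "strictly_dominated s t (insert p \<sigma>)"
  shows "0 < s * (1 - pivot R p)"
proof -
  \<comment> \<open>the completed square vanishes for this choice\<close>
  define c where "c = (\<lambda>j. if j = p then 1 else ip (a j) (R (a p)))"
  have d: "c j - c p * ip (a j) (R (a p)) = 0" if "j \<in> \<sigma>" for j
    using that p by (auto simp: c_def)
  have "synth \<sigma> (\<lambda>j. c j - c p * ip (a j) (R (a p))) = 0"
    by (simp add: synth_def d)
  moreover have "(\<Sum>j\<in>\<sigma>. (norm (c j - c p * ip (a j) (R (a p))))\<^sup>2) = 0"
    by (simp add: d)
  ultimately have id: "nsq (synth (insert p \<sigma>) c) - t * (\<Sum>j\<in>insert p \<sigma>. (norm (c j))\<^sup>2)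
      = t * (pivot R p - 1)"
    using schur_complement_identity[OF R fin p, of c] by (simp add: c_def nsq_def)
  have "s * nsq (synth (insert p \<sigma>) c) < s * t * (\<Sum>j\<in>insert p \<sigma>. (norm (c j))\<^sup>2)"
    using dom unfolding strictly_dominated_def by (auto simp: c_def)
  then have "s * (nsq (synth (insert p \<sigma>) c) - t * (\<Sum>j\<in>insert p \<sigma>. (norm (c j))\<^sup>2)) < 0"
    by (simp add: algebra_simps)
  then have "t * (s * (1 - pivot R p)) > 0" unfolding id by (simp add: algebra_simps)
  then show ?thesis using t by (simp add: zero_less_mult_iff)
qed

text \<open>The resolvent for those columns of \<open>\<tau>\<close> that have been eliminated so far; its entries are what
\<open>kern\<close> computes.\<close>

primrec Res :: "real \<Rightarrow> nat set \<Rightarrow> nat \<Rightarrow> 'v \<Rightarrow> 'v" where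
  "Res t \<tau> 0 = (\<lambda>x. sc (of_real (1 / t)) x)"
| "Res t \<tau> (Suc p) = (if p \<in> \<tau> then rank_one_update (Res t \<tau> p) p else Res t \<tau> p)"

lemma kern_eq_Res: "kern (\<lambda>i j. ip (a i) (a j)) t \<tau> p i j = ip (a i) (Res t \<tau> p (a j))"
proof (induction p arbitrary: i j)
  case (Suc p)
  show ?case
    by (simp only: kern.simps Suc.IH Res.simps) (simp add: ip_simps rank_one_update_def pivot_def)
qed (simp add: ip_simps)

lemma Int_lessThan_Suc: "\<tau> \<inter> {..<Suc p} = (if p \<in> \<tau> then insert p (\<tau> \<inter> {..<p}) else \<tau> \<inter> {..<p})"
  by (auto simp: less_Suc_eq)

lemma resolvent_Res:
  assumes "t \<noteq> 0" "\<And>p'. p' < p \<Longrightarrow> p' \<in> \<tau> \<Longrightarrow> pivot (Res t \<tau> p') p' \<noteq> 1"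
  shows "resolvent t (\<tau> \<inter> {..<p}) (Res t \<tau> p)"
  using assms(2)
proof (induction p)
  case 0
  then show ?case using assms(1)
    by (auto simp: resolvent_def scale_right_distrib ip_simps frame_op_def synth_def mult.commute)
next
  case (Suc p)
  then have "resolvent t (\<tau> \<inter> {..<p}) (Res t \<tau> p)" by simp
  from resolvent_rank_one_update[OF this, of p] Suc.prems[of p] show ?case
    using \<open>resolvent t (\<tau> \<inter> {..<p}) (Res t \<tau> p)\<close> by (auto simp: Int_lessThan_Suc)
qed

text \<open>Each elimination step adds a nonnegative term to the quadratic form of \<open>s\<close> times the
resolvent, because its denominator has the sign of \<open>s\<close>; the form starts at $s \|x\|^2 / t$. For the
lower barrier, where the resolvent is indefinite, this is the bound $R \le 1/t$.\<close>

lemma Res_bound_and_dominated: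
  assumes "0 < t" "\<And>p'. p' < p \<Longrightarrow> p' \<in> \<tau> \<Longrightarrow> 0 < s * (1 - pivot (Res t \<tau> p') p')"
  shows "strictly_dominated s t (\<tau> \<inter> {..<p}) \<and> s * nsq x / t \<le> s * Re (ip x (Res t \<tau> p x))"
  using assms(2)
proof (induction p)
  case 0
  then show ?case by (simp add: strictly_dominated_def ip_simps ip_self)
next
  case (Suc p)
  have R: "resolvent t (\<tau> \<inter> {..<p}) (Res t \<tau> p)"
  proof (rule resolvent_Res)
    show "pivot (Res t \<tau> p') p' \<noteq> 1" if "p' < p" "p' \<in> \<tau>" for p'
      using Suc.prems[of p'] that by auto
  qed (use assms(1) in simp)
  have IH: "strictly_dominated s t (\<tau> \<inter> {..<p})" "s * nsq x / t \<le> s * Re (ip x (Res t \<tau> p x))"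
    using Suc by auto
  show ?case
  proof (cases "p \<in> \<tau>")
    case True
    define q where "q = 1 - pivot (Res t \<tau> p) p"
    have q: "0 < s * q" using Suc.prems[of p] True by (simp add: q_def)
    have "0 \<le> s / q"
      using q by (metis divide_nonneg_pos less_eq_real_def mult_less_0_iff divide_nonpos_neg zero_less_mult_iff)
    then have "0 \<le> s / q * (norm (ip (a p) (Res t \<tau> p x)))\<^sup>2" by (intro mult_nonneg_nonneg) auto
    then have "s * Re (ip x (Res t \<tau> p x)) \<le> s * Re (ip x (Res t \<tau> (Suc p) x))"
      using True by (simp add: quadratic_rank_one_update[OF R] q_def distrib_left)
    moreover have "strictly_dominated s t (insert p (\<tau> \<inter> {..<p}))"
      by (rule strictly_dominated_insert[OF R]) (use assms(1) IH q q_def in auto)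
    ultimately show ?thesis using IH True by (simp add: Int_lessThan_Suc)
  next
    case False
    then show ?thesis using IH by (simp add: Int_lessThan_Suc)
  qed
qed

text \<open>Strict domination passes to subsets of the columns, so it forces the sign of every pivot
in whatever order the columns are eliminated.\<close>

lemma Res_pivot_sign:
  assumes t: "0 < t" and dom: "strictly_dominated s t \<tau>" and fin: "finite \<tau>"
  shows "p \<in> \<tau> \<Longrightarrow> 0 < s * (1 - pivot (Res t \<tau> p) p)"
proof (induction p rule: less_induct)
  case (less p)
  have R: "resolvent t (\<tau> \<inter> {..<p}) (Res t \<tau> p)"
    by (rule resolvent_Res) (use t less.IH in fastforce)+
  show ?case
    by (rule pivot_sign_if_strictly_dominated[OF R])
      (use t fin less.prems in \<open>auto intro: strictly_dominated_subset[OF dom]\<close>)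
qed


definition trace :: "('v \<Rightarrow> 'v) \<Rightarrow> real" where
  "trace R = (\<Sum>i<n. pivot R i)"

abbreviation gram :: "nat \<Rightarrow> nat \<Rightarrow> complex" where
  "gram \<equiv> \<lambda>i j. ip (a i) (a j)"

lemma barrier_ok_iff:
  "barrier_ok gram n s \<theta> t \<tau> \<longleftrightarrow>
     (\<forall>p<n. p \<in> \<tau> \<longrightarrow> 0 < s * (1 - pivot (Res t \<tau> p) p)) \<and>
     s * trace (Res t \<tau> n) \<le> s * real n / \<theta>"
  by (simp add: barrier_ok_def kern_eq_Res pivot_def trace_def)

lemma resolvent_if_pivots:
  assumes "0 < t" "\<tau> \<subseteq> {..<n}" "\<And>p. p \<in> \<tau> \<Longrightarrow> 0 < s * (1 - pivot (Res t \<tau> p) p)"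
  shows "resolvent t \<tau> (Res t \<tau> n)" "strictly_dominated s t \<tau>"
    "s * nsq x / t \<le> s * Re (ip x (Res t \<tau> n x))"
proof -
  have I: "\<tau> \<inter> {..<n} = \<tau>" using assms(2) by auto
  have "resolvent t (\<tau> \<inter> {..<n}) (Res t \<tau> n)"
  proof (rule resolvent_Res)
    show "pivot (Res t \<tau> p) p \<noteq> 1" if "p < n" "p \<in> \<tau>" for p
      using assms(3)[of p] that by auto
  qed (use assms in simp)
  then show "resolvent t \<tau> (Res t \<tau> n)" by (simp add: I)
  have "strictly_dominated s t (\<tau> \<inter> {..<n}) \<and> s * nsq x / t \<le> s * Re (ip x (Res t \<tau> n x))"
    by (rule Res_bound_and_dominated) (use assms in auto)
  then show "strictly_dominated s t \<tau>" "s * nsq x / t \<le> s * Re (ip x (Res t \<tau> n x))"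
    by (auto simp: I)
qed

text \<open>The trace condition may be verified for any resolvent, in particular for a rank-one update of
the previous one, although the certificate eliminates the columns in the order of their indices.\<close>

lemma barrier_ok_if_dominated:
  assumes t: "0 < t" and \<tau>: "\<tau> \<subseteq> {..<n}" and dom: "strictly_dominated s t \<tau>"
    and R: "resolvent t \<tau> R" and trace_acc: "s * trace R \<le> s * real n / \<theta>"
  shows "barrier_ok gram n s \<theta> t \<tau>"
proof -
  have piv: "p \<in> \<tau> \<Longrightarrow> 0 < s * (1 - pivot (Res t \<tau> p) p)" for p
    by (rule Res_pivot_sign) (use t dom \<tau> finite_subset in auto)
  have "Res t \<tau> n = R"
    using resolvent_if_pivots(1)[OF t \<tau> piv] R resolvent_unique by blast
  then show ?thesis using piv trace_acc by (simp add: barrier_ok_iff)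
qed

lemma norm_ip_resolvent_commute:
  assumes "resolvent t \<tau> R"
  shows "norm (ip (a j) (R (a i))) = norm (ip (a i) (R (a j)))"
proof -
  have "ip (a j) (R (a i)) = cnj (ip (a i) (R (a j)))"
    by (metis assms ip_commute resolventD(3))
  then show ?thesis by simp
qed

lemma trace_rank_one_update:
  assumes R: "resolvent t \<tau> R"
  shows "trace (rank_one_update R j) =
    trace R + (\<Sum>i<n. (norm (ip (a i) (R (a j))))\<^sup>2) / (1 - pivot R j)"
proof -
  have "pivot (rank_one_update R j) i =
      pivot R i + (norm (ip (a i) (R (a j))))\<^sup>2 / (1 - pivot R j)" for i
    using quadratic_rank_one_update[OF R, of "a i" j] norm_ip_resolvent_commute[OF R, of j i]
    by (simp add: pivot_def)
  then show ?thesis by (simp add: trace_def sum.distrib sum_divide_distrib)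
qed

text \<open>The resolvent identity $R = R' + d R R'$, applied twice. It is written in terms of
$x = R' a_j$ alone, so that no commutation of the two resolvents is needed.\<close>

lemma resolvent_identity:
  assumes R: "resolvent t \<tau> R" and R': "resolvent (t + d) \<tau> R'"
  shows "pivot R j = pivot R' j + d * nsq (R' (a j)) + d\<^sup>2 * Re (ip (R' (a j)) (R (R' (a j))))"
proof -
  define x where "x = R' (a j)"
  have "a j = (sc (of_real t) x - frame_op \<tau> x) + sc (of_real d) x"
    by (subst resolventD(4)[OF R', of "a j", symmetric]) (simp add: x_def scale_left_distrib)
  then have "R (a j) = R (sc (of_real t) x - frame_op \<tau> x) + R (sc (of_real d) x)"
    using resolventD(1)[OF R] by metis
  then have Ra: "R (a j) = x + sc (of_real d) (R x)"
    by (simp only: resolventD(5)[OF R] resolventD(2)[OF R])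
  have "ip (a j) (R x) = ip (R (a j)) x" by (simp only: resolventD(3)[OF R])
  also have "\<dots> = ip x x + of_real d * ip (R x) x" unfolding Ra by (simp add: ip_simps)
  also have "ip (R x) x = ip x (R x)" by (rule resolventD(3)[OF R])
  finally have "ip (a j) (R (a j)) = ip (a j) x + of_real d * (ip x x + of_real d * ip x (R x))"
    unfolding Ra by (simp add: ip_simps)
  then show ?thesis
    by (simp add: pivot_def x_def[symmetric] nsq_def power2_eq_square algebra_simps)
qed

text \<open>If $R a_j$ had norm zero, the frame bound would make it orthogonal to all columns,
and $a_j = t R a_j$ would have norm zero as well.\<close>

lemma resolvent_nonzero:
  assumes R: "resolvent t \<tau> R" and \<tau>: "\<tau> \<subseteq> {..<n}" and j: "j < n"
    and bessel: "\<And>x. (\<Sum>i<n. (norm (ip (a i) x))\<^sup>2) \<le> B * nsq x"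
  shows "0 < nsq (R (a j))"
proof (rule ccontr)
  define x where "x = R (a j)"
  assume "\<not> 0 < nsq (R (a j))"
  then have x0: "nsq x = 0" using nsq_nonneg[of x] by (simp add: x_def)
  then have "(\<Sum>i<n. (norm (ip (a i) x))\<^sup>2) \<le> 0" using bessel[of x] by simp
  then have "\<forall>i<n. ip (a i) x = 0"
    by (metis (no_types, lifting) finite_lessThan lessThan_iff norm_eq_zero order_antisym
        power_eq_0_iff sum_nonneg sum_nonneg_eq_0_iff zero_le_power2)
  then have "frame_op \<tau> x = 0" using \<tau> by (auto simp: frame_op_def synth_def intro!: sum.neutral)
  then have "a j = sc (of_real t) x" using resolventD(4)[OF R, of "a j"] by (simp add: x_def)
  then have "nsq (a j) = 0" using x0 by (simp add: nsq_scale)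
  then show False using unit[OF j] by (simp add: nsq_def)
qed

text \<open>The averaging argument. Column \<open>j\<close> is harmless after the barrier has moved from \<open>t\<close> to
\<open>t'\<close> if $Z_j = w_j / D + s q_j < s$, where $D$ is the decrease of $s \Phi$, $q_j$ is the
pivot and $w_j / (s (1 - q_j))$ is the increase of $s \Phi$ when the column is added. The sum of the
$Z_j$ is at most $B t / (\delta t') + s n / \theta$, and each $Z_j$ is at least $s / t'$, so Markov's
inequality applies to $Z_j - s / t'$.\<close>

lemma few_bad_columns:
  assumes s: "s = 1 \<or> s = -1" and t: "0 < t" "0 < t'" and \<delta>: "0 < \<delta>" and t': "t' = t + s * \<delta>"
    and \<tau>: "\<tau> \<subseteq> {..<n}" and n: "0 < n" and B: "0 \<le> B"
    and bessel: "\<And>x. (\<Sum>i<n. (norm (ip (a i) x))\<^sup>2) \<le> B * nsq x"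
    and barrier_ok: "barrier_ok gram n s \<theta> t \<tau>"
  obtains Bad where "Bad \<subseteq> {..<n}"
    "real (card Bad) * (s * (1 - 1 / t')) \<le> B * t / (\<delta> * t') + s * real n / \<theta> - s * real n / t'"
    "\<And>j. j < n \<Longrightarrow> j \<notin> \<tau> \<Longrightarrow> j \<notin> Bad \<Longrightarrow> barrier_ok gram n s \<theta> t' (insert j \<tau>)"
proof -
  have ss: "s * s = 1" using s by auto
  have fin: "finite \<tau>" using \<tau> finite_subset by auto
  define R where "R = Res t \<tau> n"
  define R' where "R' = Res t' \<tau> n"
  have piv: "p \<in> \<tau> \<Longrightarrow> 0 < s * (1 - pivot (Res t \<tau> p) p)" for p
    using barrier_ok \<tau> by (auto simp: barrier_ok_iff)
  note R = resolvent_if_pivots[OF t(1) \<tau> piv, folded R_def]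
  have dom': "strictly_dominated s t' \<tau>"
    by (rule strictly_dominated_mono[OF R(2)]) (use \<delta> s t' in auto)
  have piv': "p \<in> \<tau> \<Longrightarrow> 0 < s * (1 - pivot (Res t' \<tau> p) p)" for p
    by (rule Res_pivot_sign) (use t dom' fin in auto)
  note R' = resolvent_if_pivots[OF t(2) \<tau> piv', folded R'_def]
  define x where "x = (\<lambda>j. R' (a j))"
  define w where "w = (\<lambda>j. \<Sum>i<n. (norm (ip (a i) (x j)))\<^sup>2)"
  define D where "D = s * (trace R - trace R')"
  define N where "N = (\<Sum>j<n. nsq (x j))"
  have N: "0 < N"
    unfolding N_def x_def by (rule sum_pos) (use n resolvent_nonzero[OF R'(1) \<tau> _ bessel] in auto)
  have "\<delta> * t' / t * nsq (x j) \<le> s * (pivot R j - pivot R' j)" for j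
  proof -
    have "s * (pivot R j - pivot R' j) = \<delta> * nsq (x j) + \<delta>\<^sup>2 * (s * Re (ip (x j) (R (x j))))"
      using resolvent_identity[OF R(1) R'(1)[unfolded t'], of j] ss
      by (simp add: x_def power_mult_distrib power2_eq_square algebra_simps)
    moreover have "\<delta>\<^sup>2 * (s * nsq (x j) / t) \<le> \<delta>\<^sup>2 * (s * Re (ip (x j) (R (x j))))"
      by (intro mult_left_mono R(3)) auto
    moreover have "\<delta> * t' / t * nsq (x j) = \<delta> * nsq (x j) + \<delta>\<^sup>2 * (s * nsq (x j) / t)"
      using t by (simp add: t' field_simps power2_eq_square)
    ultimately show ?thesis by linarith
  qed
  then have "(\<Sum>j<n. \<delta> * t' / t * nsq (x j)) \<le> (\<Sum>j<n. s * (pivot R j - pivot R' j))"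
    by (intro sum_mono) auto
  then have DN: "\<delta> * t' / t * N \<le> D"
    by (simp only: N_def D_def trace_def sum_distrib_left sum_subtractf[symmetric])
  have "0 < \<delta> * t' / t * N" using N t \<delta> by simp
  with DN have D: "0 < D" by simp
  have w0: "0 \<le> w j" for j by (simp add: w_def sum_nonneg)
  have "(\<Sum>j<n. w j) \<le> (\<Sum>j<n. B * nsq (x j))"
    unfolding w_def by (intro sum_mono bessel)
  then have W: "(\<Sum>j<n. w j) \<le> B * N" by (simp add: N_def sum_distrib_left)
  also have "\<dots> \<le> B * (D * t / (\<delta> * t'))"
    using DN t \<delta> by (intro mult_left_mono B) (simp add: field_simps)
  finally have W: "(\<Sum>j<n. w j) / D \<le> B * t / (\<delta> * t')"
    using D by (simp add: field_simps)
  \<comment> \<open>the column is acceptable exactly when this quantity is below \<open>s\<close>\<close>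
  define Z where "Z = (\<lambda>j. w j / D + s * pivot R' j)"
  define Bad where "Bad = {j. j < n \<and> s \<le> Z j}"
  have Zlow: "s / t' \<le> Z j" if "j < n" for j
    using R'(3)[of "a j"] unit[OF that] w0[of j] D
    by (simp add: Z_def pivot_def nsq_def add_increasing)
  have "real (card Bad) * (s * (1 - 1 / t')) = (\<Sum>j\<in>Bad. s - s / t')"
    by (simp add: algebra_simps)
  also have "\<dots> \<le> (\<Sum>j\<in>Bad. Z j - s / t')" by (intro sum_mono) (simp add: Bad_def)
  also have "\<dots> \<le> (\<Sum>j<n. Z j - s / t')"
    by (intro sum_mono2) (auto simp: Bad_def Zlow)
  also have "\<dots> = (\<Sum>j<n. w j) / D + s * trace R' - s * real n / t'"
    by (simp add: Z_def sum.distrib sum_subtractf trace_def sum_distrib_left sum_divide_distrib)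
  also have "s * trace R' \<le> s * trace R" using D by (simp add: D_def algebra_simps)
  also have "s * trace R \<le> s * real n / \<theta>" using barrier_ok by (simp add: barrier_ok_iff R_def)
  also note W
  finally have card: "real (card Bad) * (s * (1 - 1 / t')) \<le>
      B * t / (\<delta> * t') + s * real n / \<theta> - s * real n / t'" by simp
  show thesis
  proof (rule that[of Bad])
    show "Bad \<subseteq> {..<n}" by (auto simp: Bad_def)
    show "barrier_ok gram n s \<theta> t' (insert j \<tau>)" if j: "j < n" "j \<notin> \<tau>" "j \<notin> Bad" for j
    proof -
      define q where "q = s * (1 - pivot R' j)"
      have wq: "w j / D < q" using j by (simp add: Bad_def Z_def q_def algebra_simps)
      moreover have "0 \<le> w j / D" using w0 D by simp
      ultimately have q: "0 < q" by simp
      have "w j / q \<le> D" using wq q D by (simp add: field_simps)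
      moreover have "s * (w j / (1 - pivot R' j)) = w j / q"
      proof -
        have "inverse s = s" using s by auto
        then show ?thesis by (simp add: q_def divide_inverse)
      qed
      ultimately have "s * (trace R' + w j / (1 - pivot R' j)) \<le> s * trace R"
        by (simp add: D_def algebra_simps)
      also have "\<dots> \<le> s * real n / \<theta>" using barrier_ok by (simp add: barrier_ok_iff R_def)
      finally have trace_acc: "s * trace (rank_one_update R' j) \<le> s * real n / \<theta>"
        by (simp add: trace_rank_one_update[OF R'(1)] w_def x_def)
      show ?thesis
      proof (rule barrier_ok_if_dominated[OF t(2) _ _ _ trace_acc])
        show "strictly_dominated s t' (insert j \<tau>)"
          by (rule strictly_dominated_insert[OF R'(1) fin j(2) t(2) dom' q[unfolded q_def]])
        show "resolvent t' (insert j \<tau>) (rank_one_update R' j)"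
          by (rule resolvent_rank_one_update[OF R'(1) fin j(2)]) (use q q_def in auto)
      qed (use \<tau> j in auto)
    qed
  qed (rule card)
qed

text \<open>The norm of $A_\tau$ is at most that of $A$. Instead of square roots, the arithmetic-geometric mean
inequality with weight \<open>B\<close> is applied to each term of $\langle x, A_\tau c \rangle$.\<close>

lemma synth_bessel:
  assumes bessel: "\<And>x. (\<Sum>i<n. (norm (ip (a i) x))\<^sup>2) \<le> B * nsq x"
    and B: "0 < B" and \<tau>: "\<tau> \<subseteq> {..<n}"
  shows "nsq (synth \<tau> c) \<le> B * (\<Sum>p\<in>\<tau>. (norm (c p))\<^sup>2)"
proof -
  define x where "x = synth \<tau> c"
  have "nsq x = (\<Sum>p\<in>\<tau>. Re (c p * ip x (a p)))"
    by (simp add: nsq_def x_def) (subst (2) synth_def, simp add: ip_sum_right ip_scale_right)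
  also have "\<dots> \<le> (\<Sum>p\<in>\<tau>. (norm (ip (a p) x))\<^sup>2 / (2 * B) + B * (norm (c p))\<^sup>2 / 2)"
  proof (rule sum_mono)
    fix p
    have "Re (c p * ip x (a p)) \<le> norm (c p) * norm (ip x (a p))"
      by (metis complex_Re_le_cmod norm_mult)
    also have "norm (ip x (a p)) = norm (ip (a p) x)" by (metis complex_mod_cnj ip_commute)
    also have "norm (c p) * norm (ip (a p) x) \<le> (norm (ip (a p) x))\<^sup>2 / (2 * B) + B * (norm (c p))\<^sup>2 / 2"
    proof -
      have "0 \<le> (norm (ip (a p) x) - B * norm (c p))\<^sup>2 / (2 * B)" using B by simp
      then show ?thesis using B by (simp add: field_simps power2_eq_square)
    qed
    finally show "Re (c p * ip x (a p)) \<le> (norm (ip (a p) x))\<^sup>2 / (2 * B) + B * (norm (c p))\<^sup>2 / 2" .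
  qed
  also have "\<dots> = (\<Sum>p\<in>\<tau>. (norm (ip (a p) x))\<^sup>2) / (2 * B) + B * (\<Sum>p\<in>\<tau>. (norm (c p))\<^sup>2) / 2"
    by (simp add: sum.distrib sum_divide_distrib sum_distrib_left)
  also have "(\<Sum>p\<in>\<tau>. (norm (ip (a p) x))\<^sup>2) \<le> (\<Sum>p<n. (norm (ip (a p) x))\<^sup>2)"
    by (rule sum_mono2) (use \<tau> in auto)
  also note bessel[of x]
  finally have "nsq x \<le> B * nsq x / (2 * B) + B * (\<Sum>p\<in>\<tau>. (norm (c p))\<^sup>2) / 2"
    using B by (simp add: divide_right_mono)
  then show ?thesis using B by (simp add: x_def)
qed

text \<open>If the barrier is at least \<open>\<theta>\<close> above $\|A\|^2$, every set of columns qualifies: then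
$t - M_\tau \ge \theta$, so all diagonal entries of the kernel are at most $1 / \theta$.\<close>

lemma barrier_ok_if_frame_bound_small:
  assumes bessel: "\<And>x. (\<Sum>i<n. (norm (ip (a i) x))\<^sup>2) \<le> B * nsq x"
    and B: "0 < B" and t: "B + \<theta> \<le> t" and \<theta>: "0 < \<theta>" and \<tau>: "\<tau> \<subseteq> {..<n}"
  shows "barrier_ok gram n 1 \<theta> t \<tau>"
proof -
  have t0: "0 < t" using assms by linarith
  have dom: "strictly_dominated 1 t \<tau>"
    unfolding strictly_dominated_def
  proof (intro allI impI)
    fix c :: "nat \<Rightarrow> complex" assume "\<exists>p\<in>\<tau>. c p \<noteq> 0"
    then obtain p where "p \<in> \<tau>" "c p \<noteq> 0" by blast
    then have "0 < (\<Sum>p\<in>\<tau>. (norm (c p))\<^sup>2)"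
      using finite_subset[OF \<tau>] by (intro sum_pos2[of \<tau> p]) auto
    then have "B * (\<Sum>p\<in>\<tau>. (norm (c p))\<^sup>2) < t * (\<Sum>p\<in>\<tau>. (norm (c p))\<^sup>2)"
      using t \<theta> by simp
    with synth_bessel[OF bessel B \<tau>, of c]
    show "1 * nsq (synth \<tau> c) < 1 * t * (\<Sum>p\<in>\<tau>. (norm (c p))\<^sup>2)" by simp
  qed
  have piv: "p \<in> \<tau> \<Longrightarrow> 0 < 1 * (1 - pivot (Res t \<tau> p) p)" for p
    by (rule Res_pivot_sign[OF t0 dom]) (use \<tau> finite_subset in auto)
  define R where "R = Res t \<tau> n"
  note R = resolvent_if_pivots[OF t0 \<tau> piv, folded R_def]
  have "pivot R j \<le> 1 / \<theta>" if j: "j < n" for j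
  proof -
    define x where "x = R (a j)"
    define q where "q = pivot R j"
    have "q = Re (ip x (sc (of_real t) x - frame_op \<tau> x))"
      using resolventD(4)[OF R(1), of "a j"]
      by (simp add: q_def pivot_def x_def resolventD(3)[OF R(1)])
    also have "\<dots> = t * nsq x - (\<Sum>p\<in>\<tau>. (norm (ip (a p) x))\<^sup>2)"
    proof -
      have "ip (a p) x * ip x (a p) = of_real ((norm (ip (a p) x))\<^sup>2)" for p
        by (subst (2) ip_commute) (rule complex_norm_square[symmetric])
      then show ?thesis
        by (simp add: ip_simps frame_op_def synth_def ip_sum_right ip_self)
    qed
    finally have "q = t * nsq x - (\<Sum>p\<in>\<tau>. (norm (ip (a p) x))\<^sup>2)" .
    moreover have "(\<Sum>p\<in>\<tau>. (norm (ip (a p) x))\<^sup>2) \<le> (\<Sum>p<n. (norm (ip (a p) x))\<^sup>2)"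
      by (rule sum_mono2) (use \<tau> in auto)
    ultimately have "(t - B) * nsq x \<le> q" using bessel[of x] by (simp add: left_diff_distrib)
    moreover have "\<theta> * nsq x \<le> (t - B) * nsq x"
      using t nsq_nonneg[of x] by (intro mult_right_mono) auto
    moreover have "q\<^sup>2 \<le> nsq x"
      using cauchy_schwarz_real[of "a j" x] unit[OF j] by (simp add: q_def pivot_def x_def nsq_def)
    then have "\<theta> * q\<^sup>2 \<le> \<theta> * nsq x" using \<theta> by simp
    ultimately have "\<theta> * q\<^sup>2 \<le> q" by linarith
    then have "q * (\<theta> * q - 1) \<le> 0" by (simp add: power2_eq_square algebra_simps)
    then have "q \<le> 0 \<or> \<theta> * q \<le> 1" by (auto simp: mult_le_0_iff)
    moreover have "0 \<le> 1 / \<theta>" using \<theta> by simp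
    moreover have "q \<le> 1 / \<theta>" if "\<theta> * q \<le> 1"
      using that \<theta> by (simp add: pos_le_divide_eq mult.commute)
    ultimately have "q \<le> 1 / \<theta>" by linarith
    then show ?thesis by (simp add: q_def)
  qed
  then have "trace R \<le> (\<Sum>i<n. 1 / \<theta>)" unfolding trace_def by (intro sum_mono) auto
  also have "\<dots> = real n / \<theta>" by simp
  finally have "1 * trace R \<le> 1 * real n / \<theta>" by (simp only: mult_1_left)
  then show ?thesis by (intro barrier_ok_if_dominated[OF t0 \<tau> dom R(1)])
qed


lemma frame_bound_ge_1:
  assumes "\<And>x. (\<Sum>i<n. (norm (ip (a i) x))\<^sup>2) \<le> B * nsq x" "0 < n"
  shows "1 \<le> B"
proof -
  have "(norm (ip (a 0) (a 0)))\<^sup>2 \<le> (\<Sum>i<n. (norm (ip (a i) (a 0)))\<^sup>2)"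
    by (rule member_le_sum) (use assms(2) in auto)
  also have "\<dots> \<le> B * nsq (a 0)" by (rule assms(1))
  finally show ?thesis using unit[OF assms(2)] by (simp add: nsq_def)
qed

lemma barrier_ok_empty:
  assumes "0 < t" "0 < \<theta>" "s * \<theta> \<le> s * t"
  shows "barrier_ok gram n s \<theta> t {}"
proof -
  have Res0: "Res t {} m = (\<lambda>x. sc (of_real (1 / t)) x)" for m
    by (induction m) auto
  have "trace (Res t {} n) = (\<Sum>i<n. 1 / t)"
    unfolding trace_def pivot_def Res0 by (intro sum.cong) (auto simp: ip_scale_right unit)
  moreover have "s * real n / t \<le> s * real n / \<theta>"
  proof -
    have "0 \<le> real n * (s * t - s * \<theta>) / (t * \<theta>)" using assms by simp
    also have "\<dots> = s * real n / \<theta> - s * real n / t" using assms by (simp add: field_simps)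
    finally show ?thesis by simp
  qed
  ultimately show ?thesis by (simp add: barrier_ok_iff)
qed

text \<open>If \<open>B \<le> 2\<close>, any further column will do. Otherwise fewer than half of the columns
have been selected, and fewer than half of them are bad.\<close>

lemma next_column_bounded_norm:
  assumes bessel: "\<And>x. (\<Sum>i<n. (norm (ip (a i) x))\<^sup>2) \<le> B * nsq x"
    and n: "0 < n" and k: "k \<le> n" "real k \<le> 2 * real n / B" "real k - 1 < real n / B"
    and \<tau>: "\<tau> \<subseteq> {..<n}" "card \<tau> < k"
    and barrier_ok: "card \<tau> = 0 \<or> barrier_ok_at gram n bounded_norm_barrier k (card \<tau>) \<tau>"
  shows "\<exists>j<n. j \<notin> \<tau> \<and> barrier_ok_at gram n bounded_norm_barrier k (card \<tau> + 1) (insert j \<tau>)"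
proof -
  define c where "c = card \<tau>"
  define t where "t = 8 + 8 * real c / real k"
  define t' where "t' = 8 + 8 * real (c + 1) / real k"
  have k0: "0 < k" using \<tau> by simp
  have B1: "1 \<le> B" by (rule frame_bound_ge_1[OF bessel n])
  have fin: "finite \<tau>" using \<tau>(1) finite_subset by auto
  have goal: "barrier_ok_at gram n bounded_norm_barrier k (card \<tau> + 1) \<sigma> \<longleftrightarrow> barrier_ok gram n 1 6 t' \<sigma>" for \<sigma>
    by (simp add: barrier_ok_at_def bounded_norm_barrier_def level_def t'_def c_def)
  have t: "8 \<le> t" by (simp add: t_def)
  have tt': "t' = t + 1 * (8 / real k)" by (simp add: t_def t'_def add_divide_distrib distrib_left)
  have t': "8 \<le> t'" by (simp add: t'_def)
  have t'16: "t' \<le> 16" using \<tau>(2) k0 by (simp add: t'_def c_def field_simps)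
  have "0 < 8 / real k" using k0 by simp
  then have tle: "t \<le> t'" using tt' by linarith
  show ?thesis
  proof (cases "B \<le> 2")
    case True
    have "card \<tau> < card {..<n}" using \<tau> k by simp
    then obtain j where j: "j < n" "j \<notin> \<tau>"
      using card_mono[OF fin, of "{..<n}"] by (metis leD lessThan_iff subsetI)
    have "barrier_ok gram n 1 6 t' (insert j \<tau>)"
      by (rule barrier_ok_if_frame_bound_small[OF bessel]) (use True B1 t' j \<tau> in auto)
    with j show ?thesis unfolding goal by blast
  next
    case False
    have pt: "barrier_ok gram n 1 6 t \<tau>"
    proof (cases "card \<tau> = 0")
      case True
      then have "\<tau> = {}" using fin by simp
      then show ?thesis using barrier_ok_empty[of t 6 1] t by simp
    next
      case False
      with barrier_ok show ?thesis
        by (simp add: barrier_ok_at_def bounded_norm_barrier_def level_def t_def c_def)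
    qed
    \<comment> \<open>the barrier moves by \<open>8 / k\<close>, which is at least \<open>4 B / n\<close>\<close>
    obtain Bad where Bad: "Bad \<subseteq> {..<n}"
      "real (card Bad) * (1 * (1 - 1 / t')) \<le> B * t / (8 / real k * t') + 1 * real n / 6 - 1 * real n / t'"
      "\<And>j. j < n \<Longrightarrow> j \<notin> \<tau> \<Longrightarrow> j \<notin> Bad \<Longrightarrow> barrier_ok gram n 1 6 t' (insert j \<tau>)"
      by (rule few_bad_columns[OF _ _ _ _ tt' \<tau>(1) n _ bessel pt]) (use t t' B1 k0 in auto)
    have "B * t / (8 / real k * t') = B * real k / 8 * (t / t')" by simp
    also have "\<dots> \<le> B * real k / 8 * 1"
      using t' tle B1 by (intro mult_left_mono) (simp_all add: divide_le_eq_1)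
    also have "\<dots> \<le> real n / 4" using k(2) B1 by (simp add: field_simps)
    finally have 1: "B * t / (8 / real k * t') \<le> real n / 4" .
    have h: "real n / 16 \<le> real n / t'" using t'16 t' by (intro divide_left_mono) auto
    have "real (card Bad) * (1 - 1 / t') \<le> B * t / (8 / real k * t') + (real n / 6 - real n / t')"
      using Bad(2) by (simp add: algebra_simps)
    also have "\<dots> \<le> real n / 4 + (real n / 6 - real n / 16)"
      using 1 h by (intro add_mono diff_mono) auto
    finally have "real (card Bad) * (1 - 1 / t') \<le> real n / 4 + (real n / 6 - real n / 16)" .
    moreover have "real (card Bad) * (7 / 8) \<le> real (card Bad) * (1 - 1 / t')"
      using t' by (intro mult_left_mono) (auto simp: field_simps)
    ultimately have "real (card Bad) * (7 / 8) \<le> real n / 4 + (real n / 6 - real n / 16)"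
      by (rule order_trans[rotated])
    then have "real (card Bad) < real n / 2" using n by simp
    moreover have "real (card \<tau>) < real n / 2"
    proof -
      have "real n / B \<le> real n / 2" using False by (intro divide_left_mono) auto
      then show ?thesis using k(3) \<tau>(2) by linarith
    qed
    ultimately have "card Bad + card \<tau> < card {..<n}" by simp
    then have "card (Bad \<union> \<tau>) < card {..<n}" using card_Un_le[of Bad \<tau>] by linarith
    then obtain j where "j < n" "j \<notin> Bad \<union> \<tau>"
      using card_mono[of "Bad \<union> \<tau>" "{..<n}"] fin finite_subset[OF Bad(1)]
      by (metis finite_Un finite_lessThan leD lessThan_iff subsetI)
    then show ?thesis unfolding goal using Bad(3)[of j] by blast
  qed
qed

text \<open>Each of the two averaging arguments excludes at most a quarter of the columns, and at most a quarter has
been selected already.\<close>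

lemma next_column_well_conditioned:
  assumes bessel: "\<And>x. (\<Sum>i<n. (norm (ip (a i) x))\<^sup>2) \<le> B * nsq x"
    and n: "0 < n" and k: "real k \<le> real n / B / 500"
    and \<tau>: "\<tau> \<subseteq> {..<n}" "card \<tau> < k"
    and barrier_ok: "card \<tau> = 0 \<or>
      barrier_ok_at gram n upper_barrier k (card \<tau>) \<tau> \<and> barrier_ok_at gram n lower_barrier k (card \<tau>) \<tau>"
  shows "\<exists>j<n. j \<notin> \<tau> \<and> barrier_ok_at gram n upper_barrier k (card \<tau> + 1) (insert j \<tau>)
    \<and> barrier_ok_at gram n lower_barrier k (card \<tau> + 1) (insert j \<tau>)"
proof -
  define c where "c = card \<tau>"
  define u where "u = 7 / 5 + 1 / 25 * real c / real k"
  define u' where "u' = 7 / 5 + 1 / 25 * real (c + 1) / real k"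
  define l where "l = 1 / 2 - 1 / 50 * real c / real k"
  define l' where "l' = 1 / 2 - 1 / 50 * real (c + 1) / real k"
  have k0: "0 < k" using \<tau> by simp
  have B1: "1 \<le> B" by (rule frame_bound_ge_1[OF bessel n])
  have fin: "finite \<tau>" using \<tau>(1) finite_subset by auto
  have ck: "real (c + 1) / real k \<le> 1" "0 \<le> real c / real k"
    using \<tau>(2) k0 by (auto simp: c_def)
  have Bk: "B * real k \<le> real n / 500" using k B1 by (simp add: field_simps)
  have goal: "barrier_ok_at gram n upper_barrier k (card \<tau> + 1) \<sigma> \<longleftrightarrow> barrier_ok gram n 1 (7/5) u' \<sigma>"
    "barrier_ok_at gram n lower_barrier k (card \<tau> + 1) \<sigma> \<longleftrightarrow> barrier_ok gram n (-1) (1/2) l' \<sigma>" for \<sigma>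
    by (simp_all add: barrier_ok_at_def upper_barrier_def lower_barrier_def level_def u'_def l'_def c_def
        of_rat_divide of_rat_minus)
  have uu': "u' = u + 1 * (1 / 25 / real k)" by (simp add: u_def u'_def add_divide_distrib distrib_left)
  have ll': "l' = l + -1 * (1 / 50 / real k)" by (simp add: l_def l'_def add_divide_distrib distrib_left)
  have kpos: "0 < 1 / real k" using k0 by simp
  have u: "7 / 5 \<le> u" "u < u'" "u' \<le> 36 / 25"
    using ck kpos by (simp_all add: u_def u'_def field_simps)
  have l: "12 / 25 \<le> l'" "l' < l" "l \<le> 1 / 2"
    using ck kpos by (simp_all add: l_def l'_def field_simps)
  have "barrier_ok gram n 1 (7/5) u \<tau> \<and> barrier_ok gram n (-1) (1/2) l \<tau>"
  proof (cases "card \<tau> = 0")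
    case True
    then have "\<tau> = {}" using fin by simp
    then show ?thesis using barrier_ok_empty[of u "7/5" 1] barrier_ok_empty[of l "1/2" "-1"] u l by simp
  next
    case False
    with barrier_ok show ?thesis
      by (simp add: barrier_ok_at_def upper_barrier_def lower_barrier_def level_def u_def l_def c_def
          of_rat_divide of_rat_minus)
  qed
  then have pu: "barrier_ok gram n 1 (7/5) u \<tau>" and pl: "barrier_ok gram n (-1) (1/2) l \<tau>" by auto
  obtain Bu where Bu: "Bu \<subseteq> {..<n}"
    "real (card Bu) * (1 * (1 - 1 / u')) \<le>
       B * u / (1 / 25 / real k * u') + 1 * real n / (7/5) - 1 * real n / u'"
    "\<And>j. j < n \<Longrightarrow> j \<notin> \<tau> \<Longrightarrow> j \<notin> Bu \<Longrightarrow> barrier_ok gram n 1 (7/5) u' (insert j \<tau>)"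
    by (rule few_bad_columns[OF _ _ _ _ uu' \<tau>(1) n _ bessel pu]) (use u B1 k0 in auto)
  obtain Bl where Bl: "Bl \<subseteq> {..<n}"
    "real (card Bl) * (-1 * (1 - 1 / l')) \<le>
       B * l / (1 / 50 / real k * l') + -1 * real n / (1/2) - -1 * real n / l'"
    "\<And>j. j < n \<Longrightarrow> j \<notin> \<tau> \<Longrightarrow> j \<notin> Bl \<Longrightarrow> barrier_ok gram n (-1) (1/2) l' (insert j \<tau>)"
    by (rule few_bad_columns[OF _ _ _ _ ll' \<tau>(1) n _ bessel pl]) (use l B1 k0 in auto)
  have cu: "real (card Bu) \<le> 1 / 4 * real n"
  proof -
    have "B * u / (1 / 25 / real k * u') = 25 * (B * real k) * (u / u')" by simp
    also have "\<dots> \<le> 25 * (B * real k) * 1" using u B1 k0 by (intro mult_left_mono) auto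
    finally have 1: "B * u / (1 / 25 / real k * u') \<le> real n / 20" using Bk by simp
    have "25 / 36 * real n \<le> real n / u'"
      using u divide_left_mono[of u' "36/25" "real n"] by simp
    with 1 Bu(2) have "real (card Bu) * (1 - 1 / u') \<le> (1 / 20 + 5 / 7 - 25 / 36) * real n"
      by (simp add: algebra_simps)
    moreover have "real (card Bu) * (2 / 7) \<le> real (card Bu) * (1 - 1 / u')"
      using u by (intro mult_left_mono) (auto simp: field_simps)
    ultimately show ?thesis by simp
  qed
  have cl: "real (card Bl) \<le> 1 / 4 * real n"
  proof -
    have "B * l / (1 / 50 / real k * l') = 50 * (B * real k) * (l / l')" by simp
    also have "\<dots> \<le> 50 * (B * real k) * (25 / 24)"
      using l B1 k0 by (intro mult_left_mono) (auto simp: field_simps)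
    finally have 1: "B * l / (1 / 50 / real k * l') \<le> 5 / 48 * real n" using Bk by simp
    have h: "real n / l' \<le> 25 / 12 * real n"
      using l divide_left_mono[of "12/25" l' "real n"] by simp
    have "real (card Bl) * (1 / l' - 1) \<le> B * l / (1 / 50 / real k * l') + (real n / l' - 2 * real n)"
      using Bl(2) by (simp add: algebra_simps)
    also have "\<dots> \<le> 5 / 48 * real n + (25 / 12 * real n - 2 * real n)"
      using 1 h by (intro add_mono diff_mono) auto
    finally have "real (card Bl) * (1 / l' - 1) \<le> 5 / 48 * real n + (25 / 12 * real n - 2 * real n)" .
    moreover have "real (card Bl) * 1 \<le> real (card Bl) * (1 / l' - 1)"
      using l by (intro mult_left_mono) (auto simp: field_simps)
    ultimately have "real (card Bl) * 1 \<le> 5 / 48 * real n + (25 / 12 * real n - 2 * real n)"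
      by (rule order_trans[rotated])
    then show ?thesis by simp
  qed
  have "real (card \<tau>) \<le> 1 / 4 * real n"
  proof -
    have "1 * real k \<le> B * real k" using B1 by (intro mult_right_mono) auto
    then show ?thesis using Bk \<tau>(2) by linarith
  qed
  with cu cl n have "card Bu + card Bl + card \<tau> < card {..<n}" by simp
  then have "card (Bu \<union> Bl \<union> \<tau>) < card {..<n}"
    using card_Un_le[of "Bu \<union> Bl" \<tau>] card_Un_le[of Bu Bl] by linarith
  then obtain j where "j < n" "j \<notin> Bu \<union> Bl \<union> \<tau>"
    using card_mono[of "Bu \<union> Bl \<union> \<tau>" "{..<n}"] fin finite_subset[OF Bu(1)] finite_subset[OF Bl(1)]
    by (metis finite_Un finite_lessThan leD lessThan_iff subsetI)
  then show ?thesis unfolding goal using Bu(3)[of j] Bl(3)[of j] by blast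
qed


lemma synth_bound_if_barrier_ok:
  assumes barrier_ok: "barrier_ok gram n s \<theta> t \<tau>" and t: "0 < t" and \<tau>: "\<tau> \<subseteq> {..<n}"
  shows "s * nsq (synth \<tau> c) \<le> s * t * (\<Sum>p\<in>\<tau>. (norm (c p))\<^sup>2)"
proof (cases "\<exists>p\<in>\<tau>. c p \<noteq> 0")
  case True
  have "strictly_dominated s t \<tau>"
    by (rule resolvent_if_pivots(2)[OF t \<tau>]) (use barrier_ok \<tau> in \<open>auto simp: barrier_ok_iff\<close>)
  then show ?thesis using True by (auto simp: strictly_dominated_def intro: less_imp_le)
next
  case False
  then show ?thesis by (simp add: synth_def nsq_def)
qed

end

section \<open>The selection program\<close>

text \<open>Memory layout: arrays 4 and 5 hold the real and imaginary parts of the kernel, row 0 of array 3 is the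
indicator of the current set, and entries $(0, 0)$ and $(0, 1)$ of array 6 hold the barrier level and the
trace. Natural variables 2 to 5 are loop indices, 6 is the row offset of the current kernel, 7 is
the verdict of the checks, 8 counts the target sizes from 0, 9 counts the passes over the columns, 10 is
the candidate column, and 11 is the size of the current set.\<close>

abbreviation (input) kre :: "nexp \<Rightarrow> nexp \<Rightarrow> rexp" where "kre \<equiv> RGet 4"
abbreviation (input) kim :: "nexp \<Rightarrow> nexp \<Rightarrow> rexp" where "kim \<equiv> RGet 5"
abbreviation (input) member :: "nexp \<Rightarrow> rexp" where "member \<equiv> RGet 3 (NConst 0)"
abbreviation (input) level_cell :: rexp where "level_cell \<equiv> RGet 6 (NConst 0) (NConst 0)"
abbreviation (input) trace_acc :: rexp where "trace_acc \<equiv> RGet 6 (NConst 0) (NConst 1)"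

abbreviation (input) cols :: nexp where "cols \<equiv> NVar 1"
abbreviation (input) ivar :: nexp where "ivar \<equiv> NVar 2"
abbreviation (input) jvar :: nexp where "jvar \<equiv> NVar 3"
abbreviation (input) rvar :: nexp where "rvar \<equiv> NVar 4"
abbreviation (input) pvar :: nexp where "pvar \<equiv> NVar 5"
abbreviation (input) base :: nexp where "base \<equiv> NVar 6"
abbreviation (input) flag_var :: nexp where "flag_var \<equiv> NVar 7"
abbreviation (input) target :: nexp where "target \<equiv> NAdd (NVar 8) (NConst 1)"
abbreviation (input) cand_var :: nexp where "cand_var \<equiv> NVar 10"
abbreviation (input) size_var :: nexp where "size_var \<equiv> NVar 11"

definition init_entry :: prog where
  "init_entry =
     (SetR 4 ivar jvar (RConst 0) ;; SetR 5 ivar jvar (RConst 0) ;;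
      For 4 0
       (SetR 4 ivar jvar (RAdd (kre ivar jvar)
          (RDiv (RAdd (RMul (RGet 0 rvar ivar) (RGet 0 rvar jvar)) (RMul (RGet 1 rvar ivar) (RGet 1 rvar jvar))) level_cell)) ;;
        SetR 5 ivar jvar (RAdd (kim ivar jvar)
          (RDiv (RSub (RMul (RGet 0 rvar ivar) (RGet 1 rvar jvar)) (RMul (RGet 1 rvar ivar) (RGet 0 rvar jvar))) level_cell))))"

text \<open>The kernel after one elimination step is written to the next \<open>n\<close> rows of the array, below the old
one; this way no entry is overwritten while it is still needed. The indicator of the set is a factor of the
correction, so columns outside the set leave the kernel unchanged.\<close>

definition update_entry :: prog where
  "update_entry =
     (SetR 4 (NAdd base (NAdd cols ivar)) jvar (RAdd (kre (NAdd base ivar) jvar) (RMul (member pvar) (RDiv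
        (RSub (RMul (kre (NAdd base ivar) pvar) (kre (NAdd base pvar) jvar))
              (RMul (kim (NAdd base ivar) pvar) (kim (NAdd base pvar) jvar)))
        (RSub (RConst 1) (kre (NAdd base pvar) pvar))))) ;;
      SetR 5 (NAdd base (NAdd cols ivar)) jvar (RAdd (kim (NAdd base ivar) jvar) (RMul (member pvar) (RDiv
        (RAdd (RMul (kre (NAdd base ivar) pvar) (kim (NAdd base pvar) jvar))
              (RMul (kim (NAdd base ivar) pvar) (kre (NAdd base pvar) jvar)))
        (RSub (RConst 1) (kre (NAdd base pvar) pvar))))))"

definition init_kernel :: prog where "init_kernel = For 2 1 (For 3 1 init_entry)"
definition update_kernel :: prog where "update_kernel = For 2 1 (For 3 1 update_entry)"

definition eliminate :: "rat \<Rightarrow> prog" where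
  "eliminate \<sigma> =
     (If (BAnd (RLess (RConst 0) (member pvar))
            (BNot (RLess (RConst 0) (RMul (RConst \<sigma>) (RSub (RConst 1) (kre (NAdd base pvar) pvar))))))
        (SetN 7 (NConst 0)) Nop ;;
      update_kernel ;;
      SetN 6 (NAdd base cols))"

definition check_barrier :: "barrier \<Rightarrow> prog" where
  "check_barrier b =
     (SetR 6 (NConst 0) (NConst 0) (RAdd (RConst (start b))
        (RDiv (RMul (RConst (drift b)) (ROfNat (NAdd size_var (NConst 1)))) (ROfNat target))) ;;
      init_kernel ;;
      SetN 6 (NConst 0) ;;
      For 5 1 (eliminate (side b)) ;;
      SetR 6 (NConst 0) (NConst 1) (RConst 0) ;;
      For 2 1 (SetR 6 (NConst 0) (NConst 1) (RAdd trace_acc (kre (NAdd base ivar) ivar))) ;;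
      If (RLess (RDiv (RMul (RConst (side b)) (ROfNat cols)) (RConst (threshold b)))
            (RMul (RConst (side b)) trace_acc))
        (SetN 7 (NConst 0)) Nop)"

definition try_candidate :: "barrier \<Rightarrow> barrier \<Rightarrow> prog" where
  "try_candidate b b' =
     If (BAnd (NLess size_var target) (BNot (RLess (RConst 0) (member cand_var))))
       (SetR 3 (NConst 0) cand_var (RConst 1) ;;
        SetN 7 (NConst 1) ;;
        check_barrier b ;;
        check_barrier b' ;;
        If (NLess (NConst 0) flag_var)
          (SetN 11 (NAdd size_var (NConst 1)))
          (SetR 3 (NConst 0) cand_var (RConst 0)))
       Nop"

text \<open>As many passes over all candidates are made as there are columns. A pass that selects nothing has tested
every candidate against the current set, so each pass makes progress whenever progress is possible, and
\<open>n\<close> passes reach every target size up to \<open>n\<close>. The output is replaced only in case of success.\<close>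

definition greedy_selection :: "barrier \<Rightarrow> barrier \<Rightarrow> prog" where
  "greedy_selection b b' =
     (For 2 1 (SetR 3 (NConst 0) ivar (RConst 0)) ;;
      SetN 11 (NConst 0) ;;
      For 9 1 (For 10 1 (try_candidate b b')) ;;
      If (NLess (NVar 8) size_var)
        (For 2 1 (SetR 2 (NConst 0) ivar (member ivar)))
        Nop)"

text \<open>Before any search succeeds, the output is the first column alone, which has condition number $1$. This
default covers matrices for which the required number of columns is at most one.\<close>

definition select_columns :: "barrier \<Rightarrow> barrier \<Rightarrow> prog" where
  "select_columns b b' = (SetR 2 (NConst 0) (NConst 0) (RConst 1) ;; For 8 1 (greedy_selection b b'))"

lemma assigned_check_barrier:
  "assigned_vars (check_barrier b) = {2, 3, 4, 5, 6, 7}" "assigned_arrays (check_barrier b) = {4, 5, 6}"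
  by (auto simp: check_barrier_def init_kernel_def update_kernel_def init_entry_def update_entry_def
      eliminate_def)

lemma well_formed_select_columns: "well_formed (select_columns b b')"
  by (simp add: select_columns_def greedy_selection_def try_candidate_def assigned_check_barrier)
    (simp add: check_barrier_def init_kernel_def update_kernel_def init_entry_def update_entry_def
      eliminate_def)

definition entry :: "state \<Rightarrow> nat \<Rightarrow> nat \<Rightarrow> complex" where
  "entry s i j = Complex (rarr s 4 i j) (rarr s 5 i j)"

definition input_entry :: "state \<Rightarrow> nat \<Rightarrow> nat \<Rightarrow> complex" where
  "input_entry s i j = Complex (rarr s 0 i j) (rarr s 1 i j)"

definition input_gram :: "state \<Rightarrow> nat \<Rightarrow> nat \<Rightarrow> complex" where
  "input_gram s i j = (\<Sum>r<nvar s 0. cnj (input_entry s r i) * input_entry s r j)"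

definition represents :: "state \<Rightarrow> nat set \<Rightarrow> bool" where
  "represents s \<tau> \<longleftrightarrow> (\<forall>j < nvar s 1. rarr s 3 0 j = (if j \<in> \<tau> then 1 else 0))"

lemma init_kernel_entries:
  assumes "i < nvar s 1" "j < nvar s 1"
  shows "entry (sem init_kernel s) i j = input_gram s i j / of_real (rarr s 6 0 0)"
proof -
  define E where "E = (\<lambda>s' :: state. nvar s' 0 = nvar s 0 \<and> nvar s' 1 = nvar s 1 \<and> rarr s' 0 = rarr s 0 \<and>
     rarr s' 1 = rarr s 1 \<and> rarr s' 6 = rarr s 6)"
  define D where "D = (\<lambda>i j s'. entry s' i j = input_gram s i j / of_real (rarr s 6 0 0))"
  have entry_one: "E (sem init_entry s') \<and> D i j (sem init_entry s') \<and>
      (\<forall>i' j'. (i', j') \<noteq> (i, j) \<longrightarrow> entry (sem init_entry s') i' j' = entry s' i' j')"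
    if E: "E s'" and ij: "nvar s' 2 = i" "nvar s' 3 = j" for i j s'
  proof -
    define I where "I = (\<lambda>k (s'' :: state). E s'' \<and> nvar s'' 2 = i \<and> nvar s'' 3 = j \<and>
       entry s'' i j = (\<Sum>r<k. cnj (input_entry s r i) * input_entry s r j) / of_real (rarr s 6 0 0) \<and>
       (\<forall>i' j'. (i', j') \<noteq> (i, j) \<longrightarrow> entry s'' i' j' = entry s' i' j'))"
    have "I (nvar s' 0) (sem init_entry s')"
    proof -
      define s0 where "s0 = set_rarr 5 i j 0 (set_rarr 4 i j 0 s')"
      have n0: "nvar s0 0 = nvar s' 0" by (simp add: s0_def)
      show ?thesis
        unfolding init_entry_def sem.simps(4)
        apply (simp only: sem.simps(2,3) nval.simps rval.simps of_rat_0 ij nvar_set_rarr)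
        apply (fold s0_def, subst n0[symmetric])
      proof (rule sem_For_induct)
        show "I 0 (set_nvar 4 0 s0)"
          using E ij by (auto simp: I_def E_def s0_def entry_def complex_eq_iff)
        fix k s'' assume "nvar s'' 4 = k" "I k s''"
        then show "I (Suc k) (set_nvar 4 (Suc k) (sem
            (SetR 4 ivar jvar (RAdd (kre ivar jvar)
              (RDiv (RAdd (RMul (RGet 0 rvar ivar) (RGet 0 rvar jvar)) (RMul (RGet 1 rvar ivar) (RGet 1 rvar jvar))) level_cell)) ;;
             SetR 5 ivar jvar (RAdd (kim ivar jvar)
              (RDiv (RSub (RMul (RGet 0 rvar ivar) (RGet 1 rvar jvar)) (RMul (RGet 1 rvar ivar) (RGet 0 rvar jvar))) level_cell)))
            s''))"
          by (auto simp: I_def E_def entry_def input_entry_def complex_eq_iff add_divide_distrib)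
      qed simp
    qed
    moreover have "nvar s' 0 = nvar s 0" using E by (simp add: E_def)
    ultimately show ?thesis by (auto simp: I_def D_def input_gram_def)
  qed
  have "E (sem init_kernel s) \<and> (\<forall>i<nvar s 1. \<forall>j<nvar s 1. D i j (sem init_kernel s))"
    unfolding init_kernel_def
  proof (rule sem_For_For)
    fix i j s' assume "E s'" "nvar s' 2 = i" "nvar s' 3 = j"
    from entry_one[OF this]
    show "E (sem init_entry s') \<and> D i j (sem init_entry s') \<and>
       (\<forall>i'<nvar s 1. \<forall>j'<nvar s 1. (i', j') \<noteq> (i, j) \<longrightarrow> D i' j' s' \<longrightarrow> D i' j' (sem init_entry s'))"
      by (auto simp: D_def)
  qed (auto simp: E_def D_def init_entry_def entry_def)
  then show ?thesis using assms by (simp add: D_def)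
qed

lemma update_kernel_entries:
  assumes rep: "represents s \<tau>" and p: "nvar s 5 = p" "p < nvar s 1"
    and K: "\<And>i j. i < nvar s 1 \<Longrightarrow> j < nvar s 1 \<Longrightarrow> entry s (nvar s 6 + i) j = kern g t \<tau> p i j"
    and ij: "i < nvar s 1" "j < nvar s 1"
  shows "entry (sem update_kernel s) (nvar s 6 + (nvar s 1 + i)) j = kern g t \<tau> (Suc p) i j"
proof -
  define n where "n = nvar s 1"
  define m where "m = nvar s 6"
  define E where "E = (\<lambda>s' :: state. nvar s' 1 = n \<and> nvar s' 5 = p \<and> nvar s' 6 = m \<and>
     rarr s' 3 = rarr s 3 \<and> (\<forall>i<n. \<forall>j<n. entry s' (m + i) j = kern g t \<tau> p i j))"
  define D where "D = (\<lambda>i j s'. entry s' (m + (n + i)) j = kern g t \<tau> (Suc p) i j)"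
  have "E (sem update_kernel s) \<and> (\<forall>i<n. \<forall>j<n. D i j (sem update_kernel s))"
    unfolding update_kernel_def
  proof (rule sem_For_For)
    fix i j s' assume i: "i < n" "j < n" and E: "E s'" and ij: "nvar s' 2 = i" "nvar s' 3 = j"
    have pn: "p < n" using p by (simp add: n_def)
    have mem: "rarr s' 3 0 p = (if p \<in> \<tau> then 1 else 0)"
      using E rep p by (simp add: E_def represents_def)
    have kr: "rarr s' 4 (m + i) j = Re (kern g t \<tau> p i j)" "rarr s' 5 (m + i) j = Im (kern g t \<tau> p i j)"
      if "i < n" "j < n" for i j
      using E that by (auto simp: E_def entry_def complex_eq_iff)
    have s: "nvar s' 1 = n" "nvar s' (Suc 0) = n" "nvar s' 5 = p" "nvar s' 6 = m" using E by (auto simp: E_def)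
    have other: "entry (sem update_entry s') i' j' = entry s' i' j'" if "(i', j') \<noteq> (m + (n + i), j)" for i' j'
      using that s ij by (auto simp: update_entry_def entry_def)
    have "D i j (sem update_entry s')"
      using i pn s ij
      by (auto simp: D_def update_entry_def entry_def kr mem complex_eq_iff
          simp del: of_real_diff)
    moreover have "E (sem update_entry s')"
      using E unfolding E_def by (auto simp: other) (auto simp: update_entry_def)
    ultimately show "E (sem update_entry s') \<and> D i j (sem update_entry s') \<and>
       (\<forall>i'<n. \<forall>j'<n. (i', j') \<noteq> (i, j) \<longrightarrow> D i' j' s' \<longrightarrow> D i' j' (sem update_entry s'))"
      by (auto simp: D_def other)
  qed (use p K in \<open>auto simp: E_def D_def update_entry_def entry_def n_def m_def\<close>)
  then show ?thesis using ij by (simp add: D_def n_def m_def)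
qed


lemma assigned_init_kernel:
  "assigned_vars init_kernel = {2, 3, 4}" "assigned_arrays init_kernel = {4, 5}"
  by (auto simp: init_kernel_def init_entry_def)

lemma assigned_update_kernel:
  "assigned_vars update_kernel = {2, 3}" "assigned_arrays update_kernel = {4, 5}"
  by (auto simp: update_kernel_def update_entry_def)

text \<open>The verdict variable can only be reset, so after the loop it records whether all pivots had the right
sign; the last kernel starts at row $n \cdot n$.\<close>

lemma sem_eliminate_loop:
  fixes s :: state and \<tau> :: "nat set" and \<sigma> :: rat and g t
  defines "n \<equiv> nvar s 1"
    and "good \<equiv> \<lambda>q. q \<in> \<tau> \<longrightarrow> 0 < of_rat \<sigma> * (1 - Re (kern g t \<tau> q q q))"
  assumes rep: "represents s \<tau>" and base: "nvar s 6 = 0"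
    and K: "\<And>i j. i < n \<Longrightarrow> j < n \<Longrightarrow> entry s i j = g i j / of_real t"
  shows "nvar (sem (For 5 1 (eliminate \<sigma>)) s) 7 = (if \<forall>q<n. good q then nvar s 7 else 0) \<and>
    nvar (sem (For 5 1 (eliminate \<sigma>)) s) 6 = n * n \<and>
    (\<forall>i<n. \<forall>j<n. entry (sem (For 5 1 (eliminate \<sigma>)) s) (n * n + i) j = kern g t \<tau> n i j)"
proof -
  define I where "I = (\<lambda>p (s' :: state). nvar s' 1 = n \<and> rarr s' 3 = rarr s 3 \<and> nvar s' 6 = p * n \<and>
    (\<forall>i<n. \<forall>j<n. entry s' (p * n + i) j = kern g t \<tau> p i j) \<and>
    nvar s' 7 = (if \<forall>q<p. good q then nvar s 7 else 0))"
  have "I (nvar s 1) (sem (For 5 1 (eliminate \<sigma>)) s)"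
  proof (rule sem_For_induct)
    show "5 \<notin> assigned_vars (eliminate \<sigma>)" by (simp add: eliminate_def assigned_update_kernel)
    show "I 0 (set_nvar 5 0 s)"
      using base K by (simp add: I_def n_def entry_def)
    fix p s' assume p: "p < nvar s 1" "nvar s' 5 = p" and I: "I p s'"
    have pn: "p < n" using p by (simp add: n_def)
    have mem: "rarr s' 3 0 p = (if p \<in> \<tau> then 1 else 0)"
      using I rep p by (simp add: I_def represents_def)
    have piv: "rarr s' 4 (p * n + p) p = Re (kern g t \<tau> p p p)"
      using I pn by (auto simp: I_def entry_def complex_eq_iff)
    have s': "nvar s' 1 = n" "nvar s' (Suc 0) = n" "nvar s' 6 = p * n" using I by (auto simp: I_def)
    define s1 where "s1 = (if good p then s' else set_nvar 7 0 s')"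
    have 1: "sem (eliminate \<sigma>) s' =
       set_nvar 6 (nvar (sem update_kernel s1) 6 + nvar (sem update_kernel s1) 1) (sem update_kernel s1)"
      by (simp add: eliminate_def s' p mem piv s1_def good_def)
    have s1: "represents s1 \<tau>" "nvar s1 5 = p" "nvar s1 1 = n" "nvar s1 6 = p * n"
      "rarr s1 3 = rarr s 3" "nvar s1 7 = (if \<forall>q<Suc p. good q then nvar s 7 else 0)"
      "\<And>i j. i < n \<Longrightarrow> j < n \<Longrightarrow> entry s1 (p * n + i) j = kern g t \<tau> p i j"
      using I rep p(2) s' by (auto simp: s1_def represents_def I_def n_def less_Suc_eq entry_def)
    have "entry (sem update_kernel s1) (nvar s1 6 + (nvar s1 1 + i)) j = kern g t \<tau> (Suc p) i j"
      if "i < n" "j < n" for i j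
      by (rule update_kernel_entries[OF s1(1,2)]) (use s1 that pn in auto)
    then have "\<forall>i<n. \<forall>j<n. entry (sem update_kernel s1) (Suc p * n + i) j = kern g t \<tau> (Suc p) i j"
      by (simp add: s1 s1(3)[simplified] algebra_simps del: kern.simps)
    then show "I (Suc p) (set_nvar 5 (Suc p) (sem (eliminate \<sigma>) s'))"
      using s1 by (simp add: I_def 1 sem_frame assigned_update_kernel entry_def del: kern.simps)
  qed
  then show ?thesis by (simp add: I_def n_def)
qed

lemma sem_check_barrier:
  assumes rep: "represents s \<tau>"
  shows "nvar (sem (check_barrier b) s) 7 =
    (if barrier_ok_at (input_gram s) (nvar s 1) b (nvar s 8 + 1) (nvar s 11 + 1) \<tau> then nvar s 7 else 0)"
proof -
  define n where "n = nvar s 1"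
  define g where "g = input_gram s"
  define t where "t = level b (nvar s 8 + 1) (nvar s 11 + 1)"
  define s1 where "s1 = set_rarr 6 0 0 t s"
  define s2 where "s2 = sem init_kernel s1"
  define s3 where "s3 = set_nvar 6 0 s2"
  define s4 where "s4 = sem (For 5 1 (eliminate (side b))) s3"
  define s5 where "s5 = set_rarr 6 0 1 0 s4"
  define s6 where "s6 = sem (For 2 1 (SetR 6 (NConst 0) (NConst 1) (RAdd trace_acc (kre (NAdd base ivar) ivar)))) s5"
  have sem: "sem (check_barrier b) s = sem (If (RLess (RDiv (RMul (RConst (side b)) (ROfNat cols)) (RConst (threshold b)))
            (RMul (RConst (side b)) trace_acc)) (SetN 7 (NConst 0)) Nop) s6"
    by (simp add: check_barrier_def s6_def s5_def s4_def s3_def s2_def s1_def t_def level_def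
        del: sem.simps(6))
  have s3: "nvar s3 1 = n" "nvar s3 6 = 0" "nvar s3 7 = nvar s 7" "represents s3 \<tau>"
    using rep by (simp_all add: s3_def s2_def s1_def sem_frame assigned_init_kernel represents_def n_def)
  have g1: "input_gram s1 = g"
    by (simp add: fun_eq_iff g_def input_gram_def input_entry_def s1_def)
  have "entry s3 i j = g i j / of_real t" if "i < n" "j < n" for i j
    using init_kernel_entries[of i s1 j] that
    by (simp add: s3_def s2_def entry_def g1) (simp add: s1_def n_def)
  from sem_eliminate_loop[OF s3(4,2), of g t "side b", folded s4_def, unfolded s3, OF this]
  have s4: "nvar s4 7 = (if \<forall>q<n. q \<in> \<tau> \<longrightarrow> 0 < of_rat (side b) * (1 - Re (kern g t \<tau> q q q)) then nvar s 7 else 0)"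
    "nvar s4 6 = n * n" "\<forall>i<n. \<forall>j<n. entry s4 (n * n + i) j = kern g t \<tau> n i j"
    by auto
  have s4n: "nvar s4 1 = n"
    unfolding s4_def by (simp add: s3(1)[simplified] sem_frame eliminate_def assigned_update_kernel del: sem.simps)
  define I where "I = (\<lambda>k (s' :: state). nvar s' 1 = n \<and> nvar s' 6 = n * n \<and> nvar s' 7 = nvar s4 7 \<and>
    rarr s' 4 = rarr s4 4 \<and> rarr s' 6 0 1 = (\<Sum>i<k. Re (kern g t \<tau> n i i)))"
  have n5: "nvar s5 1 = n" using s4n by (simp add: s5_def)
  have "I (nvar s5 1) s6"
    unfolding s6_def
  proof (rule sem_For_induct)
    show "I 0 (set_nvar 2 0 s5)" using s4 s4n by (simp add: I_def s5_def)
    fix i s' assume i: "i < nvar s5 1" "nvar s' 2 = i" and I: "I i s'"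
    have "rarr s4 4 (n * n + i) i = Re (kern g t \<tau> n i i)"
      using s4(3) i n5 by (auto simp: entry_def complex_eq_iff)
    then show "I (Suc i) (set_nvar 2 (Suc i)
        (sem (SetR 6 (NConst 0) (NConst 1) (RAdd trace_acc (kre (NAdd base ivar) ivar))) s'))"
      using I i by (simp add: I_def)
  qed simp
  then have s6: "nvar s6 1 = n" "nvar s6 7 = nvar s4 7" "rarr s6 6 0 1 = (\<Sum>i<n. Re (kern g t \<tau> n i i))"
    using n5 by (simp_all add: I_def)
  have "barrier_ok_at (input_gram s) (nvar s 1) b (nvar s 8 + 1) (nvar s 11 + 1) \<tau> =
      barrier_ok g n (of_rat (side b)) (of_rat (threshold b)) t \<tau>"
    by (simp only: barrier_ok_at_def g_def n_def t_def)
  then show ?thesis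
    unfolding sem barrier_ok_def using s6(1) by (simp add: s6(2) s6(3)[simplified] s4(1) not_less) auto
qed


definition accepted ::
  "(nat \<Rightarrow> nat \<Rightarrow> complex) \<Rightarrow> nat \<Rightarrow> barrier \<Rightarrow> barrier \<Rightarrow> nat \<Rightarrow> nat set \<Rightarrow> bool" where
  "accepted g n b b' k \<tau> \<longleftrightarrow> barrier_ok_at g n b k (card \<tau>) \<tau> \<and> barrier_ok_at g n b' k (card \<tau>) \<tau>"

text \<open>The hypothesis under which the greedy search for \<open>k\<close> columns cannot get stuck, wherever it has got
to.\<close>

definition extendable ::
  "(nat \<Rightarrow> nat \<Rightarrow> complex) \<Rightarrow> nat \<Rightarrow> barrier \<Rightarrow> barrier \<Rightarrow> nat \<Rightarrow> bool" where
  "extendable g n b b' k \<longleftrightarrow>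
     (\<forall>\<tau>. \<tau> \<subseteq> {..<n} \<longrightarrow> card \<tau> < k \<longrightarrow> card \<tau> = 0 \<or> accepted g n b b' k \<tau> \<longrightarrow>
        (\<exists>j<n. j \<notin> \<tau> \<and> accepted g n b b' k (insert j \<tau>)))"

lemma input_gram_cong:
  assumes "nvar s' 0 = nvar s 0" "rarr s' 0 = rarr s 0" "rarr s' 1 = rarr s 1"
  shows "input_gram s' = input_gram s"
  using assms by (simp add: fun_eq_iff input_gram_def input_entry_def)

lemma assigned_try_candidate:
  "assigned_vars (try_candidate b b') = {2, 3, 4, 5, 6, 7, 11}"
  "assigned_arrays (try_candidate b b') = {3, 4, 5, 6}"
  by (auto simp: try_candidate_def assigned_check_barrier)

text \<open>The invariant of the greedy search for \<open>k\<close> columns. The empty set counts as certified.\<close>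

definition partial_selection :: "barrier \<Rightarrow> barrier \<Rightarrow> (nat \<Rightarrow> nat \<Rightarrow> complex) \<Rightarrow> nat \<Rightarrow> nat \<Rightarrow> state \<Rightarrow> nat set \<Rightarrow> bool" where
  "partial_selection b b' g n k s \<tau> \<longleftrightarrow>
     nvar s 1 = n \<and> nvar s 8 + 1 = k \<and> input_gram s = g \<and> represents s \<tau> \<and>
     \<tau> \<subseteq> {..<n} \<and> nvar s 11 = card \<tau> \<and> card \<tau> \<le> k \<and> (card \<tau> = 0 \<or> accepted g n b b' k \<tau>)"

lemma sem_try_candidate:
  assumes J: "partial_selection b b' g n k s \<tau>" and x: "nvar s 10 = x" "x < n"
  shows "partial_selection b b' g n k (sem (try_candidate b b') s)
    (if card \<tau> < k \<and> x \<notin> \<tau> \<and> accepted g n b b' k (insert x \<tau>) then insert x \<tau> else \<tau>)"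
proof -
  have s: "nvar s 1 = n" "nvar s 8 + 1 = k" "input_gram s = g" "represents s \<tau>"
    "\<tau> \<subseteq> {..<n}" "nvar s 11 = card \<tau>" "card \<tau> \<le> k" "card \<tau> = 0 \<or> accepted g n b b' k \<tau>"
    using J by (auto simp: partial_selection_def)
  have fin: "finite \<tau>" using s(5) finite_subset by auto
  have mem: "rarr s 3 0 x = (if x \<in> \<tau> then 1 else 0)"
    using s(1,4) x by (simp add: represents_def)
  show ?thesis
  proof (cases "card \<tau> < k \<and> x \<notin> \<tau>")
    case False
    then have "sem (try_candidate b b') s = s"
      using s(2,6) x by (auto simp: try_candidate_def mem)
    then show ?thesis using J False by auto
  next
    case True
    define s0 where "s0 = set_nvar 7 1 (set_rarr 3 0 x 1 s)"
    define s1 where "s1 = sem (check_barrier b) s0"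
    define s2 where "s2 = sem (check_barrier b') s1"
    have sem: "sem (try_candidate b b') s =
      (if 0 < nvar s2 7 then set_nvar 11 (nvar s2 11 + 1) s2 else set_rarr 3 0 x 0 s2)"
      using True s(2,6) x by (simp add: try_candidate_def mem s0_def s1_def s2_def sem_frame assigned_check_barrier)
    have frame: "nvar s0 v = nvar s v" "nvar s1 v = nvar s v" "nvar s2 v = nvar s v" if "v \<notin> {2,3,4,5,6,7}" for v
      using that by (auto simp: s0_def s1_def s2_def sem_frame assigned_check_barrier)
    have arr: "rarr s1 r = rarr s0 r" "rarr s2 r = rarr s0 r" if "r \<notin> {4,5,6}" for r
      using that by (auto simp: s1_def s2_def sem_frame assigned_check_barrier)
    have rep0: "represents s0 (insert x \<tau>)"
      using s(4) by (auto simp: represents_def s0_def)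
    have rep1: "represents s1 (insert x \<tau>)" "represents s2 (insert x \<tau>)"
      using rep0 by (auto simp: represents_def arr frame)
    have g0: "input_gram s0 = g"
      unfolding s(3)[symmetric] by (rule input_gram_cong) (auto simp: s0_def)
    have "input_gram s1 = g" "input_gram s2 = g"
      unfolding g0[symmetric] by (rule input_gram_cong; auto simp: frame arr) (rule input_gram_cong; auto simp: frame arr)
    note g = g0 this
    have c: "card (insert x \<tau>) = card \<tau> + 1" using True fin by simp
    have "nvar s1 7 = (if barrier_ok_at g n b k (card \<tau> + 1) (insert x \<tau>) then 1 else 0)"
      unfolding s1_def using sem_check_barrier[OF rep0, of b] s(1,2,6) frame(1)
      by (simp add: g) (simp add: s0_def)
    then have "nvar s2 7 = (if accepted g n b b' k (insert x \<tau>) then 1 else 0)"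
      unfolding s2_def using sem_check_barrier[OF rep1(1), of b'] s(1,2,6) frame(2) c
      by (simp add: g accepted_def)
    then have flag_var: "0 < nvar s2 7 \<longleftrightarrow> accepted g n b b' k (insert x \<tau>)" by simp
    show ?thesis
    proof (cases "accepted g n b b' k (insert x \<tau>)")
      case acc: True
      have "input_gram (set_nvar 11 (nvar s2 11 + 1) s2) = g"
        unfolding g(3)[symmetric] by (rule input_gram_cong) auto
      moreover have "represents (set_nvar 11 (nvar s2 11 + 1) s2) (insert x \<tau>)"
        using rep1(2) by (simp add: represents_def)
      ultimately show ?thesis
        using acc True flag_var s(1,2,5,6) x(2) c frame(3)
        by (simp add: sem partial_selection_def)
    next
      case nacc: False
      have "input_gram (set_rarr 3 0 x 0 s2) = g"
        unfolding g(3)[symmetric] by (rule input_gram_cong) auto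
      moreover have "represents (set_rarr 3 0 x 0 s2) \<tau>"
        using rep1(2) True by (auto simp: represents_def)
      ultimately show ?thesis
        using nacc flag_var s(1,2,5,6,7,8) frame(3)
        by (simp add: sem partial_selection_def)
    qed
  qed
qed

lemma partial_selection_cong:
  assumes "partial_selection b b' g n k s \<tau>" "\<And>v. v \<in> {0, 1, 8, 11} \<Longrightarrow> nvar s' v = nvar s v"
    "\<And>r. r \<in> {0, 1, 3} \<Longrightarrow> rarr s' r = rarr s r"
  shows "partial_selection b b' g n k s' \<tau>"
proof -
  have "input_gram s' = input_gram s" by (rule input_gram_cong) (use assms in auto)
  moreover have "represents s' = represents s"
    using assms by (auto simp: fun_eq_iff represents_def)
  ultimately show ?thesis using assms by (simp add: partial_selection_def)
qed

text \<open>Within a pass the set may grow more than once. If it has not grown by the end, all candidates have been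
tested against the same set.\<close>

lemma sem_one_pass:
  assumes J: "partial_selection b b' g n k s \<tau>"
  shows "\<exists>\<tau>'. partial_selection b b' g n k (sem (For 10 1 (try_candidate b b')) s) \<tau>' \<and>
    (card \<tau> < card \<tau>' \<or>
     \<tau>' = \<tau> \<and> (card \<tau> < k \<longrightarrow> (\<forall>j<n. j \<notin> \<tau> \<longrightarrow> \<not> accepted g n b b' k (insert j \<tau>))))"
proof -
  have n: "nvar s 1 = n" using J by (simp add: partial_selection_def)
  define I where "I = (\<lambda>i s. \<exists>\<tau>'. partial_selection b b' g n k s \<tau>' \<and>
    (card \<tau> < card \<tau>' \<or>
     \<tau>' = \<tau> \<and> (card \<tau> < k \<longrightarrow> (\<forall>j<i. j \<notin> \<tau> \<longrightarrow> \<not> accepted g n b b' k (insert j \<tau>)))))"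
  have "I (nvar s 1) (sem (For 10 1 (try_candidate b b')) s)"
  proof (rule sem_For_induct)
    show "10 \<notin> assigned_vars (try_candidate b b')" by (simp add: assigned_try_candidate)
    have "partial_selection b b' g n k (set_nvar 10 0 s) \<tau>"
      by (rule partial_selection_cong[OF J]) auto
    then show "I 0 (set_nvar 10 0 s)" unfolding I_def by auto
    fix i s' assume i: "i < nvar s 1" "nvar s' 10 = i" and I: "I i s'"
    then obtain \<tau>' where \<tau>': "partial_selection b b' g n k s' \<tau>'"
      "card \<tau> < card \<tau>' \<or>
       \<tau>' = \<tau> \<and> (card \<tau> < k \<longrightarrow> (\<forall>j<i. j \<notin> \<tau> \<longrightarrow> \<not> accepted g n b b' k (insert j \<tau>)))"
      by (auto simp: I_def)
    define add where "add \<longleftrightarrow> card \<tau>' < k \<and> i \<notin> \<tau>' \<and> accepted g n b b' k (insert i \<tau>')"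
    have fin: "finite \<tau>'" using \<tau>'(1) finite_subset by (auto simp: partial_selection_def)
    have "partial_selection b b' g n k (sem (try_candidate b b') s') (if add then insert i \<tau>' else \<tau>')"
      unfolding add_def by (rule sem_try_candidate[OF \<tau>'(1)]) (use i n in auto)
    then have "partial_selection b b' g n k (set_nvar 10 (Suc i) (sem (try_candidate b b') s'))
        (if add then insert i \<tau>' else \<tau>')"
      by (rule partial_selection_cong) auto
    moreover have "card \<tau> < card (if add then insert i \<tau>' else \<tau>') \<or>
       (if add then insert i \<tau>' else \<tau>') = \<tau> \<and>
         (card \<tau> < k \<longrightarrow> (\<forall>j<Suc i. j \<notin> \<tau> \<longrightarrow> \<not> accepted g n b b' k (insert j \<tau>)))"
      using \<tau>'(2) fin by (auto simp: add_def less_Suc_eq)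
    ultimately show "I (Suc i) (set_nvar 10 (Suc i) (sem (try_candidate b b') s'))"
      unfolding I_def by blast
  qed
  then show ?thesis by (simp only: I_def n)
qed

lemma sem_all_passes:
  assumes J: "partial_selection b b' g n k s {}" and k: "k \<le> n"
  shows "\<exists>\<tau>. partial_selection b b' g n k (sem (For 9 1 (For 10 1 (try_candidate b b'))) s) \<tau> \<and>
    (extendable g n b b' k \<longrightarrow> card \<tau> = k)"
proof -
  have n: "nvar s 1 = n" using J by (simp add: partial_selection_def)
  define I where "I = (\<lambda>i s. \<exists>\<tau>. partial_selection b b' g n k s \<tau> \<and>
    (extendable g n b b' k \<longrightarrow> min i k \<le> card \<tau>))"
  have "I (nvar s 1) (sem (For 9 1 (For 10 1 (try_candidate b b'))) s)"
  proof (rule sem_For_induct)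
    show "9 \<notin> assigned_vars (For 10 1 (try_candidate b b'))" by (simp add: assigned_try_candidate)
    have "partial_selection b b' g n k (set_nvar 9 0 s) {}"
      by (rule partial_selection_cong[OF J]) auto
    then show "I 0 (set_nvar 9 0 s)" unfolding I_def by auto
    fix i s' assume "I i s'"
    then obtain \<tau> where \<tau>: "partial_selection b b' g n k s' \<tau>" "extendable g n b b' k \<longrightarrow> min i k \<le> card \<tau>"
      by (auto simp: I_def)
    let ?s = "sem (For 10 1 (try_candidate b b')) s'"
    obtain \<tau>' where \<tau>': "partial_selection b b' g n k ?s \<tau>'"
      "card \<tau> < card \<tau>' \<or>
       \<tau>' = \<tau> \<and> (card \<tau> < k \<longrightarrow> (\<forall>j<n. j \<notin> \<tau> \<longrightarrow> \<not> accepted g n b b' k (insert j \<tau>)))"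
      using sem_one_pass[OF \<tau>(1)] by blast
    have "min (Suc i) k \<le> card \<tau>'" if ext: "extendable g n b b' k"
      using \<tau>'(2)
    proof
      assume "card \<tau> < card \<tau>'"
      then show ?thesis using \<tau>(2) ext by simp
    next
      assume none: "\<tau>' = \<tau> \<and> (card \<tau> < k \<longrightarrow> (\<forall>j<n. j \<notin> \<tau> \<longrightarrow> \<not> accepted g n b b' k (insert j \<tau>)))"
      have "\<tau> \<subseteq> {..<n}" "card \<tau> = 0 \<or> accepted g n b b' k \<tau>"
        using \<tau>(1) by (auto simp: partial_selection_def)
      with ext none have "\<not> card \<tau> < k" unfolding extendable_def by blast
      then show ?thesis using none by simp
    qed
    moreover have "partial_selection b b' g n k (set_nvar 9 (Suc i) ?s) \<tau>'"
      by (rule partial_selection_cong[OF \<tau>'(1)]) auto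
    ultimately show "I (Suc i) (set_nvar 9 (Suc i) ?s)" unfolding I_def by blast
  qed
  then obtain \<tau> where \<tau>: "partial_selection b b' g n k (sem (For 9 1 (For 10 1 (try_candidate b b'))) s) \<tau>"
    "extendable g n b b' k \<longrightarrow> min n k \<le> card \<tau>"
    unfolding I_def n by blast
  moreover have "card \<tau> \<le> k" using \<tau>(1) by (simp add: partial_selection_def)
  ultimately show ?thesis using k by (intro exI[of _ \<tau>]) auto
qed

lemma assigned_greedy_selection:
  "assigned_vars (greedy_selection b b') = {2, 3, 4, 5, 6, 7, 9, 10, 11}"
  "assigned_arrays (greedy_selection b b') = {2, 3, 4, 5, 6}"
  by (auto simp: greedy_selection_def assigned_try_candidate)

lemma sem_greedy_selection:
  assumes n: "nvar s 1 = n" and k: "nvar s 8 + 1 = k" "k \<le> n" and g: "input_gram s = g"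
  shows "(output_set n (sem (greedy_selection b b') s) = output_set n s \<and> \<not> extendable g n b b' k) \<or>
    (card (output_set n (sem (greedy_selection b b') s)) = k \<and>
     accepted g n b b' k (output_set n (sem (greedy_selection b b') s)))"
proof -
  define s1 where "s1 = sem (For 2 1 (SetR 3 (NConst 0) ivar (RConst 0))) s"
  define s2 where "s2 = set_nvar 11 0 s1"
  define s3 where "s3 = sem (For 9 1 (For 10 1 (try_candidate b b'))) s2"
  have sem: "sem (greedy_selection b b') s = (if nvar s3 8 < nvar s3 11
      then sem (For 2 1 (SetR 2 (NConst 0) ivar (member ivar))) s3 else s3)"
    by (simp add: greedy_selection_def s1_def s2_def s3_def del: sem.simps(6))
  have frame1: "v \<noteq> 2 \<Longrightarrow> nvar s1 v = nvar s v" "r \<noteq> 3 \<Longrightarrow> rarr s1 r = rarr s r" for v r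
    unfolding s1_def by (auto simp del: sem.simps intro!: sem_frame)
  define I where "I = (\<lambda>i (s' :: state). nvar s' 1 = n \<and> (\<forall>j<i. rarr s' 3 0 j = 0))"
  have "I (nvar s 1) s1"
    unfolding s1_def by (rule sem_For_induct) (use n in \<open>auto simp: I_def less_Suc_eq\<close>)
  then have "represents s1 {}" using n by (simp add: I_def represents_def)
  moreover have "input_gram s2 = g"
    unfolding g[symmetric] by (rule input_gram_cong) (auto simp: s2_def frame1)
  ultimately have J: "partial_selection b b' g n k s2 {}"
    using n k frame1(1)[of 1] frame1(1)[of 8] by (simp add: partial_selection_def s2_def represents_def)
  obtain \<tau> where \<tau>: "partial_selection b b' g n k s3 \<tau>" "extendable g n b b' k \<longrightarrow> card \<tau> = k"
    using sem_all_passes[OF J k(2)] by (auto simp: s3_def)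
  then have s3: "nvar s3 1 = n" "nvar s3 8 + 1 = k" "represents s3 \<tau>" "\<tau> \<subseteq> {..<n}" "nvar s3 11 = card \<tau>"
    "card \<tau> \<le> k" "card \<tau> = 0 \<or> accepted g n b b' k \<tau>"
    by (auto simp: partial_selection_def)
  show ?thesis
  proof (cases "card \<tau> = k")
    case True
    define s4 where "s4 = sem (For 2 1 (SetR 2 (NConst 0) ivar (member ivar))) s3"
    define I where "I = (\<lambda>i (s' :: state). rarr s' 3 = rarr s3 3 \<and> (\<forall>j<i. rarr s' 2 0 j = rarr s3 3 0 j))"
    have "I (nvar s3 1) s4"
      unfolding s4_def by (rule sem_For_induct) (auto simp: I_def less_Suc_eq)
    then have "output_set n s4 = \<tau>"
      using s3(1,3,4) by (auto simp: I_def output_set_def represents_def split: if_splits)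
    moreover have "sem (greedy_selection b b') s = s4"
      using True s3(2,5) by (auto simp: sem s4_def simp del: sem.simps)
    ultimately show ?thesis using s3(2,7) True by simp
  next
    case False
    then have "sem (greedy_selection b b') s = s3" using s3(2,5,6) by (auto simp: sem)
    moreover have "rarr s3 2 = rarr s 2"
    proof -
      have "rarr s3 2 = rarr s2 2" unfolding s3_def
        by (rule sem_frame(2)) (simp add: assigned_try_candidate)
      then show ?thesis using frame1(2)[of 2] by (simp add: s2_def)
    qed
    ultimately have "output_set n (sem (greedy_selection b b') s) = output_set n s"
      by (simp add: output_set_def)
    then show ?thesis using False \<tau>(2) by blast
  qed
qed

text \<open>A later success overwrites an earlier one with a larger set, so the last success dominates all target
sizes that cannot fail.\<close>

lemma output_select_columns:
  fixes s :: state and b b'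
  defines "n \<equiv> nvar s 1" and "g \<equiv> input_gram s"
    and "S \<equiv> output_set (nvar s 1) (sem (select_columns b b') s)"
  assumes zero: "rarr s 2 = (\<lambda>_ _. 0)" and n: "0 < n"
  shows "S = {0} \<or> (\<exists>k\<ge>1. card S = k \<and> accepted g n b b' k S)"
    and "\<And>k. 1 \<le> k \<Longrightarrow> k \<le> n \<Longrightarrow> extendable g n b b' k \<Longrightarrow> k \<le> card S"
    and "1 \<le> card S"
proof -
  define s0 where "s0 = set_rarr 2 0 0 1 s"
  define I where "I = (\<lambda>i s'. nvar s' 1 = n \<and> input_gram s' = g \<and>
    (output_set n s' = {0} \<or>
      (\<exists>k\<ge>1. k \<le> i \<and> card (output_set n s') = k \<and> accepted g n b b' k (output_set n s'))) \<and>
    (\<forall>k. 1 \<le> k \<longrightarrow> k \<le> i \<longrightarrow> extendable g n b b' k \<longrightarrow> k \<le> card (output_set n s')))"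
  have "I (nvar s0 1) (sem (For 8 1 (greedy_selection b b')) s0)"
  proof (rule sem_For_induct)
    show "8 \<notin> assigned_vars (greedy_selection b b')" by (simp add: assigned_greedy_selection)
    have "output_set n (set_nvar 8 0 s0) = {0}"
      using zero n by (auto simp: output_set_def s0_def)
    moreover have "input_gram (set_nvar 8 0 s0) = g"
      unfolding g_def by (rule input_gram_cong) (auto simp: s0_def)
    ultimately show "I 0 (set_nvar 8 0 s0)" by (simp add: I_def n_def s0_def)
    fix i s' assume i: "i < nvar s0 1" "nvar s' 8 = i" and I: "I i s'"
    let ?s = "sem (greedy_selection b b') s'"
    have s': "nvar s' 1 = n" "input_gram s' = g" using I by (auto simp: I_def)
    have out: "output_set n (set_nvar 8 (Suc i) ?s) = output_set n ?s"
      by (simp add: output_set_def)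
    have step: "(output_set n ?s = output_set n s' \<and> \<not> extendable g n b b' (Suc i)) \<or>
      (card (output_set n ?s) = Suc i \<and> accepted g n b b' (Suc i) (output_set n ?s))"
      by (rule sem_greedy_selection) (use s' i in \<open>auto simp: n_def s0_def\<close>)
    have "input_gram (set_nvar 8 (Suc i) ?s) = g"
      unfolding s'(2)[symmetric] by (rule input_gram_cong) (auto simp: sem_frame assigned_greedy_selection)
    moreover have "nvar (set_nvar 8 (Suc i) ?s) 1 = n"
      using s'(1) by (simp add: sem_frame assigned_greedy_selection)
    moreover from step have "(output_set n ?s = {0} \<or>
      (\<exists>k\<ge>1. k \<le> Suc i \<and> card (output_set n ?s) = k \<and> accepted g n b b' k (output_set n ?s))) \<and>
      (\<forall>k. 1 \<le> k \<longrightarrow> k \<le> Suc i \<longrightarrow> extendable g n b b' k \<longrightarrow> k \<le> card (output_set n ?s))"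
      using I unfolding I_def by (auto simp: le_Suc_eq)
    ultimately show "I (Suc i) (set_nvar 8 (Suc i) ?s)" unfolding I_def out by blast
  qed
  moreover have "nvar s0 1 = n" by (simp add: s0_def n_def)
  moreover have "S = output_set n (sem (For 8 1 (greedy_selection b b')) s0)"
    by (simp add: S_def n_def select_columns_def s0_def del: sem.simps(6))
  ultimately have *: "S = {0} \<or> (\<exists>k\<ge>1. card S = k \<and> accepted g n b b' k S)"
    "\<forall>k. 1 \<le> k \<longrightarrow> k \<le> n \<longrightarrow> extendable g n b b' k \<longrightarrow> k \<le> card S"
    unfolding I_def by auto
  show "S = {0} \<or> (\<exists>k\<ge>1. card S = k \<and> accepted g n b b' k S)" by (rule *(1))
  show "1 \<le> k \<Longrightarrow> k \<le> n \<Longrightarrow> extendable g n b b' k \<Longrightarrow> k \<le> card S" for k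
    using *(2) by blast
  show "1 \<le> card S" using *(1) by auto
qed

section \<open>From matrices to systems of unit vectors\<close>

lemma l2_norm_nonneg: "0 \<le> l2_norm x"
  by (simp add: l2_norm_def L2_set_nonneg)

lemma l2_norm_power2: "(l2_norm x)\<^sup>2 = (\<Sum>i<dim_vec x. (norm (vec_index x i))\<^sup>2)"
  by (simp add: l2_norm_def L2_set_def sum_nonneg)

lemma l2_norm_zero: "l2_norm (0\<^sub>v k :: 'a::real_normed_field Matrix.vec) = 0"
  by (simp add: l2_norm_def L2_set_def)

lemma l2_norm_smult: "l2_norm (c \<cdot>\<^sub>v x) = norm c * l2_norm (x :: 'a::real_normed_field Matrix.vec)"
proof -
  have "(l2_norm (c \<cdot>\<^sub>v x))\<^sup>2 = (norm c * l2_norm x)\<^sup>2"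
    by (simp add: l2_norm_power2 power_mult_distrib norm_mult sum_distrib_left)
  then show ?thesis by (simp add: l2_norm_nonneg)
qed

lemma l2_norm_mult_le_frobenius:
  fixes A :: "'a::real_normed_field mat"
  assumes "x \<in> carrier_vec (dim_col A)"
  shows "l2_norm (A *\<^sub>v x) \<le> frobenius_norm A * l2_norm x"
proof -
  have "(l2_norm (A *\<^sub>v x))\<^sup>2 =
      (\<Sum>i<dim_row A. (norm (\<Sum>j<dim_col A. A $$ (i, j) * vec_index x j))\<^sup>2)"
    using assms by (simp add: l2_norm_power2 scalar_prod_def lessThan_atLeast0)
  also have "\<dots> \<le> (\<Sum>i<dim_row A. (L2_set (\<lambda>j. norm (A $$ (i, j))) {..<dim_col A})\<^sup>2 * (l2_norm x)\<^sup>2)"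
  proof (rule sum_mono)
    fix i
    have "norm (\<Sum>j<dim_col A. A $$ (i, j) * vec_index x j) \<le>
        (\<Sum>j<dim_col A. \<bar>norm (A $$ (i, j))\<bar> * \<bar>norm (vec_index x j)\<bar>)"
      by (rule order_trans[OF norm_sum]) (simp add: norm_mult)
    also have "\<dots> \<le> L2_set (\<lambda>j. norm (A $$ (i, j))) {..<dim_col A} * l2_norm x"
      using assms unfolding l2_norm_def by (subst carrier_vecD[OF assms]) (rule L2_set_mult_ineq)
    finally show "(norm (\<Sum>j<dim_col A. A $$ (i, j) * vec_index x j))\<^sup>2 \<le>
        (L2_set (\<lambda>j. norm (A $$ (i, j))) {..<dim_col A})\<^sup>2 * (l2_norm x)\<^sup>2"
      by (metis power_mono norm_ge_zero power_mult_distrib)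
  qed
  also have "\<dots> = (frobenius_norm A * l2_norm x)\<^sup>2"
    by (simp add: frobenius_norm_def L2_set_def sum_nonneg power_mult_distrib sum_distrib_right
        sum.cartesian_product case_prod_beta real_sqrt_pow2)
  finally show ?thesis
    by (rule power2_le_imp_le) (simp add: l2_norm_nonneg frobenius_norm_def L2_set_nonneg)
qed

lemma
  fixes A :: "'a::real_normed_field mat"
  shows spectral_norm_nonneg: "0 \<le> spectral_norm A"
    and l2_norm_mult_le: "x \<in> carrier_vec (dim_col A) \<Longrightarrow> l2_norm (A *\<^sub>v x) \<le> spectral_norm A * l2_norm x"
proof -
  define U :: "'a Matrix.vec set" where "U = {x \<in> carrier_vec (dim_col A). l2_norm x \<le> 1}"
  have bdd: "bdd_above ((\<lambda>x. l2_norm (A *\<^sub>v x)) ` U)"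
  proof (rule bdd_aboveI2)
    fix x assume "x \<in> U"
    then have "l2_norm (A *\<^sub>v x) \<le> frobenius_norm A * l2_norm x" "l2_norm x \<le> 1"
      by (auto simp: U_def l2_norm_mult_le_frobenius)
    moreover have "0 \<le> frobenius_norm A" by (simp add: frobenius_norm_def L2_set_nonneg)
    ultimately show "l2_norm (A *\<^sub>v x) \<le> frobenius_norm A"
      by (meson mult_left_le order_trans)
  qed
  have upper: "l2_norm (A *\<^sub>v x) \<le> spectral_norm A" if "x \<in> U" for x
    unfolding spectral_norm_def U_def[symmetric] using that bdd by (rule cSUP_upper)
  have "0\<^sub>v (dim_col A) \<in> U" by (simp add: U_def l2_norm_zero)
  from upper[OF this] show "0 \<le> spectral_norm A" using l2_norm_nonneg order_trans by blast
  assume x: "x \<in> carrier_vec (dim_col A)"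
  show "l2_norm (A *\<^sub>v x) \<le> spectral_norm A * l2_norm x"
  proof (cases "l2_norm x = 0")
    case True
    then show ?thesis using l2_norm_mult_le_frobenius[OF x] by simp
  next
    case False
    then have pos: "0 < l2_norm x" using l2_norm_nonneg[of x] by simp
    define c where "c = (of_real (1 / l2_norm x) :: 'a)"
    have "c \<cdot>\<^sub>v x \<in> U" using x pos by (simp add: U_def l2_norm_smult c_def norm_divide)
    from upper[OF this] have "norm c * l2_norm (A *\<^sub>v x) \<le> spectral_norm A"
      using x by (simp add: mult_mat_vec[where nr = "dim_row A" and nc = "dim_col A"] l2_norm_smult)
    moreover have "norm c = 1 / l2_norm x" using pos by (simp add: c_def norm_divide)
    ultimately show ?thesis using pos by (simp add: field_simps)
  qed
qed

lemma spectral_norm_le: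
  fixes A :: "'a::real_normed_field mat"
  assumes "\<And>x. x \<in> carrier_vec (dim_col A) \<Longrightarrow> l2_norm (A *\<^sub>v x) \<le> C * l2_norm x" "0 \<le> C"
  shows "spectral_norm A \<le> C"
  unfolding spectral_norm_def
proof (rule cSUP_least)
  show "{x \<in> carrier_vec (dim_col A). l2_norm (x :: 'a Matrix.vec) \<le> 1} \<noteq> {}"
  proof -
    have "0\<^sub>v (dim_col A) \<in> {x \<in> carrier_vec (dim_col A). l2_norm (x :: 'a Matrix.vec) \<le> 1}"
      by (simp add: l2_norm_zero)
    then show ?thesis by blast
  qed
  fix x :: "'a Matrix.vec" assume "x \<in> {x \<in> carrier_vec (dim_col A). l2_norm x \<le> 1}"
  then have x: "x \<in> carrier_vec (dim_col A)" "l2_norm x \<le> 1" by auto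
  have "C * l2_norm x \<le> C" using x(2) assms(2) by (rule mult_left_le)
  then show "l2_norm (A *\<^sub>v x) \<le> C" using assms(1)[OF x(1)] by linarith
qed

lemma condition_number_le:
  fixes A :: "'a::real_normed_field mat"
  assumes upper: "\<And>x. x \<in> carrier_vec (dim_col A) \<Longrightarrow> (l2_norm (A *\<^sub>v x))\<^sup>2 \<le> u * (l2_norm x)\<^sup>2"
    and lower: "\<And>x. x \<in> carrier_vec (dim_col A) \<Longrightarrow> l * (l2_norm x)\<^sup>2 \<le> (l2_norm (A *\<^sub>v x))\<^sup>2"
    and l: "0 < l"
  shows "condition_number A \<le> ereal (sqrt (u / l))"
proof -
  have "mat_kernel A = {0\<^sub>v (dim_col A)}"
  proof (intro equalityI subsetI)
    fix x assume "x \<in> mat_kernel A"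
    then have x: "x \<in> carrier_vec (dim_col A)" "A *\<^sub>v x = 0\<^sub>v (dim_row A)"
      by (auto simp: mat_kernel_def)
    then have "l * (l2_norm x)\<^sup>2 \<le> 0" using lower[OF x(1)] by (simp add: l2_norm_zero)
    then have "(l2_norm x)\<^sup>2 = 0" using l by (simp add: mult_le_0_iff)
    then have "\<forall>i<dim_vec x. vec_index x i = 0"
      unfolding l2_norm_power2 by (subst (asm) sum_nonneg_eq_0_iff) auto
    then show "x \<in> {0\<^sub>v (dim_col A)}" using x(1) by auto
  qed (auto simp: mat_kernel_def)
  moreover have "Sup {ereal (l2_norm (A *\<^sub>v x) / l2_norm (A *\<^sub>v y)) | x y.
             x \<in> carrier_vec (dim_col A) \<and> y \<in> carrier_vec (dim_col A) \<and>
             l2_norm x = 1 \<and> l2_norm y = 1} \<le> ereal (sqrt (u / l))"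
  proof (rule Sup_least, clarify)
    fix x y :: "'a Matrix.vec" assume x: "x \<in> carrier_vec (dim_col A)" "l2_norm x = 1"
      and y: "y \<in> carrier_vec (dim_col A)" "l2_norm y = 1"
    have "(l2_norm (A *\<^sub>v x) / l2_norm (A *\<^sub>v y))\<^sup>2 \<le> u / l"
      unfolding power_divide using upper[OF x(1)] lower[OF y(1)] x y l
      by (intro frac_le) (auto intro: order_trans[OF zero_le_power2])
    then show "ereal (l2_norm (A *\<^sub>v x) / l2_norm (A *\<^sub>v y)) \<le> ereal (sqrt (u / l))"
      by (simp add: real_le_rsqrt)
  qed
  ultimately show ?thesis by (simp add: condition_number_def)
qed

text \<open>A matrix and its adjoint have the same norm. There is no conjugation on an arbitrary
normed field, so the hypothesis asks for the vector \<open>c\<close> that pairs with $A x$ to $\|x\|^2$: for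
$x = A^* z$ this is the conjugate of $z$ in the complex case and $z$ itself in the real case.\<close>

lemma adjoint_bound:
  fixes A :: "'a::real_normed_field mat" and x c :: "nat \<Rightarrow> 'a"
  assumes dual: "of_real (\<Sum>j<dim_col A. (norm (x j))\<^sup>2) =
      (\<Sum>i<dim_row A. c i * (\<Sum>j<dim_col A. A $$ (i, j) * x j))"
  shows "(\<Sum>j<dim_col A. (norm (x j))\<^sup>2) \<le> (spectral_norm A)\<^sup>2 * (\<Sum>i<dim_row A. (norm (c i))\<^sup>2)"
proof -
  define v where "v = vec (dim_col A) x"
  define X where "X = (\<Sum>j<dim_col A. (norm (x j))\<^sup>2)"
  have v: "v \<in> carrier_vec (dim_col A)" by (simp add: v_def)
  have X: "X = (l2_norm v)\<^sup>2" by (simp add: X_def l2_norm_power2 v_def)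
  have Av: "vec_index (A *\<^sub>v v) i = (\<Sum>j<dim_col A. A $$ (i, j) * x j)" if "i < dim_row A" for i
    using that by (simp add: v_def scalar_prod_def lessThan_atLeast0)
  have "0 \<le> X" by (simp add: X_def sum_nonneg)
  then have "X = norm (of_real X :: 'a)" by simp
  also have "\<dots> \<le> (\<Sum>i<dim_row A. \<bar>norm (c i)\<bar> * \<bar>norm (vec_index (A *\<^sub>v v) i)\<bar>)"
    unfolding X_def dual by (rule order_trans[OF norm_sum]) (simp add: norm_mult Av del: index_mult_mat_vec)
  also have "\<dots> \<le> L2_set (\<lambda>i. norm (c i)) {..<dim_row A} * l2_norm (A *\<^sub>v v)"
    unfolding l2_norm_def by (simp only: dim_mult_mat_vec) (rule L2_set_mult_ineq)
  also have "\<dots> \<le> L2_set (\<lambda>i. norm (c i)) {..<dim_row A} * (spectral_norm A * l2_norm v)"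
    by (intro mult_left_mono l2_norm_mult_le v L2_set_nonneg)
  finally have *: "(l2_norm v)\<^sup>2 \<le> (spectral_norm A * L2_set (\<lambda>i. norm (c i)) {..<dim_row A}) * l2_norm v"
    by (simp only: X mult_ac)
  have "l2_norm v \<le> spectral_norm A * L2_set (\<lambda>i. norm (c i)) {..<dim_row A}"
  proof (cases "l2_norm v = 0")
    case True
    then show ?thesis by (simp add: spectral_norm_nonneg L2_set_nonneg)
  next
    case False
    then have "0 < l2_norm v" using l2_norm_nonneg[of v] by simp
    with * show ?thesis unfolding power2_eq_square by (rule mult_right_le_imp_le)
  qed
  then have "(l2_norm v)\<^sup>2 \<le> (spectral_norm A * L2_set (\<lambda>i. norm (c i)) {..<dim_row A})\<^sup>2"
    by (intro power_mono l2_norm_nonneg)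
  moreover have "(L2_set (\<lambda>i. norm (c i)) {..<dim_row A})\<^sup>2 = (\<Sum>i<dim_row A. (norm (c i))\<^sup>2)"
    by (simp add: L2_set_def sum_nonneg)
  ultimately show ?thesis by (simp only: X[symmetric] X_def[symmetric] power_mult_distrib)
qed

text \<open>The two scalar fields are treated alike. The last condition says that $\|A^* z\| \le \|A\| \|z\|$ also holds
for complex vectors \<open>z\<close> when the norm of \<open>A\<close> is taken over the given field.\<close>

locale scalar_embedding =
  fixes emb :: "'a::real_normed_field \<Rightarrow> complex"
  assumes emb_add: "emb (x + y) = emb x + emb y"
    and emb_mult: "emb (x * y) = emb x * emb y"
    and norm_emb: "norm (emb x) = norm x"
    and analysis_bound: "(\<Sum>j<dim_col A. (norm (\<Sum>i<dim_row A. cnj (emb (A $$ (i, j))) * z i))\<^sup>2)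
      \<le> (spectral_norm A)\<^sup>2 * (\<Sum>i<dim_row A. (norm (z i))\<^sup>2)"

interpretation complex_scalars: scalar_embedding "id :: complex \<Rightarrow> complex"
proof
  fix A :: "complex mat" and z :: "nat \<Rightarrow> complex"
  define x where "x = (\<lambda>j. \<Sum>i<dim_row A. cnj (A $$ (i, j)) * z i)"
  have "of_real (\<Sum>j<dim_col A. (norm (x j))\<^sup>2) =
      (\<Sum>i<dim_row A. cnj (z i) * (\<Sum>j<dim_col A. A $$ (i, j) * x j))"
  proof -
    have "of_real (\<Sum>j<dim_col A. (norm (x j))\<^sup>2) = (\<Sum>j<dim_col A. cnj (x j) * x j)"
      by (simp add: complex_norm_square mult.commute del: of_real_power)
    also have "\<dots> = (\<Sum>j<dim_col A. \<Sum>i<dim_row A. cnj (z i) * (A $$ (i, j) * x j))"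
      by (subst (1) x_def) (simp add: sum_distrib_left sum_distrib_right mult_ac)
    also have "\<dots> = (\<Sum>i<dim_row A. cnj (z i) * (\<Sum>j<dim_col A. A $$ (i, j) * x j))"
      by (subst sum.swap) (simp add: sum_distrib_left)
    finally show ?thesis .
  qed
  from adjoint_bound[OF this]
  show "(\<Sum>j<dim_col A. (norm (\<Sum>i<dim_row A. cnj (id (A $$ (i, j))) * z i))\<^sup>2)
      \<le> (spectral_norm A)\<^sup>2 * (\<Sum>i<dim_row A. (norm (z i))\<^sup>2)"
    by (simp add: x_def)
qed auto

text \<open>For a real matrix the real and imaginary parts of \<open>z\<close> are mapped separately.\<close>

interpretation real_scalars: scalar_embedding complex_of_real
proof
  fix A :: "real mat" and z :: "nat \<Rightarrow> complex"
  have bound: "(\<Sum>j<dim_col A. (\<Sum>i<dim_row A. A $$ (i, j) * w i)\<^sup>2)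
      \<le> (spectral_norm A)\<^sup>2 * (\<Sum>i<dim_row A. (w i)\<^sup>2)" for w :: "nat \<Rightarrow> real"
  proof -
    define x where "x = (\<lambda>j. \<Sum>i<dim_row A. A $$ (i, j) * w i)"
    have "of_real (\<Sum>j<dim_col A. (norm (x j))\<^sup>2) =
        (\<Sum>i<dim_row A. w i * (\<Sum>j<dim_col A. A $$ (i, j) * x j))"
    proof -
      have "of_real (\<Sum>j<dim_col A. (norm (x j))\<^sup>2) = (\<Sum>j<dim_col A. x j * x j)"
        by (simp add: power2_eq_square)
      also have "\<dots> = (\<Sum>j<dim_col A. \<Sum>i<dim_row A. w i * (A $$ (i, j) * x j))"
        by (subst (1) x_def) (simp add: sum_distrib_left sum_distrib_right mult_ac)
      also have "\<dots> = (\<Sum>i<dim_row A. w i * (\<Sum>j<dim_col A. A $$ (i, j) * x j))"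
        by (subst sum.swap) (simp add: sum_distrib_left)
      finally show ?thesis .
    qed
    from adjoint_bound[OF this] show ?thesis by (simp add: x_def)
  qed
  show "(\<Sum>j<dim_col A. (norm (\<Sum>i<dim_row A. cnj (complex_of_real (A $$ (i, j))) * z i))\<^sup>2)
      \<le> (spectral_norm A)\<^sup>2 * (\<Sum>i<dim_row A. (norm (z i))\<^sup>2)"
    using add_mono[OF bound[of "\<lambda>i. Re (z i)"] bound[of "\<lambda>i. Im (z i)"]]
    by (simp add: cmod_power2 sum.distrib distrib_left)
qed auto

text \<open>The columns of the submatrix are numbered by \<open>pick \<tau>\<close>, whose inverse counts the smaller elements of
\<open>\<tau>\<close>. Reindexing along it replaces the coordinates of \<open>x\<close> by coefficients indexed by \<open>\<tau>\<close>.\<close>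

lemma column_submatrix_action:
  fixes A :: "'a::real_normed_field mat"
  assumes emb: "scalar_embedding emb" and \<tau>: "\<tau> \<subseteq> {..<dim_col A}"
    and x: "x \<in> carrier_vec (dim_col (column_submatrix A \<tau>))"
  obtains c where "(l2_norm x)\<^sup>2 = (\<Sum>p\<in>\<tau>. (norm (c p))\<^sup>2)"
    "(l2_norm (column_submatrix A \<tau> *\<^sub>v x))\<^sup>2 =
      (\<Sum>i<dim_row A. (norm (\<Sum>p\<in>\<tau>. c p * emb (A $$ (i, p))))\<^sup>2)"
proof -
  interpret scalar_embedding emb by (rule emb)
  define \<rho> where "\<rho> = (\<lambda>p. card {b \<in> \<tau>. b < p})"
  have fin: "finite \<tau>" using \<tau> finite_subset by auto
  have pick: "pick \<tau> (\<rho> p) = p" if "p \<in> \<tau>" for p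
    unfolding \<rho>_def using that by (rule pick_card_in_set)
  have bij: "bij_betw \<rho> \<tau> {..<card \<tau>}"
  proof -
    have inj: "inj_on \<rho> \<tau>" by (metis inj_onI pick)
    have "\<rho> ` \<tau> \<subseteq> {..<card \<tau>}"
      unfolding \<rho>_def using fin by (auto intro!: psubset_card_mono)
    then have "\<rho> ` \<tau> = {..<card \<tau>}"
      by (rule card_subset_eq[rotated]) (simp_all add: card_image[OF inj])
    with inj show ?thesis by (simp add: bij_betw_def)
  qed
  have cols: "{j. j < dim_col A \<and> j \<in> \<tau>} = \<tau>" using \<tau> by auto
  have dim: "dim_row (column_submatrix A \<tau>) = dim_row A" "dim_col (column_submatrix A \<tau>) = card \<tau>"
    by (simp_all add: column_submatrix_def dim_submatrix cols)
  have ent: "column_submatrix A \<tau> $$ (i, q) = A $$ (i, pick \<tau> q)" if "i < dim_row A" "q < card \<tau>" for i q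
    using that by (simp add: column_submatrix_def submatrix_index cols pick_UNIV)
  have dx: "dim_vec x = card \<tau>" using x dim by simp
  have emb_zero: "emb 0 = 0" using emb_add[of 0 0] by simp
  have emb_sum: "emb (sum f I) = (\<Sum>i\<in>I. emb (f i))" for f and I :: "nat set"
    by (induction I rule: infinite_finite_induct) (auto simp: emb_zero emb_add)
  define c where "c = (\<lambda>p. emb (vec_index x (\<rho> p)))"
  show thesis
  proof (rule that[of c])
    show "(l2_norm x)\<^sup>2 = (\<Sum>p\<in>\<tau>. (norm (c p))\<^sup>2)"
      unfolding l2_norm_power2 dx c_def norm_emb
      by (rule sum.reindex_bij_betw[OF bij, symmetric])
    have "norm (vec_index (column_submatrix A \<tau> *\<^sub>v x) i) = norm (\<Sum>p\<in>\<tau>. c p * emb (A $$ (i, p)))"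
      if i: "i < dim_row A" for i
    proof -
      have "vec_index (column_submatrix A \<tau> *\<^sub>v x) i =
          (\<Sum>q<card \<tau>. A $$ (i, pick \<tau> q) * vec_index x q)"
        using i by (simp add: scalar_prod_def dim dx ent lessThan_atLeast0)
      also have "\<dots> = (\<Sum>p\<in>\<tau>. A $$ (i, pick \<tau> (\<rho> p)) * vec_index x (\<rho> p))"
        by (rule sum.reindex_bij_betw[OF bij, symmetric])
      also have "\<dots> = (\<Sum>p\<in>\<tau>. A $$ (i, p) * vec_index x (\<rho> p))"
        by (intro sum.cong) (auto simp: pick)
      also have "emb \<dots> = (\<Sum>p\<in>\<tau>. c p * emb (A $$ (i, p)))"
        by (simp add: emb_sum emb_mult c_def mult.commute)
      finally show ?thesis by (metis norm_emb)
    qed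
    then show "(l2_norm (column_submatrix A \<tau> *\<^sub>v x))\<^sup>2 =
        (\<Sum>i<dim_row A. (norm (\<Sum>p\<in>\<tau>. c p * emb (A $$ (i, p))))\<^sup>2)"
      by (simp add: l2_norm_power2 dim)
  qed
qed

lemma stable_rank_standardized:
  fixes A :: "'a::real_normed_field mat"
  assumes "standardized A"
  shows "stable_rank A = real (dim_col A) / (spectral_norm A)\<^sup>2"
proof -
  have "(\<Sum>i<dim_row A. (norm (A $$ (i, j)))\<^sup>2) = 1" if "j < dim_col A" for j
  proof -
    have "(l2_norm (col A j))\<^sup>2 = 1" using assms that by (simp add: standardized_def)
    then show ?thesis using that by (simp add: l2_norm_power2)
  qed
  then have "(\<Sum>j<dim_col A. \<Sum>i<dim_row A. (norm (A $$ (i, j)))\<^sup>2) = real (dim_col A)" by simp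
  then have "(frobenius_norm A)\<^sup>2 = real (dim_col A)"
    by (subst (asm) sum.swap)
      (simp add: frobenius_norm_def L2_set_def sum_nonneg sum.cartesian_product case_prod_beta)
  then show ?thesis by (simp add: stable_rank_def)
qed

definition scale_fun :: "complex \<Rightarrow> (nat \<Rightarrow> complex) \<Rightarrow> nat \<Rightarrow> complex" where
  "scale_fun c f = (\<lambda>i. c * f i)"

definition dot :: "nat \<Rightarrow> (nat \<Rightarrow> complex) \<Rightarrow> (nat \<Rightarrow> complex) \<Rightarrow> complex" where
  "dot m f g = (\<Sum>i<m. cnj (f i) * g i)"

text \<open>The columns as functions, read off the initial state, so that the Gram matrix computed by the program is
that of these vectors on all indices, including those beyond the number of columns.\<close>

definition input_column :: "complex mat \<Rightarrow> nat \<Rightarrow> nat \<Rightarrow> complex" where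
  "input_column A j = (\<lambda>i. input_entry (input_state A) i j)"

lemma input_column_eq: "i < dim_row A \<Longrightarrow> j < dim_col A \<Longrightarrow> input_column A j i = A $$ (i, j)"
  by (simp add: input_column_def input_entry_def input_state_def complex_eq_iff)

lemma input_gram_eq: "input_gram (input_state A) = (\<lambda>i j. dot (dim_row A) (input_column A i) (input_column A j))"
  by (simp add: fun_eq_iff input_gram_def dot_def input_column_def) (simp add: input_state_def)

lemma (in scalar_embedding) unit_vectors_input:
  assumes "standardized A"
  shows "unit_vectors scale_fun (dot (dim_row A)) (input_column (map_mat emb A)) (dim_col A)"
proof (intro unit_vectors.intro unit_vectors_axioms.intro)
  show "vector_space scale_fun"
    by (rule vector_space.intro) (simp_all add: scale_fun_def fun_eq_iff algebra_simps)
  fix x y z :: "nat \<Rightarrow> complex" and c :: complex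
  show "dot (dim_row A) x (y + z) = dot (dim_row A) x y + dot (dim_row A) x z"
    by (simp add: dot_def algebra_simps sum.distrib)
  show "dot (dim_row A) x (scale_fun c y) = c * dot (dim_row A) x y"
    by (simp add: dot_def scale_fun_def mult_ac sum_distrib_left)
  show "dot (dim_row A) y x = cnj (dot (dim_row A) x y)"
    by (simp add: dot_def mult.commute)
  show "0 \<le> Re (dot (dim_row A) x x)" by (simp add: dot_def sum_nonneg)
next
  fix j assume j: "j < dim_col A"
  have "(l2_norm (col A j))\<^sup>2 = 1" using assms j by (simp add: standardized_def)
  then have "(\<Sum>i<dim_row A. (norm (A $$ (i, j)))\<^sup>2) = 1" using j by (simp add: l2_norm_power2)
  then have "(\<Sum>i<dim_row A. (norm (input_column (map_mat emb A) j i))\<^sup>2) = 1"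
    using j by (simp add: input_column_eq norm_emb)
  moreover have "cnj w * w = of_real ((norm w)\<^sup>2)" for w
    by (simp only: complex_norm_square mult.commute)
  then have "dot (dim_row A) w w = of_real (\<Sum>i<dim_row A. (norm (w i))\<^sup>2)" for w
    by (simp only: dot_def of_real_sum)
  ultimately show "dot (dim_row A) (input_column (map_mat emb A) j) (input_column (map_mat emb A) j) = 1"
    by (simp only: of_real_1)
qed


lemma frame_bound_input:
  assumes "scalar_embedding emb"
  shows "(\<Sum>j<dim_col A. (norm (dot (dim_row A) (input_column (map_mat emb A) j) z))\<^sup>2)
    \<le> (spectral_norm A)\<^sup>2 * Re (dot (dim_row A) z z)"
proof -
  interpret scalar_embedding emb by (rule assms)
  have "(\<Sum>j<dim_col A. (norm (dot (dim_row A) (input_column (map_mat emb A) j) z))\<^sup>2) =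
      (\<Sum>j<dim_col A. (norm (\<Sum>i<dim_row A. cnj (emb (A $$ (i, j))) * z i))\<^sup>2)"
    unfolding dot_def
    by (intro sum.cong refl arg_cong[where f = "\<lambda>w. (norm w)\<^sup>2"]) (auto simp: input_column_eq)
  moreover have "Re (dot (dim_row A) z z) = (\<Sum>i<dim_row A. (norm (z i))\<^sup>2)"
    by (simp add: dot_def cmod_power2 flip: power2_eq_square)
  ultimately show ?thesis using analysis_bound[of A z] by simp
qed

text \<open>The squares of the singular values of $A_\tau$ lie between \<open>l\<close> and \<open>u\<close>.\<close>

definition frame_bounds :: "'a::real_normed_field mat \<Rightarrow> nat set \<Rightarrow> real \<Rightarrow> real \<Rightarrow> bool" where
  "frame_bounds A \<tau> l u \<longleftrightarrow>
     (\<forall>x \<in> carrier_vec (dim_col (column_submatrix A \<tau>)).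
        l * (l2_norm x)\<^sup>2 \<le> (l2_norm (column_submatrix A \<tau> *\<^sub>v x))\<^sup>2 \<and>
        (l2_norm (column_submatrix A \<tau> *\<^sub>v x))\<^sup>2 \<le> u * (l2_norm x)\<^sup>2)"

lemma frame_bounds_mono:
  fixes A :: "'a::real_normed_field mat"
  assumes "frame_bounds A \<tau> l u" "l' \<le> l" "u \<le> u'"
  shows "frame_bounds A \<tau> l' u'"
  unfolding frame_bounds_def
proof
  fix x :: "'a Matrix.vec" assume "x \<in> carrier_vec (dim_col (column_submatrix A \<tau>))"
  then have "l * (l2_norm x)\<^sup>2 \<le> (l2_norm (column_submatrix A \<tau> *\<^sub>v x))\<^sup>2"
    "(l2_norm (column_submatrix A \<tau> *\<^sub>v x))\<^sup>2 \<le> u * (l2_norm x)\<^sup>2"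
    using assms(1) by (auto simp: frame_bounds_def)
  moreover have "l' * (l2_norm x)\<^sup>2 \<le> l * (l2_norm x)\<^sup>2" "u * (l2_norm x)\<^sup>2 \<le> u' * (l2_norm x)\<^sup>2"
    using assms(2,3) by (auto intro: mult_right_mono)
  ultimately show "l' * (l2_norm x)\<^sup>2 \<le> (l2_norm (column_submatrix A \<tau> *\<^sub>v x))\<^sup>2 \<and>
        (l2_norm (column_submatrix A \<tau> *\<^sub>v x))\<^sup>2 \<le> u' * (l2_norm x)\<^sup>2" by linarith
qed

lemma spectral_norm_if_frame_bounds:
  fixes A :: "'a::real_normed_field mat"
  assumes "frame_bounds A \<tau> l (C\<^sup>2)" "0 \<le> C"
  shows "spectral_norm (column_submatrix A \<tau>) \<le> C"
proof (rule spectral_norm_le[OF _ assms(2)])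
  fix x :: "'a Matrix.vec" assume "x \<in> carrier_vec (dim_col (column_submatrix A \<tau>))"
  then have "(l2_norm (column_submatrix A \<tau> *\<^sub>v x))\<^sup>2 \<le> (C * l2_norm x)\<^sup>2"
    using assms(1) by (auto simp: frame_bounds_def power_mult_distrib)
  then show "l2_norm (column_submatrix A \<tau> *\<^sub>v x) \<le> C * l2_norm x"
    by (rule power2_le_imp_le) (simp add: assms(2) l2_norm_nonneg)
qed

lemma condition_number_if_frame_bounds:
  assumes "frame_bounds A \<tau> l u" "0 < l"
  shows "condition_number (column_submatrix A \<tau>) \<le> ereal (sqrt (u / l))"
  by (rule condition_number_le) (use assms in \<open>auto simp: frame_bounds_def\<close>)

context
  fixes emb :: "'a::real_normed_field \<Rightarrow> complex" and A :: "'a mat"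
  assumes emb: "scalar_embedding emb" and standardized: "standardized A" and cols: "0 < dim_col A"
begin

interpretation unit_vectors scale_fun "dot (dim_row A)" "input_column (map_mat emb A)" "dim_col A"
  by (rule scalar_embedding.unit_vectors_input[OF emb standardized])

lemma input_gram_embedded: "input_gram (input_state (map_mat emb A)) = gram"
  using input_gram_eq[of "map_mat emb A"] by simp

lemma bessel:
  "(\<Sum>i<dim_col A. (norm (dot (dim_row A) (input_column (map_mat emb A) i) x))\<^sup>2)
    \<le> (spectral_norm A)\<^sup>2 * nsq x"
  unfolding nsq_def by (rule frame_bound_input[OF emb])

lemma spectral_norm_ge_1: "1 \<le> (spectral_norm A)\<^sup>2"
  using frame_bound_ge_1[OF bessel cols] .

lemma stable_rank_bounds: "stable_rank A \<le> real (dim_col A)"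
proof -
  have "real (dim_col A) / (spectral_norm A)\<^sup>2 \<le> real (dim_col A) / 1"
    by (rule divide_left_mono) (use spectral_norm_ge_1 in auto)
  then show ?thesis by (simp add: stable_rank_standardized[OF standardized])
qed

lemma frame_bounds_if_synth_bounds:
  assumes \<tau>: "\<tau> \<subseteq> {..<dim_col A}"
    and bounds: "\<And>c. l * (\<Sum>p\<in>\<tau>. (norm (c p))\<^sup>2) \<le> nsq (synth \<tau> c) \<and>
      nsq (synth \<tau> c) \<le> u * (\<Sum>p\<in>\<tau>. (norm (c p))\<^sup>2)"
  shows "frame_bounds A \<tau> l u"
  unfolding frame_bounds_def
proof
  fix x :: "'a Matrix.vec" assume x: "x \<in> carrier_vec (dim_col (column_submatrix A \<tau>))"
  obtain c where c: "(l2_norm x)\<^sup>2 = (\<Sum>p\<in>\<tau>. (norm (c p))\<^sup>2)"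
    "(l2_norm (column_submatrix A \<tau> *\<^sub>v x))\<^sup>2 =
      (\<Sum>i<dim_row A. (norm (\<Sum>p\<in>\<tau>. c p * emb (A $$ (i, p))))\<^sup>2)"
    by (rule column_submatrix_action[OF emb \<tau> x])
  have app: "(\<Sum>p\<in>I. f p) i = (\<Sum>p\<in>I. f p i)" for f :: "nat \<Rightarrow> nat \<Rightarrow> complex" and I i
    by (induction I rule: infinite_finite_induct) auto
  have "nsq (synth \<tau> c) = (\<Sum>i<dim_row A. (norm (synth \<tau> c i))\<^sup>2)"
    by (simp add: nsq_def dot_def cmod_power2 flip: power2_eq_square)
  also have "\<dots> = (\<Sum>i<dim_row A. (norm (\<Sum>p\<in>\<tau>. c p * emb (A $$ (i, p))))\<^sup>2)"
    unfolding synth_def app scale_fun_def using \<tau>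
    by (intro sum.cong refl arg_cong[where f = "\<lambda>w. (norm w)\<^sup>2"]) (auto simp: input_column_eq)
  finally have "(l2_norm (column_submatrix A \<tau> *\<^sub>v x))\<^sup>2 = nsq (synth \<tau> c)" using c by simp
  then show "l * (l2_norm x)\<^sup>2 \<le> (l2_norm (column_submatrix A \<tau> *\<^sub>v x))\<^sup>2 \<and>
      (l2_norm (column_submatrix A \<tau> *\<^sub>v x))\<^sup>2 \<le> u * (l2_norm x)\<^sup>2"
    using bounds[of c] c by simp
qed

lemma frame_bounds_singleton: "frame_bounds A {0} 1 1"
proof (rule frame_bounds_if_synth_bounds)
  fix c
  have "nsq (synth {0} c) = (norm (c 0))\<^sup>2"
    using unit[OF cols] by (simp add: synth_def nsq_scale) (simp add: nsq_def)
  then show "1 * (\<Sum>p\<in>{0}. (norm (c p))\<^sup>2) \<le> nsq (synth {0} c) \<and>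
      nsq (synth {0} c) \<le> 1 * (\<Sum>p\<in>{0}. (norm (c p))\<^sup>2)" by simp
qed (use cols in simp)

abbreviation selection :: "barrier \<Rightarrow> barrier \<Rightarrow> nat set" where
  "selection b b' \<equiv> output_set (dim_col A) (sem (select_columns b b') (input_state (map_mat emb A)))"

lemma selection:
  shows "selection b b' = {0} \<or> (\<exists>k\<ge>1. card (selection b b') = k \<and> accepted gram (dim_col A) b b' k (selection b b'))"
    and "1 \<le> k \<Longrightarrow> k \<le> dim_col A \<Longrightarrow> extendable gram (dim_col A) b b' k \<Longrightarrow> k \<le> card (selection b b')"
    and "1 \<le> card (selection b b')" "selection b b' \<subseteq> {..<dim_col A}"
proof -
  let ?s = "input_state (map_mat emb A)"
  have n: "nvar ?s 1 = dim_col A" by (simp add: input_state_def)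
  have z: "rarr ?s 2 = (\<lambda>_ _. 0)" by (simp add: input_state_def)
  note O = output_select_columns[OF z, unfolded n input_gram_embedded, OF cols, where b = b and b' = b']
  show "selection b b' = {0} \<or> (\<exists>k\<ge>1. card (selection b b') = k \<and> accepted gram (dim_col A) b b' k (selection b b'))"
    by (rule O(1))
  show "1 \<le> k \<Longrightarrow> k \<le> dim_col A \<Longrightarrow> extendable gram (dim_col A) b b' k \<Longrightarrow> k \<le> card (selection b b')"
    by (rule O(2))
  show "1 \<le> card (selection b b')" by (rule O(3))
  show "selection b b' \<subseteq> {..<dim_col A}" by (auto simp: output_set_def)
qed

text \<open>The target size is the stable rank rounded up. It is at most twice the stable rank when that is above $1$;
otherwise one column is enough.\<close>

lemma bounded_norm_output:
  defines "\<tau> \<equiv> selection bounded_norm_barrier bounded_norm_barrier"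
  shows "stable_rank A \<le> real (card \<tau>)" "spectral_norm (column_submatrix A \<tau>) \<le> 4"
proof -
  let ?b = bounded_norm_barrier
  show "stable_rank A \<le> real (card \<tau>)"
  proof (cases "stable_rank A \<le> 1")
    case True
    then show ?thesis using selection(3)[of ?b ?b] by (simp add: \<tau>_def)
  next
    case False
    define k where "k = nat \<lceil>stable_rank A\<rceil>"
    have k: "stable_rank A \<le> real k" "real k < stable_rank A + 1"
      using False by (auto simp: k_def) linarith+
    have kn: "k \<le> dim_col A" using stable_rank_bounds by (simp add: k_def ceiling_le_iff nat_le_iff)
    have "extendable gram (dim_col A) ?b ?b k"
      unfolding extendable_def
    proof (intro allI impI)
      fix \<sigma> assume \<sigma>: "\<sigma> \<subseteq> {..<dim_col A}" "card \<sigma> < k"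
        "card \<sigma> = 0 \<or> accepted gram (dim_col A) ?b ?b k \<sigma>"
      have "finite \<sigma>" using \<sigma>(1) finite_subset by auto
      moreover have "\<exists>j<dim_col A. j \<notin> \<sigma> \<and> barrier_ok_at gram (dim_col A) ?b k (card \<sigma> + 1) (insert j \<sigma>)"
        by (rule next_column_bounded_norm[OF bessel cols kn _ _ \<sigma>(1,2)])
          (use k False \<sigma>(3) stable_rank_standardized[OF standardized] in \<open>auto simp: accepted_def\<close>)
      ultimately show "\<exists>j<dim_col A. j \<notin> \<sigma> \<and> accepted gram (dim_col A) ?b ?b k (insert j \<sigma>)"
        by (auto simp: accepted_def)
    qed
    then have "k \<le> card \<tau>" unfolding \<tau>_def using False k(1) by (intro selection(2) kn) auto
    then show ?thesis using k(1) by linarith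
  qed
  have "frame_bounds A \<tau> 0 16"
  proof (cases "\<tau> = {0}")
    case True
    show ?thesis unfolding True by (rule frame_bounds_mono[OF frame_bounds_singleton]) auto
  next
    case False
    then obtain k where k: "k \<ge> 1" "card \<tau> = k" "accepted gram (dim_col A) ?b ?b k \<tau>"
      using selection(1)[of ?b ?b] by (auto simp: \<tau>_def)
    have sub: "\<tau> \<subseteq> {..<dim_col A}" unfolding \<tau>_def by (rule selection(4))
    have "barrier_ok gram (dim_col A) 1 6 16 \<tau>"
      using k by (simp add: accepted_def barrier_ok_at_def bounded_norm_barrier_def level_def)
    from synth_bound_if_barrier_ok[OF this _ sub]
    show ?thesis by (intro frame_bounds_if_synth_bounds[OF sub]) (simp add: nsq_nonneg)
  qed
  then show "spectral_norm (column_submatrix A \<tau>) \<le> 4"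
    by (intro spectral_norm_if_frame_bounds[where l = 0]) auto
qed

text \<open>The target size is one thousandth of the stable rank, rounded up; unless one column is enough, this is at
most a five-hundredth of the stable rank, as the averaging argument requires.\<close>

lemma well_conditioned_output:
  defines "\<tau> \<equiv> selection upper_barrier lower_barrier"
  shows "1 / 1000 * stable_rank A \<le> real (card \<tau>)"
    "condition_number (column_submatrix A \<tau>) \<le> ereal (sqrt 3)"
proof -
  let ?u = upper_barrier and ?l = lower_barrier
  show "1 / 1000 * stable_rank A \<le> real (card \<tau>)"
  proof (cases "1 / 1000 * stable_rank A \<le> 1")
    case True
    then show ?thesis using selection(3)[of ?u ?l] by (simp add: \<tau>_def)
  next
    case False
    define k where "k = nat \<lceil>1 / 1000 * stable_rank A\<rceil>"
    have k: "1 / 1000 * stable_rank A \<le> real k" "real k < 1 / 1000 * stable_rank A + 1"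
      using False by (auto simp: k_def) linarith+
    have kn: "k \<le> dim_col A" using stable_rank_bounds k False by linarith
    have "extendable gram (dim_col A) ?u ?l k"
      unfolding extendable_def
    proof (intro allI impI)
      fix \<sigma> assume \<sigma>: "\<sigma> \<subseteq> {..<dim_col A}" "card \<sigma> < k"
        "card \<sigma> = 0 \<or> accepted gram (dim_col A) ?u ?l k \<sigma>"
      have "finite \<sigma>" using \<sigma>(1) finite_subset by auto
      moreover have "\<exists>j<dim_col A. j \<notin> \<sigma> \<and> barrier_ok_at gram (dim_col A) ?u k (card \<sigma> + 1) (insert j \<sigma>)
          \<and> barrier_ok_at gram (dim_col A) ?l k (card \<sigma> + 1) (insert j \<sigma>)"
        by (rule next_column_well_conditioned[OF bessel cols _ \<sigma>(1,2)])
          (use k False \<sigma>(3) stable_rank_standardized[OF standardized] in \<open>auto simp: accepted_def\<close>)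
      ultimately show "\<exists>j<dim_col A. j \<notin> \<sigma> \<and> accepted gram (dim_col A) ?u ?l k (insert j \<sigma>)"
        by (auto simp: accepted_def)
    qed
    then have "k \<le> card \<tau>" unfolding \<tau>_def using False k(1) by (intro selection(2) kn) auto
    then show ?thesis using k(1) by linarith
  qed
  have "frame_bounds A \<tau> (12 / 25) (36 / 25)"
  proof (cases "\<tau> = {0}")
    case True
    show ?thesis unfolding True by (rule frame_bounds_mono[OF frame_bounds_singleton]) auto
  next
    case False
    then obtain k where k: "k \<ge> 1" "card \<tau> = k" "accepted gram (dim_col A) ?u ?l k \<tau>"
      using selection(1)[of ?u ?l] by (auto simp: \<tau>_def)
    have sub: "\<tau> \<subseteq> {..<dim_col A}" unfolding \<tau>_def by (rule selection(4))
    have "barrier_ok gram (dim_col A) 1 (7 / 5) (36 / 25) \<tau>" "barrier_ok gram (dim_col A) (-1) (1 / 2) (12 / 25) \<tau>"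
      using k by (simp_all add: accepted_def barrier_ok_at_def upper_barrier_def lower_barrier_def level_def
          of_rat_divide of_rat_minus)
    note this[THEN synth_bound_if_barrier_ok, OF _ sub]
    then show ?thesis by (intro frame_bounds_if_synth_bounds[OF sub]) simp
  qed
  from condition_number_if_frame_bounds[OF this]
  show "condition_number (column_submatrix A \<tau>) \<le> ereal (sqrt 3)" by simp
qed

end

theorem theorem1p3:
  shows "\<exists>C c :: real. C > 0 \<and> c > 0 \<and>
    (\<exists>P. polynomial_time P \<and>
       produces complex_of_real P (\<lambda>(A :: real mat) \<tau>.
         real (card \<tau>) \<ge> stable_rank A \<and> spectral_norm (column_submatrix A \<tau>) \<le> C) \<and>
       produces id P (\<lambda>(A :: complex mat) \<tau>.
         real (card \<tau>) \<ge> stable_rank A \<and> spectral_norm (column_submatrix A \<tau>) \<le> C)) \<and>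
    (\<exists>P. polynomial_time P \<and>
       produces complex_of_real P (\<lambda>(A :: real mat) \<tau>.
         real (card \<tau>) \<ge> c * stable_rank A \<and>
         condition_number (column_submatrix A \<tau>) \<le> ereal (sqrt 3)) \<and>
       produces id P (\<lambda>(A :: complex mat) \<tau>.
         real (card \<tau>) \<ge> c * stable_rank A \<and>
         condition_number (column_submatrix A \<tau>) \<le> ereal (sqrt 3)))"
proof -
  \<comment> \<open>part (a) involves a single barrier, which takes both places of the selection program\<close>
  note wf = well_formed_select_columns
  note real = real_scalars.scalar_embedding_axioms
  note complex = complex_scalars.scalar_embedding_axioms
  show ?thesis
    by (rule exI[of _ 4], rule exI[of _ "1 / 1000"], intro conjI
        exI[of _ "compile (select_columns bounded_norm_barrier bounded_norm_barrier)"]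
        exI[of _ "compile (select_columns upper_barrier lower_barrier)"]
        polynomial_time_compile wf produces_compile
        bounded_norm_output[OF real] bounded_norm_output[OF complex]
        well_conditioned_output[OF real] well_conditioned_output[OF complex]) simp_all
qed

end
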